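(* Let $\omega\in\mathfrak{M}_{m,n}(\mathbb{R})$ be a vexillary partial permutation whose Rothe diagram $\mathcal{D}(\omega)$ contains $(1,1)$. Then $\overline{X}_{\omega}$ is congruent to a product $\overline{X}_{\omega_1}\times\cdots\times\overline{X}_{\omega_k}\times\mathbb{R}^N$ for some $N\geq 0$ and some vexillary partial permutations $\omega_1,\dots,\omega_k$. If, in such a decomposition, all $\omega_j$ belong to $\widetilde{\mathfrak{Gr}}_2$, then $X_{\omega}\subset\mathfrak{M}_{m,n}(\mathbb{R})$ is a minimal submanifold.
   Context: $\mathfrak{M}_{m,n}(\mathbb{R})$ is the space of real $m\times n$ matrices with the inner product $\langle A,B\rangle=\mathrm{tr}(A^TB)$. A matrix $\omega\in\mathfrak{M}_{m,n}(\mathbb{R})$ is a partial permutation if each row and each column contains at most one entry equal to $1$ and all other entries are $0$. Extension: put $a_i=j$ if $\omega_{ij}=1$ for some $j$, and $a_i=\infty$ otherwise ($1\le i\le m$). The extension $\tilde\omega\in\mathfrak{S}_{m+n}$ is defined inductively by $\tilde\omega(i)=a_i$ if $i\le m$ and $a_i\le n$; $\tilde\omega(i)=\min([n+1,m+n]\setminus\{\tilde\omega(1),\dots,\tilde\omega(i-1)\})$ if $i\le m$ and $a_i=\infty$; $\tilde\omega(i)=\min([1,m+n]\setminus\{\tilde\omega(1),\dots,\tilde\omega(i-1)\})$ if $i>m$. The Rothe diagram of $\omega$ is $\mathcal{D}(\omega)=\{(i,j)\in[1,m+n]^2 : \tilde\omega(i)>j,\ \tilde\omega^{-1}(j)>i\}\subseteq[1,m]\times[1,n]$.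 $\omega$ is vexillary if there are no $i_1<i_2<i_3<i_4$ with $\tilde\omega(i_2)<\tilde\omega(i_1)<\tilde\omega(i_4)<\tilde\omega(i_3)$. $A_{[p,q]}$ denotes the upper-left $p\times q$ submatrix of $A$. Define $\overline{X}_\omega=\{A\in\mathfrak{M}_{m,n}(\mathbb{R}) : \mathrm{rk}(A_{[p,q]})\le\mathrm{rk}(\omega_{[p,q]})\ \forall\,1\le p\le m,\ 1\le q\le n\}$ and $X_\omega=\{A : \mathrm{rk}(A_{[p,q]})=\mathrm{rk}(\omega_{[p,q]})\ \forall\,1\le p\le m,\ 1\le q\le n\}$; $X_\omega$ is an open dense subset of $\overline{X}_\omega$ and a smooth submanifold of $\mathfrak{M}_{m,n}(\mathbb{R})$. Congruent means: with $\omega_j\in\mathfrak{M}_{m_j,n_j}(\mathbb{R})$, there is a linear isometric embedding of $\mathfrak{M}_{m_1,n_1}(\mathbb{R})\times\cdots\times\mathfrak{M}_{m_k,n_k}(\mathbb{R})\times\mathbb{R}^N$ into $\mathfrak{M}_{m,n}(\mathbb{R})$ (as a linear subspace) mapping $\overline{X}_{\omega_1}\times\cdots\times\overline{X}_{\omega_k}\times\mathbb{R}^N$ onto $\overline{X}_\omega$. $\mathfrak{Gr}_2$ is the set of vexillary partial permutations (of any size) of one of the block forms $$\begin{pmatrix} I_r & O\\ O & O\end{pmatrix},\quad \begin{pmatrix} I_{r_1} & O & O & O\\ O & O & I_{r_2} & O\\ O & O & O & O\end{pmatrix},\quad \begin{pmatrix} I_{r_1} & O & O\\ O & O & O\\ O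 & I_{r_2} & O\\ O & O & O\end{pmatrix},$$ where $I_r$ is the $r\times r$ identity matrix and each $O$ is a zero matrix of appropriate size (block sizes are arbitrary). $\widetilde{\mathfrak{Gr}}_2$ is the set of partial permutations $\mu$ (of any size) such that $\mathcal{D}(\mu)=\mathcal{D}(\omega)$ for some $\omega\in\mathfrak{Gr}_2$. A submanifold is minimal if its mean curvature vector vanishes at every point. *)

theory Defs
  imports "HOL-Analysis.Analysis" "Jordan_Normal_Form.DL_Rank"
begin

section \<open>Partial permutations and their Rothe diagrams\<close>

text \<open>
  Matrices of arbitrary size are elements of \<^typ>\<open>real mat\<close>. Their entries are numbered from 0,
  whereas the rows and columns in the combinatorial notions below are numbered from 1; hence the
  shift of the indices in \<open>row_image\<close>.
\<close>

definition partial_permutation :: "real mat \<Rightarrow> bool" where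
  "partial_permutation \<omega> \<longleftrightarrow>
     (\<forall>i<dim_row \<omega>. \<forall>j<dim_col \<omega>. \<omega> $$ (i, j) = 0 \<or> \<omega> $$ (i, j) = 1) \<and>
     (\<forall>i<dim_row \<omega>. \<forall>j<dim_col \<omega>. \<forall>j'<dim_col \<omega>.
        \<omega> $$ (i, j) = 1 \<longrightarrow> \<omega> $$ (i, j') = 1 \<longrightarrow> j = j') \<and>
     (\<forall>i<dim_row \<omega>. \<forall>i'<dim_row \<omega>. \<forall>j<dim_col \<omega>.
        \<omega> $$ (i, j) = 1 \<longrightarrow> \<omega> $$ (i', j) = 1 \<longrightarrow> i = i')"

text \<open>The number \<open>a\<^sub>i\<close>, where \<open>a\<^sub>i = \<infinity>\<close> is represented by \<^const>\<open>None\<close>.\<close>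

definition row_image :: "real mat \<Rightarrow> nat \<Rightarrow> nat option" where
  "row_image \<omega> i =
     (if \<exists>j\<in>{1..dim_col \<omega>}. \<omega> $$ (i - 1, j - 1) = 1
      then Some (THE j. j \<in> {1..dim_col \<omega>} \<and> \<omega> $$ (i - 1, j - 1) = 1)
      else None)"

text \<open>The extension of \<open>\<omega>\<close>; only the values at arguments in \<open>{1..dim_row \<omega> + dim_col \<omega>}\<close> matter.\<close>

function extension :: "real mat \<Rightarrow> nat \<Rightarrow> nat" where
  "extension \<omega> i =
     (if i \<le> dim_row \<omega> then
        (case row_image \<omega> i of
           Some j \<Rightarrow> j
         | None \<Rightarrow> Min ({dim_col \<omega> + 1..dim_row \<omega> + dim_col \<omega>} - extension \<omega> ` {1..<i}))
      else Min ({1..dim_row \<omega> + dim_col \<omega>} - extension \<omega> ` {1..<i}))"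
  by pat_completeness auto
termination
  by (relation "Wellfounded.measure snd") auto

declare extension.simps [simp del]

definition rothe_diagram :: "real mat \<Rightarrow> (nat \<times> nat) set" where
  "rothe_diagram \<omega> = (let I = {1..dim_row \<omega> + dim_col \<omega>} in
     {(i, j). i \<in> I \<and> j \<in> I \<and> extension \<omega> i > j \<and> inv_into I (extension \<omega>) j > i})"

definition vexillary :: "real mat \<Rightarrow> bool" where
  "vexillary \<omega> \<longleftrightarrow>
     (\<nexists>i1 i2 i3 i4. 1 \<le> i1 \<and> i1 < i2 \<and> i2 < i3 \<and> i3 < i4 \<and> i4 \<le> dim_row \<omega> + dim_col \<omega> \<and>
        extension \<omega> i2 < extension \<omega> i1 \<and> extension \<omega> i1 < extension \<omega> i4 \<and>
        extension \<omega> i4 < extension \<omega> i3)"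

section \<open>Matrix Schubert varieties\<close>

definition upper_left :: "nat \<Rightarrow> nat \<Rightarrow> real mat \<Rightarrow> real mat" where
  "upper_left p q A = mat p q (\<lambda>(i, j). A $$ (i, j))"

definition mat_rank :: "real mat \<Rightarrow> nat" where
  "mat_rank A = vec_space.rank (dim_row A) A"

definition X_closed :: "real mat \<Rightarrow> real mat set" where
  "X_closed \<omega> = {A \<in> carrier_mat (dim_row \<omega>) (dim_col \<omega>).
     \<forall>p\<in>{1..dim_row \<omega>}. \<forall>q\<in>{1..dim_col \<omega>}.
       mat_rank (upper_left p q A) \<le> mat_rank (upper_left p q \<omega>)}"

definition X_open :: "real mat \<Rightarrow> real mat set" where
  "X_open \<omega> = {A \<in> carrier_mat (dim_row \<omega>) (dim_col \<omega>).
     \<forall>p\<in>{1..dim_row \<omega>}. \<forall>q\<in>{1..dim_col \<omega>}.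
       mat_rank (upper_left p q A) = mat_rank (upper_left p q \<omega>)}"

section \<open>Congruence with a product\<close>

text \<open>The inner product \<open>tr (A\<^sup>T B)\<close>.\<close>

definition mat_inner :: "real mat \<Rightarrow> real mat \<Rightarrow> real" where
  "mat_inner A B = (\<Sum>i<dim_col A. (transpose_mat A * B) $$ (i, i))"

text \<open>
  A point of the product of the spaces of \<open>m\<^sub>j \<times> n\<^sub>j\<close> matrices and \<open>\<real>\<^sup>N\<close> is a pair consisting of the
  list of its matrix components and a vector of dimension \<open>N\<close>.
\<close>

definition product_space where
  "product_space \<omega>s N =
     listset (map (\<lambda>\<mu>. carrier_mat (dim_row \<mu>) (dim_col \<mu>) :: real mat set) \<omega>s) \<times>
     (carrier_vec N :: real Matrix.vec set)"

definition product_X_closed where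
  "product_X_closed \<omega>s N = listset (map X_closed \<omega>s) \<times> (carrier_vec N :: real Matrix.vec set)"

definition congruent_to_product :: "real mat \<Rightarrow> real mat list \<Rightarrow> nat \<Rightarrow> bool" where
  "congruent_to_product \<omega> \<omega>s N \<longleftrightarrow>
     (\<exists>\<Phi> \<in> product_space \<omega>s N \<rightarrow> carrier_mat (dim_row \<omega>) (dim_col \<omega>).
        (\<forall>(As, v) \<in> product_space \<omega>s N. \<forall>(Bs, w) \<in> product_space \<omega>s N.
           \<Phi> (map2 (+) As Bs, v + w) = \<Phi> (As, v) + \<Phi> (Bs, w)) \<and>
        (\<forall>c. \<forall>(As, v) \<in> product_space \<omega>s N.
           \<Phi> (map (\<lambda>A. c \<cdot>\<^sub>m A) As, c \<cdot>\<^sub>v v) = c \<cdot>\<^sub>m \<Phi> (As, v)) \<and>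
        (\<forall>(As, v) \<in> product_space \<omega>s N. \<forall>(Bs, w) \<in> product_space \<omega>s N.
           mat_inner (\<Phi> (As, v)) (\<Phi> (Bs, w)) =
             (\<Sum>j<length \<omega>s. mat_inner (As ! j) (Bs ! j)) + scalar_prod v w) \<and>
        \<Phi> ` product_X_closed \<omega>s N = X_closed \<omega>)"

section \<open>The classes of partial permutations \<open>Gr2\<close> and its saturation\<close>

text \<open>The three block forms; all block sizes may be 0.\<close>

definition block_form1 :: "nat \<Rightarrow> nat \<Rightarrow> nat \<Rightarrow> real mat" where
  "block_form1 r a b = mat (r + a) (r + b) (\<lambda>(i, j). if i < r \<and> j = i then 1 else 0)"

definition block_form2 :: "nat \<Rightarrow> nat \<Rightarrow> nat \<Rightarrow> nat \<Rightarrow> nat \<Rightarrow> real mat" where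
  "block_form2 r1 r2 a b c = mat (r1 + r2 + a) (r1 + b + r2 + c)
     (\<lambda>(i, j). if i < r1 \<and> j = i \<or> r1 \<le> i \<and> i < r1 + r2 \<and> j = i + b then 1 else 0)"

definition block_form3 :: "nat \<Rightarrow> nat \<Rightarrow> nat \<Rightarrow> nat \<Rightarrow> nat \<Rightarrow> real mat" where
  "block_form3 r1 r2 a b c = mat (r1 + a + r2 + b) (r1 + r2 + c)
     (\<lambda>(i, j). if j < r1 \<and> i = j \<or> r1 \<le> j \<and> j < r1 + r2 \<and> i = j + a then 1 else 0)"

definition Gr2 :: "real mat set" where
  "Gr2 = {\<omega>. partial_permutation \<omega> \<and> vexillary \<omega> \<and>
     ((\<exists>r a b. \<omega> = block_form1 r a b) \<or>
      (\<exists>r1 r2 a b c. \<omega> = block_form2 r1 r2 a b c) \<or>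
      (\<exists>r1 r2 a b c. \<omega> = block_form3 r1 r2 a b c))}"

definition Gr2_tilde :: "real mat set" where
  "Gr2_tilde = {\<mu>. partial_permutation \<mu> \<and> (\<exists>\<omega>\<in>Gr2. rothe_diagram \<mu> = rothe_diagram \<omega>)}"

section \<open>Minimal submanifolds of Euclidean spaces\<close>

text \<open>
  \<open>Ck_on k U f\<close>: the map \<open>f\<close> is \<open>k\<close> times continuously differentiable on \<open>U\<close>. It is only used for
  open \<open>U\<close>.
\<close>

primrec Ck_on :: "nat \<Rightarrow> 'a::euclidean_space set \<Rightarrow> ('a \<Rightarrow> 'b::euclidean_space) \<Rightarrow> bool" where
  "Ck_on 0 U f \<longleftrightarrow> continuous_on U f"
| "Ck_on (Suc k) U f \<longleftrightarrow>
     (\<forall>x\<in>U. f differentiable (at x)) \<and> (\<forall>v. Ck_on k U (\<lambda>x. frechet_derivative f (at x) v))"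

definition smooth_on :: "'a::euclidean_space set \<Rightarrow> ('a \<Rightarrow> 'b::euclidean_space) \<Rightarrow> bool" where
  "smooth_on U f \<longleftrightarrow> (\<forall>k. Ck_on k U f)"

text \<open>Embedded submanifolds, by the existence of slice charts of the ambient space.\<close>

definition smooth_submanifold :: "nat \<Rightarrow> 'a::euclidean_space set \<Rightarrow> bool" where
  "smooth_submanifold d S \<longleftrightarrow>
     (\<forall>p\<in>S. \<exists>(U::'a set) (V::'a set) \<phi> \<psi> L.
        open U \<and> p \<in> U \<and> open V \<and> homeomorphism U V \<phi> \<psi> \<and> smooth_on U \<phi> \<and> smooth_on V \<psi> \<and>
        Real_Vector_Spaces.subspace L \<and> dim L = d \<and> \<phi> ` (S \<inter> U) = L \<inter> V)"

definition tangent_space :: "'a::euclidean_space set \<Rightarrow> 'a \<Rightarrow> 'a set" where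
  "tangent_space S p =
     {v. \<exists>\<gamma> \<epsilon>::real. \<epsilon> > 0 \<and> smooth_on {-\<epsilon><..<\<epsilon>} \<gamma> \<and> \<gamma> ` {-\<epsilon><..<\<epsilon>} \<subseteq> S \<and> \<gamma> 0 = p \<and>
        (\<gamma> has_vector_derivative v) (at 0)}"

definition normal_component :: "'a::euclidean_space set \<Rightarrow> 'a \<Rightarrow> 'a \<Rightarrow> 'a" where
  "normal_component S p x =
     (THE y. y \<in> orthogonal_comp (tangent_space S p) \<and> x - y \<in> tangent_space S p)"

text \<open>
  The second fundamental form \<open>(D\<^sub>v Y)\<^sup>\<bottom>\<close>, where \<open>Y\<close> is any smooth vector field defined near \<open>p\<close>
  which is tangential along \<open>S\<close> and takes the value \<open>w\<close> at \<open>p\<close>.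
\<close>

definition second_fundamental_form :: "'a::euclidean_space set \<Rightarrow> 'a \<Rightarrow> 'a \<Rightarrow> 'a \<Rightarrow> 'a" where
  "second_fundamental_form S p v w =
     (THE z. \<exists>U Y. open U \<and> p \<in> U \<and> smooth_on U Y \<and> (\<forall>q \<in> S \<inter> U. Y q \<in> tangent_space S q) \<and>
        Y p = w \<and> z = normal_component S p (frechet_derivative Y (at p) v))"

text \<open>The normalised trace of the second fundamental form.\<close>

definition mean_curvature_vector :: "'a::euclidean_space set \<Rightarrow> 'a \<Rightarrow> 'a" where
  "mean_curvature_vector S p =
     (let T = tangent_space S p;
          B = (SOME B. pairwise real_inner_class.orthogonal B \<and> (\<forall>e\<in>B. norm e = 1) \<and> span B = T)
      in (1 / real (dim T)) *\<^sub>R (\<Sum>e\<in>B. second_fundamental_form S p e e))"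

definition minimal_submanifold :: "'a::euclidean_space set \<Rightarrow> bool" where
  "minimal_submanifold S \<longleftrightarrow>
     (\<exists>d. smooth_submanifold d S) \<and> (\<forall>p\<in>S. mean_curvature_vector S p = 0)"

section \<open>The Euclidean space of matrices of a fixed size\<close>

text \<open>
  The identification of the \<open>m \<times> n\<close> matrices in \<^typ>\<open>real mat\<close> with the Euclidean space of matrices
  whose rows and columns are indexed by linearly ordered types of cardinality \<open>m\<close> and \<open>n\<close>.
\<close>

definition index_pos :: "'i::{finite,linorder} \<Rightarrow> nat" where
  "index_pos i = card {k. k < i}"

definition cart_of_mat :: "real mat \<Rightarrow> real ^ 'n::{finite,linorder} ^ 'm::{finite,linorder}" where
  "cart_of_mat A = (\<chi> i j. A $$ (index_pos i, index_pos j))"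

lemma bij_betw_index_pos: "bij_betw index_pos (UNIV :: 'i::{finite,linorder} set) {..<CARD('i)}"
proof -
  have less: "index_pos i < index_pos j" if "i < j" for i j :: 'i
    unfolding index_pos_def using that by (intro psubset_card_mono) auto
  have "inj (index_pos :: 'i \<Rightarrow> nat)"
    by (intro injI) (metis less less_irrefl neqE)
  moreover have "range (index_pos :: 'i \<Rightarrow> nat) \<subseteq> {..<CARD('i)}"
    unfolding index_pos_def by (auto intro!: psubset_card_mono)
  ultimately show ?thesis
    by (simp add: bij_betw_def card_image card_subset_eq)
qed

lemma inner_cart_of_mat:
  assumes "A \<in> carrier_mat CARD('m::{finite,linorder}) CARD('n::{finite,linorder})"
    and "B \<in> carrier_mat CARD('m) CARD('n)"
  shows "inner (cart_of_mat A :: real ^ 'n::_ ^ 'm::_) (cart_of_mat B) = mat_inner A B"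
proof -
  have "inner (cart_of_mat A :: real ^ 'n::_ ^ 'm::_) (cart_of_mat B) =
      (\<Sum>i\<in>UNIV. \<Sum>j\<in>UNIV. A $$ (index_pos (i::'m), index_pos (j::'n)) * B $$ (index_pos i, index_pos j))"
    by (simp add: inner_vec_def cart_of_mat_def)
  also have "\<dots> = (\<Sum>i\<in>UNIV. \<Sum>j<CARD('n). A $$ (index_pos (i::'m), j) * B $$ (index_pos i, j))"
    by (intro sum.cong refl sum.reindex_bij_betw [OF bij_betw_index_pos])
  also have "\<dots> = (\<Sum>i<CARD('m). \<Sum>j<CARD('n). A $$ (i, j) * B $$ (i, j))"
    by (rule sum.reindex_bij_betw [OF bij_betw_index_pos])
  also have "\<dots> = (\<Sum>j<CARD('n). \<Sum>i<CARD('m). A $$ (i, j) * B $$ (i, j))"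
    by (rule sum.swap)
  also have "\<dots> = mat_inner A B"
    using assms unfolding mat_inner_def
    by (auto simp: scalar_prod_def atLeast0LessThan intro!: sum.cong)
  finally show ?thesis .
qed

lemma bij_betw_cart_of_mat:
  "bij_betw (cart_of_mat :: real mat \<Rightarrow> real ^ 'n::{finite,linorder} ^ 'm::{finite,linorder})
     (carrier_mat CARD('m) CARD('n)) UNIV"
proof (rule bij_betw_byWitness)
  let ?g = "\<lambda>x :: real ^ 'n::_ ^ 'm::_. mat CARD('m) CARD('n)
    (\<lambda>(i, j). vec_nth (vec_nth x (inv_into UNIV index_pos i :: 'm)) (inv_into UNIV index_pos j :: 'n))"
  have inj: "inv_into UNIV index_pos (index_pos i) = i" for i :: "'i::{finite,linorder}"
    using bij_betw_index_pos by (intro inv_f_f) (auto simp: bij_betw_def)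
  have surj: "index_pos (inv_into UNIV index_pos k :: 'i) = k" if "k < CARD('i::{finite,linorder})" for k
    using bij_betw_index_pos [where 'i = 'i] that
    by (intro f_inv_into_f) (auto simp: bij_betw_def)
  have less: "index_pos (i :: 'i) < CARD('i)" for i :: "'i::{finite,linorder}"
    using bij_betw_index_pos [where 'i = 'i] by (auto simp: bij_betw_def)
  show "\<forall>A\<in>carrier_mat CARD('m) CARD('n). ?g (cart_of_mat A) = A"
    by (auto simp: cart_of_mat_def surj intro!: eq_matI)
  show "\<forall>x\<in>UNIV. cart_of_mat (?g x) = x"
    by (simp add: cart_of_mat_def vec_eq_iff inj less)
qed auto

end

theory Submission
  imports Defs
begin

text \<open>
  The decomposition exists trivially, with \<open>\<omega>\<close> itself as the only factor.

  For minimality, Gaussian elimination exhibits \<open>X\<^sub>\<omega>\<close> as the graph of a rational map over the entries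
  outside the diagram, so it is a submanifold, and it is relatively open in its closure. The mean
  curvature vector \<open>H\<close> at \<open>p\<close> is normal to \<open>X\<^sub>\<omega>\<close> and fixed by every linear isometry which fixes \<open>p\<close> and
  preserves the closure. Hence \<open>H\<close> is orthogonal to every line through \<open>p\<close> inside the closure, and to
  every direction reversed by a reflection of this kind. The given congruence transports lines and
  reflections of the factors to the closure. For a factor in the saturation of \<open>Gr2\<close>, the closure is
  given by at most two rank conditions on corner submatrices, one of which contains the other and has
  the same rows or the same columns; there, elementary operations on rows and columns supply lines,
  Householder matrices supply reflections, and together these leave no nonzero direction for \<open>H\<close>.
  In particular \<open>p\<close> need not correspond to points of the open strata \<open>X\<^sub>\<omega>\<^sub>j\<close> of the factors.
\<close>

text \<open>The obstacle is that the mean curvature cannot be taken factor by factor, since a point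
  of a factor may lie on the boundary of its stratum. So second-order data enter only through their
  symmetries, and the rest is stated for the closures, which are given by upper bounds on ranks.
  Such bounds survive multiplication by any matrix, singular ones included, which is why row and
  column operations give whole lines.

  The reflection is built from the vector to be killed. If a column \<open>x\<close> of
  \<open>H\<close> is orthogonal to all columns of the point, then left multiplication by
  \<open>I - 2 x x^T / |x|^2\<close> fixes the point and preserves the rank bounds of all corners
  with the same rows. This is where the shared rows (or columns) of the two rank conditions are
  used.

  A reflection is recorded by the set \<open>K\<close> of reversed directions and a splitting of
  each point of the closure. In this form it passes through an isometric embedding without being
  extended to the ambient space first.\<close>

no_notation scalar_prod (infix \<open>\<bullet>\<close> 70)

section \<open>Functions of class \<open>C\<^sup>k\<close>\<close>

lemma Ck_on_cong:
  assumes "open U" "\<And>x. x \<in> U \<Longrightarrow> f x = g x" "Ck_on k U f"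
  shows "Ck_on k U g"
  using assms(2,3)
proof (induction k arbitrary: f g)
  case 0
  then show ?case by (simp cong: continuous_on_cong)
next
  case (Suc k)
  have ev: "eventually (\<lambda>y. f y = g y) (nhds x)" if "x \<in> U" for x
    using assms(1) Suc.prems(1) that by (auto simp: eventually_nhds)
  have df: "(g has_derivative D) (at x)" if "x \<in> U" "(f has_derivative D) (at x)" for x D
    by (rule has_derivative_transform_within_open[OF that(2) assms(1) that(1)]) (use Suc.prems(1) in auto)
  have eq: "frechet_derivative f (at x) = frechet_derivative g (at x)" if "x \<in> U" for x
    using Suc.prems(2) df[OF that] that frechet_derivative_at frechet_derivative_works
    by (metis Ck_on.simps(2))
  show ?case
  proof (simp, intro conjI ballI allI)
    show "g differentiable at x" if "x \<in> U" for x
      using Suc.prems(2) df[OF that] that unfolding Ck_on.simps differentiable_def by blast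
    show "Ck_on k U (\<lambda>x. frechet_derivative g (at x) v)" for v
      by (rule Suc.IH[of "\<lambda>x. frechet_derivative f (at x) v"]) (use Suc.prems eq in auto)
  qed
qed

text \<open>The closure properties below are proved with this rule: it admits any formula for the
  derivative in place of the chosen \<open>frechet_derivative\<close>, since the two agree on the
  open set \<open>U\<close>.\<close>

lemma Ck_on_has_derivativeI:
  assumes "open U" "\<And>x. x \<in> U \<Longrightarrow> (f has_derivative f' x) (at x)"
    and "\<And>v. Ck_on k U (\<lambda>x. f' x v)"
  shows "Ck_on (Suc k) U f"
proof (simp, intro conjI ballI allI)
  show "f differentiable at x" if "x \<in> U" for x
    using assms(2)[OF that] unfolding differentiable_def by auto
  show "Ck_on k U (\<lambda>x. frechet_derivative f (at x) v)" for v
    by (rule Ck_on_cong[OF assms(1) _ assms(3)[of v]]) (simp add: frechet_derivative_at[OF assms(2), symmetric])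
qed

lemma Ck_on_has_derivative:
  assumes "Ck_on (Suc k) U f" "x \<in> U"
  shows "(f has_derivative frechet_derivative f (at x)) (at x)"
  using assms frechet_derivative_works by auto

lemma Ck_on_frechet: "Ck_on (Suc k) U f \<Longrightarrow> Ck_on k U (\<lambda>x. frechet_derivative f (at x) v)"
  by simp

lemma Ck_on_Suc: "Ck_on (Suc k) U f \<Longrightarrow> Ck_on k U f"
proof (induction k arbitrary: f)
  case 0
  then show ?case
    by (auto intro!: differentiable_imp_continuous_on simp: differentiable_on_def differentiable_at_withinI)
next
  case (Suc k)
  show ?case using Suc.prems Suc.IH by (metis Ck_on.simps(2))
qed

lemma Ck_on_subset: "Ck_on k U f \<Longrightarrow> V \<subseteq> U \<Longrightarrow> Ck_on k V f"
proof (induction k arbitrary: f)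
  case 0
  then show ?case by (auto intro: continuous_on_subset)
next
  case (Suc k)
  show ?case using Suc.prems Suc.IH by auto
qed

lemma Ck_on_const: "Ck_on k U (\<lambda>x. c)"
proof (induction k arbitrary: c)
  case (Suc k)
  show ?case using Suc.IH by (simp add: frechet_derivative_const[abs_def])
qed auto

lemma Ck_on_linear:
  assumes "open U" "linear f"
  shows "Ck_on k U f"
proof (cases k)
  case 0
  then show ?thesis using assms(2) by (simp add: linear_continuous_on linear_conv_bounded_linear)
next
  case (Suc l)
  have "Ck_on (Suc l) U f"
    by (rule Ck_on_has_derivativeI[OF assms(1), where f' = "\<lambda>x. f"])
      (use assms(2) in \<open>auto intro: linear_imp_has_derivative Ck_on_const\<close>)
  then show ?thesis using Suc by simp
qed

lemma Ck_on_compose_linear: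
  assumes "open U" "linear l" "Ck_on k U f"
  shows "Ck_on k U (\<lambda>x. l (f x))"
  using assms(3)
proof (induction k arbitrary: f)
  case 0
  then show ?case
    using assms(2) by (auto intro: continuous_on_compose2 linear_continuous_on[of l UNIV] simp: linear_conv_bounded_linear)
next
  case (Suc k)
  show ?case
  proof (rule Ck_on_has_derivativeI[OF assms(1)])
    show "((\<lambda>x. l (f x)) has_derivative (\<lambda>v. l (frechet_derivative f (at x) v))) (at x)" if "x \<in> U" for x
      using Ck_on_has_derivative[OF Suc.prems that] assms(2)
      by (simp add: bounded_linear.has_derivative linear_conv_bounded_linear)
    show "Ck_on k U (\<lambda>x. l (frechet_derivative f (at x) v))" for v
      using Suc by auto
  qed
qed

lemma Ck_on_add:
  assumes "open U" "Ck_on k U f" "Ck_on k U g"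
  shows "Ck_on k U (\<lambda>x. f x + g x)"
  using assms(2,3)
proof (induction k arbitrary: f g)
  case 0
  then show ?case by (auto intro: continuous_intros)
next
  case (Suc k)
  show ?case
  proof (rule Ck_on_has_derivativeI[OF assms(1)])
    show "((\<lambda>x. f x + g x) has_derivative
        (\<lambda>v. frechet_derivative f (at x) v + frechet_derivative g (at x) v)) (at x)" if "x \<in> U" for x
      using Suc.prems that by (intro has_derivative_add Ck_on_has_derivative)
    show "Ck_on k U (\<lambda>x. frechet_derivative f (at x) v + frechet_derivative g (at x) v)" for v
      using Suc by auto
  qed
qed

lemma Ck_on_sum:
  assumes "open U" "\<And>i. i \<in> I \<Longrightarrow> Ck_on k U (f i)"
  shows "Ck_on k U (\<lambda>x. \<Sum>i\<in>I. f i x)"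
  using assms(2) by (induction I rule: infinite_finite_induct) (auto intro: Ck_on_const Ck_on_add[OF assms(1)])

lemma Ck_on_scaleR:
  fixes f :: "'a::euclidean_space \<Rightarrow> real"
  assumes "open U" "Ck_on k U f" "Ck_on k U g"
  shows "Ck_on k U (\<lambda>x. f x *\<^sub>R g x)"
  using assms(2,3)
proof (induction k arbitrary: f g)
  case 0
  then show ?case by (auto intro: continuous_intros)
next
  case (Suc k)
  \<comment> \<open>The product rule keeps one factor undifferentiated, so both factors are also
    needed at order \<open>k\<close>.\<close>
  note fg = Ck_on_Suc[OF Suc.prems(1)] Ck_on_Suc[OF Suc.prems(2)]
  show ?case
  proof (rule Ck_on_has_derivativeI[OF assms(1)])
    show "((\<lambda>x. f x *\<^sub>R g x) has_derivative
        (\<lambda>v. f x *\<^sub>R frechet_derivative g (at x) v + frechet_derivative f (at x) v *\<^sub>R g x)) (at x)" if "x \<in> U" for x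
      using Suc.prems that by (intro has_derivative_scaleR Ck_on_has_derivative)
    show "Ck_on k U (\<lambda>x. f x *\<^sub>R frechet_derivative g (at x) v + frechet_derivative f (at x) v *\<^sub>R g x)" for v
      using Suc fg by (intro Ck_on_add assms(1) Suc.IH) auto
  qed
qed

lemma Ck_on_mult:
  fixes f g :: "'a::euclidean_space \<Rightarrow> real"
  assumes "open U" "Ck_on k U f" "Ck_on k U g"
  shows "Ck_on k U (\<lambda>x. f x * g x)"
  using Ck_on_scaleR[OF assms] by simp

lemma Ck_on_inverse:
  fixes f :: "'a::euclidean_space \<Rightarrow> real"
  assumes "open U" "Ck_on k U f" "\<And>x. x \<in> U \<Longrightarrow> f x \<noteq> 0"
  shows "Ck_on k U (\<lambda>x. inverse (f x))"
  using assms(2)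
proof (induction k)
  case 0
  then show ?case using assms(3) by (auto intro: continuous_intros)
next
  case (Suc k)
  note f = Ck_on_Suc[OF Suc.prems(1)]
  show ?case
  proof (rule Ck_on_has_derivativeI[OF assms(1)])
    show "((\<lambda>x. inverse (f x)) has_derivative
        (\<lambda>v. - (inverse (f x) * frechet_derivative f (at x) v * inverse (f x)))) (at x)" if "x \<in> U" for x
      by (rule Deriv.has_derivative_inverse[OF assms(3)[OF that] Ck_on_has_derivative[OF Suc.prems that]])
    have "Ck_on k U (\<lambda>x. inverse (f x) * frechet_derivative f (at x) v * inverse (f x))" for v
      using Suc f by (intro Ck_on_mult assms(1) Suc.IH) auto
    then show "Ck_on k U (\<lambda>x. - (inverse (f x) * frechet_derivative f (at x) v * inverse (f x)))" for v
      by (intro Ck_on_compose_linear[OF assms(1), of uminus]) (auto intro: linear_uminus module_hom_uminus)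
  qed
qed

lemma open_affine_vimage:
  fixes l :: "'a::euclidean_space \<Rightarrow> 'b::euclidean_space"
  assumes "open U" "linear l"
  shows "open {x. a + l x \<in> U}"
proof -
  have "continuous_on UNIV (\<lambda>x. a + l x)"
    using assms(2) by (intro continuous_intros linear_continuous_on) (simp add: linear_conv_bounded_linear)
  then show ?thesis using open_vimage[OF assms(1)] by (simp add: vimage_def)
qed

text \<open>Inner maps are only ever lines \<open>q + t v\<close> or linear reflections. Their
  derivative is constant, so the induction avoids the general chain rule of higher order.\<close>

lemma Ck_on_compose_affine:
  fixes l :: "'a::euclidean_space \<Rightarrow> 'b::euclidean_space"
  assumes "open U" "linear l" "Ck_on k U f"
  shows "Ck_on k {x. a + l x \<in> U} (\<lambda>x. f (a + l x))"
  using assms(3)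
proof (induction k arbitrary: f)
  case 0
  have "continuous_on {x. a + l x \<in> U} (\<lambda>x. a + l x)"
    using assms(2) by (intro continuous_intros linear_continuous_on) (simp add: linear_conv_bounded_linear)
  with 0 show ?case by (auto intro: continuous_on_compose2)
next
  case (Suc k)
  show ?case
  proof (rule Ck_on_has_derivativeI[OF open_affine_vimage[OF assms(1,2)]])
    fix x assume "x \<in> {x. a + l x \<in> U}"
    then have "(f has_derivative frechet_derivative f (at (a + l x))) (at (a + l x))"
      using Ck_on_has_derivative[OF Suc.prems(1)] by auto
    moreover have "((\<lambda>x. a + l x) has_derivative l) (at x)"
      using assms(2) by (auto intro!: derivative_eq_intros linear_imp_has_derivative)
    ultimately show "((\<lambda>x. f (a + l x)) has_derivative (\<lambda>v. frechet_derivative f (at (a + l x)) (l v))) (at x)"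
      using diff_chain_at by (fastforce simp: o_def)
  next
    show "Ck_on k {x. a + l x \<in> U} (\<lambda>x. frechet_derivative f (at (a + l x)) (l v))" for v
      using Suc by (intro Suc.IH) auto
  qed
qed

lemma smooth_on_compose_linear:
  "open U \<Longrightarrow> linear l \<Longrightarrow> smooth_on U f \<Longrightarrow> smooth_on U (\<lambda>x. l (f x))"
  unfolding smooth_on_def by (blast intro: Ck_on_compose_linear)

lemma smooth_on_subset: "smooth_on U f \<Longrightarrow> V \<subseteq> U \<Longrightarrow> smooth_on V f"
  unfolding smooth_on_def by (blast intro: Ck_on_subset)

lemma smooth_on_compose_affine:
  fixes l :: "'a::euclidean_space \<Rightarrow> 'b::euclidean_space"
  shows "open U \<Longrightarrow> linear l \<Longrightarrow> smooth_on U f \<Longrightarrow> smooth_on {x. a + l x \<in> U} (\<lambda>x. f (a + l x))"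
  unfolding smooth_on_def by (blast intro: Ck_on_compose_affine)

lemma smooth_on_linear: "open U \<Longrightarrow> linear f \<Longrightarrow> smooth_on U f"
  unfolding smooth_on_def by (blast intro: Ck_on_linear)

lemma smooth_on_const: "smooth_on U (\<lambda>x. c)"
  unfolding smooth_on_def by (blast intro: Ck_on_const)

lemma smooth_on_add: "open U \<Longrightarrow> smooth_on U f \<Longrightarrow> smooth_on U g \<Longrightarrow> smooth_on U (\<lambda>x. f x + g x)"
  unfolding smooth_on_def by (blast intro: Ck_on_add)

lemma smooth_on_sum: "open U \<Longrightarrow> (\<And>i. i \<in> I \<Longrightarrow> smooth_on U (f i)) \<Longrightarrow> smooth_on U (\<lambda>x. \<Sum>i\<in>I. f i x)"
  unfolding smooth_on_def by (blast intro: Ck_on_sum)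

lemma smooth_on_scaleR:
  fixes f :: "'a::euclidean_space \<Rightarrow> real"
  shows "open U \<Longrightarrow> smooth_on U f \<Longrightarrow> smooth_on U g \<Longrightarrow> smooth_on U (\<lambda>x. f x *\<^sub>R g x)"
  unfolding smooth_on_def by (blast intro: Ck_on_scaleR)

lemma smooth_on_mult:
  fixes f g :: "'a::euclidean_space \<Rightarrow> real"
  shows "open U \<Longrightarrow> smooth_on U f \<Longrightarrow> smooth_on U g \<Longrightarrow> smooth_on U (\<lambda>x. f x * g x)"
  unfolding smooth_on_def by (blast intro: Ck_on_mult)

lemma smooth_on_diff: "open U \<Longrightarrow> smooth_on U f \<Longrightarrow> smooth_on U g \<Longrightarrow> smooth_on U (\<lambda>x. f x - g x)"
  using smooth_on_add[of U f "\<lambda>x. - g x"] smooth_on_compose_linear[of U uminus g]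
  by (simp add: linear_uminus module_hom_uminus)

lemma smooth_on_divide:
  fixes f g :: "'a::euclidean_space \<Rightarrow> real"
  assumes "open U" "smooth_on U f" "smooth_on U g" "\<And>x. x \<in> U \<Longrightarrow> g x \<noteq> 0"
  shows "smooth_on U (\<lambda>x. f x / g x)"
  using assms unfolding smooth_on_def divide_inverse by (simp add: Ck_on_mult Ck_on_inverse)

lemma smooth_on_has_derivative:
  "smooth_on U f \<Longrightarrow> x \<in> U \<Longrightarrow> (f has_derivative frechet_derivative f (at x)) (at x)"
  using Ck_on_has_derivative unfolding smooth_on_def by blast

lemma smooth_on_frechet: "smooth_on U f \<Longrightarrow> smooth_on U (\<lambda>x. frechet_derivative f (at x) v)"
  unfolding smooth_on_def using Ck_on_frechet by blast

lemma smooth_on_continuous: "smooth_on U f \<Longrightarrow> continuous_on U f"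
  unfolding smooth_on_def by (metis Ck_on.simps(1))

section \<open>Submanifolds that are graphs\<close>

text \<open>\<open>\<pi>\<close> is a linear projection, \<open>U\<close> a union of its fibres, and
  \<open>F\<close> is constant along the fibres with values in the kernel. So \<open>S\<close> is
  the graph of \<open>F\<close> over the part of the range of \<open>\<pi>\<close> in
  \<open>U\<close>, expressed without leaving the ambient type.\<close>

locale graph_submanifold =
  fixes \<pi> F :: "'a::euclidean_space \<Rightarrow> 'a" and U S :: "'a set"
  assumes linear_proj: "linear \<pi>"
    and proj_proj: "\<pi> (\<pi> x) = \<pi> x"
    and open_U: "open U"
    and proj_U: "\<pi> x \<in> U \<longleftrightarrow> x \<in> U"
    and smooth_F: "smooth_on U F"
    and F_proj: "F (\<pi> x) = F x"
    and proj_F: "\<pi> (F x) = 0"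
    and S_eq: "S = {x \<in> U. x - \<pi> x = F x}"
begin

abbreviation DF where "DF q \<equiv> frechet_derivative F (at q)"

lemma proj_add: "\<pi> (x + y) = \<pi> x + \<pi> y" and proj_diff: "\<pi> (x - y) = \<pi> x - \<pi> y"
  and proj_scaleR: "\<pi> (c *\<^sub>R x) = c *\<^sub>R \<pi> x"
  using linear_proj by (auto simp: linear_add linear_diff linear_scale)

lemma F_cong: "\<pi> x = \<pi> y \<Longrightarrow> F x = F y"
  by (metis F_proj)

lemma U_cong: "\<pi> x = \<pi> y \<Longrightarrow> x \<in> U \<longleftrightarrow> y \<in> U"
  by (metis proj_U)

lemma S_subset_U: "S \<subseteq> U"
  using S_eq by auto

lemma DF: "q \<in> U \<Longrightarrow> (F has_derivative DF q) (at q)"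
  by (rule smooth_on_has_derivative[OF smooth_F])

lemma linear_DF: "q \<in> U \<Longrightarrow> linear (DF q)"
  by (rule has_derivative_linear[OF DF])

lemma has_derivative_proj: "(\<pi> has_derivative \<pi>) (at q)"
  using linear_proj by (simp add: linear_imp_has_derivative)

lemma DF_proj:
  assumes "q \<in> U" shows "DF q (\<pi> x) = DF q x"
proof -
  have "(F has_derivative DF (\<pi> q)) (at (\<pi> q))"
    using assms proj_U DF by blast
  then have "((F \<circ> \<pi>) has_derivative (DF (\<pi> q) \<circ> \<pi>)) (at q)"
    using diff_chain_at[OF has_derivative_proj] by blast
  then have "(F has_derivative (DF (\<pi> q) \<circ> \<pi>)) (at q)"
    by (simp add: o_def F_proj)
  then have "DF q = DF (\<pi> q) \<circ> \<pi>"
    using DF[OF assms] has_derivative_unique by blast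
  then show ?thesis by (simp add: proj_proj)
qed

lemma proj_DF:
  assumes "q \<in> U" shows "\<pi> (DF q x) = 0"
proof -
  have "((\<pi> \<circ> F) has_derivative (\<pi> \<circ> DF q)) (at q)"
    by (rule diff_chain_at[OF DF[OF assms] has_derivative_proj])
  then have "((\<lambda>x. 0) has_derivative (\<pi> \<circ> DF q)) (at q)"
    by (simp add: o_def proj_F)
  then show ?thesis
    using has_derivative_unique[OF _ has_derivative_const] by (metis comp_apply)
qed

text \<open>The point of the graph in the fibre of \<open>y\<close>; it turns lines in
  \<open>U\<close> into curves in \<open>S\<close>.\<close>

definition lift where "lift y = \<pi> y + F y"

lemma lift_mem: "y \<in> U \<Longrightarrow> lift y \<in> S"
  unfolding lift_def S_eq
  by (auto simp: proj_add proj_F proj_proj intro: F_cong U_cong[THEN iffD1, of y])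

text \<open>The shear \<open>x - F x\<close> flattens the graph onto the range of
  \<open>\<pi>\<close>. It preserves \<open>\<pi> x\<close>, hence also \<open>F x\<close>, so its
  inverse is \<open>x + F x\<close>.\<close>

lemma smooth_submanifold_graph: "\<exists>d. smooth_submanifold d S"
proof -
  define \<phi> where "\<phi> x = x - F x" for x
  define \<psi> where "\<psi> x = x + F x" for x
  define L where "L = range \<pi>"
  have L_iff: "x \<in> L \<longleftrightarrow> \<pi> x = x" for x
    unfolding L_def using proj_proj by (metis rangeE rangeI)
  have phi: "\<pi> (\<phi> x) = \<pi> x" "\<pi> (\<psi> x) = \<pi> x" for x
    by (auto simp: \<phi>_def \<psi>_def proj_diff proj_add proj_F)
  have inv: "\<psi> (\<phi> x) = x" "\<phi> (\<psi> x) = x" for x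
    using F_cong[OF phi(1), of x] F_cong[OF phi(2), of x]
    unfolding \<phi>_def[of "\<psi> x"] \<psi>_def[of "\<phi> x"] by (auto simp: \<phi>_def[of x] \<psi>_def[of x])
  have U: "\<phi> x \<in> U \<longleftrightarrow> x \<in> U" "\<psi> x \<in> U \<longleftrightarrow> x \<in> U" for x
    using U_cong phi by blast+
  have sm: "smooth_on U \<phi>" "smooth_on U \<psi>"
    unfolding \<phi>_def \<psi>_def
    by (rule smooth_on_diff smooth_on_add; rule open_U smooth_F smooth_on_linear[OF open_U linear_ident])+
  have "x \<in> \<phi> ` U" "x \<in> \<psi> ` U" if "x \<in> U" for x
    using that inv U by (metis imageI)+
  then have "\<phi> ` U = U" "\<psi> ` U = U"
    using U by auto
  then have homeo: "homeomorphism U U \<phi> \<psi>"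
    unfolding homeomorphism_def using inv sm by (auto intro: smooth_on_continuous)
  have img: "\<phi> ` (S \<inter> U) = L \<inter> U"
  proof
    show "\<phi> ` (S \<inter> U) \<subseteq> L \<inter> U"
    proof
      fix y assume "y \<in> \<phi> ` (S \<inter> U)"
      then obtain x where x: "x \<in> S" "x \<in> U" "y = \<phi> x" by auto
      then have "F x = x - \<pi> x" unfolding S_eq by simp
      then have "y = \<pi> x" using x by (simp add: \<phi>_def)
      then show "y \<in> L \<inter> U" using x(2) by (simp add: L_def proj_U)
    qed
    show "L \<inter> U \<subseteq> \<phi> ` (S \<inter> U)"
    proof
      fix y assume y: "y \<in> L \<inter> U"
      then have "\<psi> y = lift y" using L_iff by (auto simp: lift_def \<psi>_def)
      then have "\<psi> y \<in> S \<inter> U" using lift_mem y S_subset_U by auto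
      then show "y \<in> \<phi> ` (S \<inter> U)" using inv by (metis imageI)
    qed
  qed
  have subL: "Real_Vector_Spaces.subspace L"
    unfolding L_def using linear_proj linear_subspace_image[OF linear_proj subspace_UNIV] by simp
  show ?thesis
    unfolding smooth_submanifold_def
    by (intro exI[of _ "dim L"] ballI exI[of _ U] exI[of _ \<phi>] exI[of _ \<psi>] exI[of _ L] conjI)
      (use S_subset_U open_U homeo sm img subL in auto)
qed

text \<open>Differentiating the graph equation along a curve gives one inclusion. Conversely, a
  solution \<open>v\<close> is the velocity of the lifted line through \<open>q\<close>.\<close>

lemma tangent_space_graph:
  assumes q: "q \<in> S"
  shows "tangent_space S q = {v. v - \<pi> v = DF q v}"
proof (intro equalityI subsetI)
  have qU: "q \<in> U" using q S_subset_U by auto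
  fix v
  {
    assume "v \<in> tangent_space S q"
    then obtain \<gamma> \<epsilon> where g: "(\<epsilon>::real) > 0" "\<gamma> ` {-\<epsilon><..<\<epsilon>} \<subseteq> S" "\<gamma> 0 = q"
      "(\<gamma> has_vector_derivative v) (at 0)"
      unfolding tangent_space_def by auto
    have gd: "(\<gamma> has_derivative (\<lambda>h. h *\<^sub>R v)) (at 0)"
      using g(4) by (simp add: has_vector_derivative_def)
    have 1: "((\<pi> \<circ> \<gamma>) has_derivative (\<pi> \<circ> (\<lambda>h. h *\<^sub>R v))) (at 0)"
      by (rule diff_chain_at[OF gd has_derivative_proj])
    have 2: "((F \<circ> \<gamma>) has_derivative (DF q \<circ> (\<lambda>h. h *\<^sub>R v))) (at 0)"
      by (rule diff_chain_at[OF gd]) (use g(3) DF[OF qU] in simp)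
    have "((\<lambda>t. \<gamma> t - (\<pi> \<circ> \<gamma>) t - (F \<circ> \<gamma>) t) has_derivative
        (\<lambda>h. h *\<^sub>R v - (\<pi> \<circ> (\<lambda>h. h *\<^sub>R v)) h - (DF q \<circ> (\<lambda>h. h *\<^sub>R v)) h)) (at 0)"
      by (intro has_derivative_diff gd 1 2)
    moreover have "((\<lambda>t. \<gamma> t - (\<pi> \<circ> \<gamma>) t - (F \<circ> \<gamma>) t) has_derivative (\<lambda>h. 0)) (at 0)"
    proof (rule has_derivative_transform_within_open[of "\<lambda>x. 0" _ _ _ "{-\<epsilon><..<\<epsilon>}"])
      fix t assume "t \<in> {- \<epsilon><..<\<epsilon>}"
      then have "\<gamma> t \<in> S" using g(2) by blast
      then show "0 = \<gamma> t - (\<pi> \<circ> \<gamma>) t - (F \<circ> \<gamma>) t" unfolding S_eq by simp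
    qed (use g(1) in auto)
    ultimately have "(\<lambda>h. h *\<^sub>R v - (\<pi> \<circ> (\<lambda>h. h *\<^sub>R v)) h - (DF q \<circ> (\<lambda>h. h *\<^sub>R v)) h) = (\<lambda>h. 0)"
      using has_derivative_unique by blast
    from fun_cong[OF this, of 1] show "v \<in> {v. v - \<pi> v = DF q v}" by simp
  next
    assume v: "v \<in> {v. v - \<pi> v = DF q v}"
    define W where "W = {t::real. q + t *\<^sub>R v \<in> U}"
    have lin: "linear (\<lambda>t::real. t *\<^sub>R v)" by (simp add: linear_iff scaleR_add_left)
    have "open W" unfolding W_def by (rule open_affine_vimage[OF open_U lin])
    moreover have "0 \<in> W" using qU by (simp add: W_def)
    ultimately obtain e where e: "e > 0" "ball 0 e \<subseteq> W" using open_contains_ball by blast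
    then have eW: "{-e<..<e} \<subseteq> W" by (auto simp: ball_eq_greaterThanLessThan)
    \<comment> \<open>This is the lift of \<open>q + t v\<close>, expanded so that smoothness and
      derivative can be read off term by term.\<close>
    define \<gamma> where "\<gamma> t = \<pi> q + t *\<^sub>R \<pi> v + F (q + t *\<^sub>R v)" for t
    have lift: "\<gamma> t = lift (q + t *\<^sub>R v)" for t
      by (simp add: \<gamma>_def lift_def proj_add proj_scaleR)
    have "smooth_on W \<gamma>" unfolding \<gamma>_def W_def
      by (intro smooth_on_add open_affine_vimage[OF open_U lin] smooth_on_compose_affine[OF open_U lin smooth_F]
          smooth_on_const smooth_on_linear) (simp add: linear_iff scaleR_add_left)
    moreover have "\<gamma> 0 = q"
    proof -
      have "F q = q - \<pi> q" using q by (simp add: S_eq)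
      then show ?thesis by (simp add: \<gamma>_def)
    qed
    moreover have "(\<gamma> has_vector_derivative v) (at 0)"
    proof -
      have "((\<lambda>t. q + t *\<^sub>R v) has_derivative (\<lambda>t. t *\<^sub>R v)) (at 0)"
        by (auto intro!: derivative_eq_intros)
      then have "((F \<circ> (\<lambda>t. q + t *\<^sub>R v)) has_derivative (DF q \<circ> (\<lambda>t. t *\<^sub>R v))) (at 0)"
        by (rule diff_chain_at) (use DF[OF qU] in simp)
      then have "((\<lambda>t. F (q + t *\<^sub>R v)) has_derivative (\<lambda>t. t *\<^sub>R DF q v)) (at 0)"
        using linear_DF[OF qU] by (simp add: o_def linear_scale)
      then have "(\<gamma> has_derivative (\<lambda>t. 0 + t *\<^sub>R \<pi> v + t *\<^sub>R DF q v)) (at 0)"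
        unfolding \<gamma>_def by (intro has_derivative_add has_derivative_const has_derivative_scaleR_left has_derivative_ident)
      moreover have "(\<lambda>t. 0 + t *\<^sub>R \<pi> v + t *\<^sub>R DF q v) = (\<lambda>t. t *\<^sub>R v)"
      proof
        fix t have "v = \<pi> v + DF q v" using v by (auto simp: algebra_simps)
        then show "0 + t *\<^sub>R \<pi> v + t *\<^sub>R DF q v = t *\<^sub>R v" by (metis add_0 scaleR_add_right)
      qed
      ultimately show ?thesis by (simp add: has_vector_derivative_def)
    qed
    moreover have "\<gamma> ` {-e<..<e} \<subseteq> S" using lift lift_mem eW by (auto simp: W_def)
    ultimately show "v \<in> tangent_space S q"
      unfolding tangent_space_def using e(1) eW smooth_on_subset by blast
  }
qed

lemma subspace_tangent_space:
  assumes "q \<in> S" shows "Real_Vector_Spaces.subspace (tangent_space S q)"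
proof -
  have "linear (DF q)" using assms S_subset_U linear_DF by auto
  then have "linear (\<lambda>v. v - \<pi> v - DF q v)"
    by (intro linear_compose_sub linear_ident linear_proj)
  from linear_subspace_kernel[OF this] show ?thesis
    by (simp add: tangent_space_graph[OF assms])
qed

text \<open>At a point of the graph, this is the tangent vector with projection
  \<open>\<pi> w\<close>. It is the standard extension of a tangent vector \<open>w\<close> to a
  tangential field.\<close>

definition tangent_field where "tangent_field w q = \<pi> w + DF q w"

lemma smooth_tangent_field: "smooth_on U (tangent_field w)"
  unfolding tangent_field_def[abs_def]
  by (intro smooth_on_add open_U smooth_on_const smooth_on_frechet smooth_F)

lemma tangent_field_base: "p \<in> S \<Longrightarrow> w \<in> tangent_space S p \<Longrightarrow> tangent_field w p = w"
  by (auto simp: tangent_space_graph tangent_field_def algebra_simps)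

lemma tangent_field_tangent:
  assumes "q \<in> S" shows "tangent_field w q \<in> tangent_space S q"
proof -
  have qU: "q \<in> U" using assms S_subset_U by auto
  have *: "\<pi> (tangent_field w q) = \<pi> w"
    by (simp add: tangent_field_def proj_add proj_proj proj_DF[OF qU])
  then have "DF q (tangent_field w q) = DF q w" using DF_proj[OF qU] by metis
  then show ?thesis using assms * by (simp add: tangent_space_graph tangent_field_def)
qed

text \<open>The tangent bundle is closed over \<open>S\<close>, because the linear equation of the
  tangent space varies continuously with the base point.\<close>

lemma tangent_space_limit:
  assumes p: "p \<in> S" and ev: "eventually (\<lambda>t. q t \<in> S \<and> x t \<in> tangent_space S (q t)) G"
    and q: "(q \<longlongrightarrow> p) G" and x: "(x \<longlongrightarrow> y) G" and G: "G \<noteq> bot"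
  shows "y \<in> tangent_space S p"
proof -
  have pU: "p \<in> U" using p S_subset_U by auto
  \<comment> \<open>Continuity of the derivative is known only for fixed directions, hence the
    expansion over \<open>Basis\<close>.\<close>
  have DF_sum: "DF r z = (\<Sum>b\<in>Basis. (z \<bullet> b) *\<^sub>R DF r b)" if "r \<in> U" for r z
  proof -
    have "DF r z = DF r (\<Sum>b\<in>Basis. (z \<bullet> b) *\<^sub>R b)" by (simp add: euclidean_representation)
    also have "\<dots> = (\<Sum>b\<in>Basis. (z \<bullet> b) *\<^sub>R DF r b)"
      using linear_DF[OF that] by (simp add: linear_sum linear_scale)
    finally show ?thesis .
  qed
  have "continuous (at p) (\<lambda>r. DF r b)" for b
    using smooth_on_continuous[OF smooth_on_frechet[OF smooth_F]] open_U pU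
    by (simp add: continuous_on_eq_continuous_at)
  then have "((\<lambda>t. DF (q t) b) \<longlongrightarrow> DF p b) G" for b
    by (rule isCont_tendsto_compose[where g = "\<lambda>r. DF r b", OF _ q])
  then have "((\<lambda>t. \<Sum>b\<in>Basis. (x t \<bullet> b) *\<^sub>R DF (q t) b) \<longlongrightarrow> (\<Sum>b\<in>Basis. (y \<bullet> b) *\<^sub>R DF p b)) G"
    by (intro tendsto_sum tendsto_scaleR tendsto_inner x tendsto_const)
  then have 1: "((\<lambda>t. \<Sum>b\<in>Basis. (x t \<bullet> b) *\<^sub>R DF (q t) b) \<longlongrightarrow> DF p y) G"
    using DF_sum[OF pU, of y] by metis
  have "continuous (at y) \<pi>" using linear_proj by (simp add: linear_continuous_at linear_conv_bounded_linear)
  then have 2: "((\<lambda>t. x t - \<pi> (x t)) \<longlongrightarrow> y - \<pi> y) G"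
    by (intro tendsto_diff x isCont_tendsto_compose[where g = \<pi>])
  have "eventually (\<lambda>t. (\<Sum>b\<in>Basis. (x t \<bullet> b) *\<^sub>R DF (q t) b) = x t - \<pi> (x t)) G"
    using ev
  proof eventually_elim
    case (elim t)
    then show ?case using tangent_space_graph DF_sum[of "q t" "x t"] S_subset_U by auto
  qed
  then have "((\<lambda>t. x t - \<pi> (x t)) \<longlongrightarrow> DF p y) G" using 1 tendsto_cong by fast
  then have "y - \<pi> y = DF p y" using 2 tendsto_unique[OF G] by blast
  then show ?thesis by (simp add: tangent_space_graph[OF p])
qed

end

section \<open>The mean curvature and reflections\<close>

lemma norm_1_pairwise_orthogonal_finite:
  fixes B :: "'a::euclidean_space set"
  assumes "pairwise real_inner_class.orthogonal B" "\<And>e. e \<in> B \<Longrightarrow> norm e = 1"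
  shows "finite B"
  using assms by (metis independent_imp_finite norm_zero pairwise_orthogonal_independent zero_neq_one)

text \<open>The basis in \<open>mean_curvature_vector\<close> is an arbitrary choice, and a
  reflection moves it to another one. Expanding \<open>B\<close> in \<open>B'\<close> and applying
  Parseval in \<open>B\<close> absorbs the difference.\<close>

lemma trace_orthonormal_basis:
  fixes h :: "'a::euclidean_space \<Rightarrow> 'a \<Rightarrow> 'b::real_vector"
  assumes h: "bilinear h"
    and B: "pairwise real_inner_class.orthogonal B" "\<And>e. e \<in> B \<Longrightarrow> norm e = 1"
    and B': "pairwise real_inner_class.orthogonal B'" "\<And>e. e \<in> B' \<Longrightarrow> norm e = 1"
    and span: "span B = span B'"
  shows "(\<Sum>e\<in>B. h e e) = (\<Sum>e\<in>B'. h e e)"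
proof -
  have fin: "finite B" "finite B'"
    using norm_1_pairwise_orthogonal_finite B B' by blast+
  have expand: "(\<Sum>f\<in>B'. (e \<bullet> f) *\<^sub>R f) = e" if "e \<in> B" for e
    by (rule orthonormal_basis_expand[OF B' _ fin(2)]) (use span span_base that in auto)
  have parseval: "(\<Sum>e\<in>B. (e \<bullet> f) * (e \<bullet> g)) = f \<bullet> g" if "f \<in> B'" for f g
  proof -
    have "(\<Sum>e\<in>B. (f \<bullet> e) *\<^sub>R e) = f"
      by (rule orthonormal_basis_expand[OF B _ fin(1)]) (use span span_base that in auto)
    then have "f \<bullet> g = (\<Sum>e\<in>B. (f \<bullet> e) *\<^sub>R e) \<bullet> g" by simp
    also have "\<dots> = (\<Sum>e\<in>B. (e \<bullet> f) * (e \<bullet> g))" by (simp add: inner_sum_left inner_commute[of f])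
    finally show ?thesis by simp
  qed
  have hs: "h (c *\<^sub>R x) (d *\<^sub>R y) = (c * d) *\<^sub>R h x y" for c d x y
    using bilinear_lmul[OF h] bilinear_rmul[OF h] by simp
  have "(\<Sum>e\<in>B. h e e) = (\<Sum>e\<in>B. \<Sum>(f, g)\<in>B' \<times> B'. ((e \<bullet> f) * (e \<bullet> g)) *\<^sub>R h f g)"
  proof (rule sum.cong[OF refl])
    fix e assume e: "e \<in> B"
    have "h e e = h (\<Sum>f\<in>B'. (e \<bullet> f) *\<^sub>R f) (\<Sum>f\<in>B'. (e \<bullet> f) *\<^sub>R f)"
      using expand[OF e] by simp
    then show "h e e = (\<Sum>(f, g)\<in>B' \<times> B'. ((e \<bullet> f) * (e \<bullet> g)) *\<^sub>R h f g)"
      by (simp add: bilinear_sum[OF h] hs)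
  qed
  also have "\<dots> = (\<Sum>(f, g)\<in>B' \<times> B'. (\<Sum>e\<in>B. (e \<bullet> f) * (e \<bullet> g)) *\<^sub>R h f g)"
    by (subst sum.swap) (simp add: scaleR_sum_left case_prod_unfold)
  also have "\<dots> = (\<Sum>f\<in>B'. \<Sum>g\<in>B'. (f \<bullet> g) *\<^sub>R h f g)"
    by (simp add: sum.cartesian_product[symmetric] parseval cong: sum.cong)
  also have "\<dots> = (\<Sum>f\<in>B'. h f f)"
  proof (rule sum.cong[OF refl])
    fix f assume f: "f \<in> B'"
    have "(f \<bullet> g) *\<^sub>R h f g = (if g = f then h f f else 0)" if "g \<in> B'" for g
    proof (cases "g = f")
      case True
      then show ?thesis using B'(2)[OF f] by (simp add: norm_eq_1)
    next
      case False
      then have "f \<bullet> g = 0" using B'(1) f that by (auto simp: pairwise_def real_inner_class.orthogonal_def)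
      then show ?thesis using False by simp
    qed
    then show "(\<Sum>g\<in>B'. (f \<bullet> g) *\<^sub>R h f g) = h f f" using f fin by simp
  qed
  finally show ?thesis .
qed

text \<open>If \<open>P\<close> is the orthogonal projection onto the span of \<open>K\<close>, the
  reflection is \<open>1 - 2 P\<close>; it is isometric because \<open>P\<close> is symmetric and
  idempotent.\<close>

lemma reflection_exists:
  fixes K :: "'a::euclidean_space set"
  obtains \<sigma> where "linear \<sigma>" "\<And>x. \<sigma> (\<sigma> x) = x" "\<And>x y. \<sigma> x \<bullet> \<sigma> y = x \<bullet> y"
    "\<And>x. x \<in> span K \<Longrightarrow> \<sigma> x = - x" "\<And>x. (\<And>k. k \<in> K \<Longrightarrow> x \<bullet> k = 0) \<Longrightarrow> \<sigma> x = x"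
proof -
  obtain B where B: "B \<subseteq> span K" "pairwise real_inner_class.orthogonal B" "\<And>x. x \<in> B \<Longrightarrow> norm x = 1"
    and spB: "span B = span K"
    using orthonormal_basis_subspace[OF subspace_span[of K]] by (metis span_span)
  have fin: "finite B" by (rule norm_1_pairwise_orthogonal_finite) (use B in auto)
  define P where "P x = (\<Sum>b\<in>B. (x \<bullet> b) *\<^sub>R b)" for x
  have Pin: "P x \<in> span K" for x
    unfolding P_def using B(1) by (intro span_sum span_scale) auto
  have Pid: "P x = x" if "x \<in> span K" for x
    unfolding P_def by (rule orthonormal_basis_expand[OF B(2,3) _ fin]) (use that spB in auto)
  have P0: "P x = 0" if "\<And>k. k \<in> K \<Longrightarrow> x \<bullet> k = 0" for x
  proof -
    have "real_inner_class.orthogonal x b" if "b \<in> span K" for b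
      by (rule orthogonal_to_span[OF that]) (simp add: real_inner_class.orthogonal_def \<open>\<And>k. k \<in> K \<Longrightarrow> x \<bullet> k = 0\<close>)
    then show ?thesis
      unfolding P_def using B(1) by (intro sum.neutral) (auto simp: real_inner_class.orthogonal_def)
  qed
  have Psym: "P x \<bullet> y = x \<bullet> P y" for x y
    unfolding P_def by (simp add: inner_sum_left inner_sum_right inner_commute mult.commute)
  have linP: "linear P"
    unfolding P_def by (rule linearI) (simp_all add: inner_add_left scaleR_add_left sum.distrib scaleR_sum_right)
  define \<sigma> where "\<sigma> x = x - 2 *\<^sub>R P x" for x
  note Padd = linear_add[OF linP] linear_diff[OF linP] linear_scale[OF linP]
  show thesis
  proof
    show "linear \<sigma>" unfolding \<sigma>_def
      by (rule linearI) (simp_all add: Padd algebra_simps)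
    show "\<sigma> (\<sigma> x) = x" for x
      by (simp add: \<sigma>_def Padd Pid[OF Pin] algebra_simps) (simp flip: scaleR_add_left)
    show "\<sigma> x \<bullet> \<sigma> y = x \<bullet> y" for x y
    proof -
      have "P x \<bullet> P y = P x \<bullet> y" using Psym[of "P x" y] Pid[OF Pin] by simp
      then show ?thesis by (simp add: \<sigma>_def inner_diff_left inner_diff_right Psym)
    qed
    show "\<sigma> x = - x" if "x \<in> span K" for x
      using Pid[OF that] by (simp add: \<sigma>_def scaleR_2)
    show "\<sigma> x = x" if "\<And>k. k \<in> K \<Longrightarrow> x \<bullet> k = 0" for x
      using P0[OF that] by (simp add: \<sigma>_def)
  qed
qed

section \<open>The second fundamental form of a graph and its symmetries\<close>

context graph_submanifold
begin

text \<open>The orthogonal splitting along the tangent space makes the definite description unique.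
  Later proofs identify normal components through the third claim.\<close>

lemma normal_component:
  assumes "p \<in> S"
  shows "normal_component S p x \<in> orthogonal_comp (tangent_space S p)"
    and "x - normal_component S p x \<in> tangent_space S p"
    and "\<lbrakk>y \<in> orthogonal_comp (tangent_space S p); x - y \<in> tangent_space S p\<rbrakk> \<Longrightarrow> normal_component S p x = y"
proof -
  let ?T = "tangent_space S p"
  note sub = subspace_tangent_space[OF assms]
  have uniq: "y = z" if "y \<in> orthogonal_comp ?T \<and> x - y \<in> ?T" "z \<in> orthogonal_comp ?T \<and> x - z \<in> ?T" for y z
  proof -
    have "z - y \<in> ?T" using Real_Vector_Spaces.subspace_diff[OF sub, of "x - y" "x - z"] that by simp
    moreover have "z - y \<in> orthogonal_comp ?T"
      using that by (simp add: Real_Vector_Spaces.subspace_diff subspace_orthogonal_comp)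
    ultimately have "(z - y) \<bullet> (z - y) = 0"
      by (auto simp: orthogonal_comp_def real_inner_class.orthogonal_def)
    then show ?thesis by simp
  qed
  obtain y z where yz: "y \<in> span ?T" "\<And>w. w \<in> span ?T \<Longrightarrow> real_inner_class.orthogonal z w" "x = y + z"
    using orthogonal_subspace_decomp_exists by blast
  have "span ?T = ?T" using sub by (rule span_eq_iff[THEN iffD2])
  note yz' = yz[unfolded this]
  have "x - z \<in> ?T" using yz'(1,3) by simp
  then have z: "z \<in> orthogonal_comp ?T \<and> x - z \<in> ?T"
    using yz'(2) orthogonal_commute by (auto simp: orthogonal_comp_def)
  then have nc: "normal_component S p x = z"
    unfolding normal_component_def using uniq by (intro the_equality) auto
  show "normal_component S p x \<in> orthogonal_comp ?T" "x - normal_component S p x \<in> ?T"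
    using z nc by auto
  show "\<lbrakk>y \<in> orthogonal_comp ?T; x - y \<in> ?T\<rbrakk> \<Longrightarrow> normal_component S p x = y" for y
    using z nc uniq by blast
qed

lemma linear_normal_component:
  assumes "p \<in> S" shows "linear (normal_component S p)"
proof (rule linearI)
  note sub = subspace_tangent_space[OF assms] and nc = normal_component[OF assms]
  fix x y c
  have "x + y - (normal_component S p x + normal_component S p y) \<in> tangent_space S p"
    using Real_Vector_Spaces.subspace_add[OF sub nc(2)[of x] nc(2)[of y]] by (simp add: algebra_simps)
  then show "normal_component S p (x + y) = normal_component S p x + normal_component S p y"
    by (intro nc(3) Real_Vector_Spaces.subspace_add subspace_orthogonal_comp nc(1))
  have "c *\<^sub>R x - c *\<^sub>R normal_component S p x \<in> tangent_space S p"
    using Real_Vector_Spaces.subspace_scale[OF sub nc(2)[of x], of c] by (simp add: algebra_simps)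
  then show "normal_component S p (c *\<^sub>R x) = c *\<^sub>R normal_component S p x"
    by (intro nc(3) Real_Vector_Spaces.subspace_scale subspace_orthogonal_comp nc(1))
qed

lemma normal_component_eq_0:
  assumes "p \<in> S" "x \<in> tangent_space S p" shows "normal_component S p x = 0"
  by (rule normal_component(3)[OF assms(1)]) (use assms(2) in \<open>auto simp: orthogonal_comp_def real_inner_class.orthogonal_def\<close>)

text \<open>This makes the second fundamental form independent of the extension. Along a curve with
  velocity \<open>v\<close>, the quotients \<open>Z (\<gamma> t) / t\<close> are tangent at
  \<open>\<gamma> t\<close> and converge to the derivative, so \<open>tangent_space_limit\<close>
  applies.\<close>

lemma derivative_tangent_field_zero:
  assumes p: "p \<in> S" and V: "open V" "p \<in> V" and Z: "smooth_on V Z"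
    and tan: "\<And>q. q \<in> S \<inter> V \<Longrightarrow> Z q \<in> tangent_space S q" and Zp: "Z p = 0"
    and v: "v \<in> tangent_space S p"
  shows "frechet_derivative Z (at p) v \<in> tangent_space S p"
proof -
  let ?D = "frechet_derivative Z (at p)"
  obtain \<gamma> \<epsilon> where g: "(\<epsilon>::real) > 0" "\<gamma> ` {-\<epsilon><..<\<epsilon>} \<subseteq> S" "\<gamma> 0 = p" "(\<gamma> has_vector_derivative v) (at 0)"
    using v unfolding tangent_space_def by auto
  have gd: "(\<gamma> has_derivative (\<lambda>h. h *\<^sub>R v)) (at 0)"
    using g(4) by (simp add: has_vector_derivative_def)
  then have "continuous (at 0) \<gamma>" by (rule has_derivative_continuous)
  then have lim: "(\<gamma> \<longlongrightarrow> p) (at 0)" using g(3) by (simp add: isCont_def)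
  have D: "(Z has_derivative ?D) (at p)" using smooth_on_has_derivative[OF Z V(2)] .
  have "((Z \<circ> \<gamma>) has_derivative (?D \<circ> (\<lambda>h. h *\<^sub>R v))) (at 0)"
    by (rule diff_chain_at[OF gd]) (use D g(3) in simp)
  then have "((\<lambda>t. (1 / norm (t - 0)) *\<^sub>R (Z (\<gamma> t) - (Z (\<gamma> 0) + ?D ((t - 0) *\<^sub>R v)))) \<longlongrightarrow> 0) (at 0)"
    unfolding has_derivative_at2 by (simp add: o_def)
  then have "((\<lambda>t. norm ((1 / \<bar>t\<bar>) *\<^sub>R (Z (\<gamma> t) - t *\<^sub>R ?D v))) \<longlongrightarrow> 0) (at 0)"
    using g(3) Zp linear_scale[OF has_derivative_linear[OF D]] by (intro tendsto_norm_zero) simp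
  \<comment> \<open>The remainder of the derivative is divided by the absolute value of
    \<open>t\<close>, the field by \<open>t\<close> itself; inside the norm the sign
    disappears.\<close>
  moreover have "norm ((1 / \<bar>t\<bar>) *\<^sub>R (Z (\<gamma> t) - t *\<^sub>R ?D v)) = norm ((1 / t) *\<^sub>R Z (\<gamma> t) - ?D v)"
    if "t \<noteq> 0" for t
  proof -
    have "(1 / t) *\<^sub>R Z (\<gamma> t) - ?D v = (1 / t) *\<^sub>R (Z (\<gamma> t) - t *\<^sub>R ?D v)"
      using that by (simp add: scaleR_diff_right)
    then show ?thesis by simp
  qed
  then have "eventually (\<lambda>t. norm ((1 / \<bar>t\<bar>) *\<^sub>R (Z (\<gamma> t) - t *\<^sub>R ?D v)) = norm ((1 / t) *\<^sub>R Z (\<gamma> t) - ?D v)) (at 0)"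
    by (auto simp: eventually_at_filter)
  ultimately have "((\<lambda>t. norm ((1 / t) *\<^sub>R Z (\<gamma> t) - ?D v)) \<longlongrightarrow> 0) (at 0)"
    using tendsto_cong by fast
  then have lim2: "((\<lambda>t. (1 / t) *\<^sub>R Z (\<gamma> t)) \<longlongrightarrow> ?D v) (at 0)"
    using tendsto_norm_zero_iff Lim_null by blast
  have "eventually (\<lambda>t. \<gamma> t \<in> V) (at 0)" using lim V by (simp add: tendsto_def)
  moreover have "eventually (\<lambda>t::real. t \<in> {-\<epsilon><..<\<epsilon>}) (at 0)"
    using g(1) eventually_at_in_open'[of "{-\<epsilon><..<\<epsilon>}" 0] by auto
  ultimately have "eventually (\<lambda>t. \<gamma> t \<in> S \<and> (1 / t) *\<^sub>R Z (\<gamma> t) \<in> tangent_space S (\<gamma> t)) (at 0)"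
  proof eventually_elim
    case (elim t)
    then have "\<gamma> t \<in> S" using g(2) by blast
    then show ?case
      using tan elim by (auto intro: Real_Vector_Spaces.subspace_scale[OF subspace_tangent_space])
  qed
  then show ?thesis
    by (rule tangent_space_limit[OF p _ lim lim2]) simp
qed

text \<open>Two extensions of the same vector differ by a tangential field that vanishes at
  \<open>p\<close>, and its derivative has no normal component. So every extension may be used for
  the evaluation.\<close>

lemma second_fundamental_form_eq:
  assumes p: "p \<in> S" and V: "open V" "p \<in> V" and Y: "smooth_on V Y"
    and tan: "\<And>q. q \<in> S \<inter> V \<Longrightarrow> Y q \<in> tangent_space S q"
    and v: "v \<in> tangent_space S p"
  shows "second_fundamental_form S p v (Y p) = normal_component S p (frechet_derivative Y (at p) v)"
  unfolding second_fundamental_form_def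
proof (rule the_equality)
  show "\<exists>U Ya. open U \<and> p \<in> U \<and> smooth_on U Ya \<and> (\<forall>q\<in>S \<inter> U. Ya q \<in> tangent_space S q) \<and>
      Ya p = Y p \<and> normal_component S p (frechet_derivative Y (at p) v) = normal_component S p (frechet_derivative Ya (at p) v)"
    using assms by blast
next
  fix z
  assume "\<exists>U Ya. open U \<and> p \<in> U \<and> smooth_on U Ya \<and> (\<forall>q\<in>S \<inter> U. Ya q \<in> tangent_space S q) \<and>
      Ya p = Y p \<and> z = normal_component S p (frechet_derivative Ya (at p) v)"
  then obtain W X where X: "open W" "p \<in> W" "smooth_on W X" "\<forall>q\<in>S \<inter> W. X q \<in> tangent_space S q" "X p = Y p"
    and z: "z = normal_component S p (frechet_derivative X (at p) v)" by blast
  let ?Z = "\<lambda>q. X q - Y q"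
  have "(?Z has_derivative (\<lambda>h. frechet_derivative X (at p) h - frechet_derivative Y (at p) h)) (at p)"
    by (intro has_derivative_diff smooth_on_has_derivative[OF X(3,2)] smooth_on_has_derivative[OF Y V(2)])
  then have D: "frechet_derivative ?Z (at p) = (\<lambda>h. frechet_derivative X (at p) h - frechet_derivative Y (at p) h)"
    by (simp add: frechet_derivative_at[symmetric])
  have "frechet_derivative ?Z (at p) v \<in> tangent_space S p"
  proof (rule derivative_tangent_field_zero[OF p _ _ _ _ _ v])
    show "open (V \<inter> W)" "p \<in> V \<inter> W" using V X by auto
    show "smooth_on (V \<inter> W) ?Z"
      using V X by (intro smooth_on_diff smooth_on_subset[OF Y] smooth_on_subset[OF X(3)]) auto
    show "X q - Y q \<in> tangent_space S q" if "q \<in> S \<inter> (V \<inter> W)" for q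
      using that X(4) tan by (intro Real_Vector_Spaces.subspace_diff[OF subspace_tangent_space]) auto
  qed (use X in simp)
  then have "normal_component S p (frechet_derivative X (at p) v - frechet_derivative Y (at p) v) = 0"
    using D normal_component_eq_0[OF p] by simp
  then show "z = normal_component S p (frechet_derivative Y (at p) v)"
    using z linear_diff[OF linear_normal_component[OF p]] by simp
qed

text \<open>\<open>second_fundamental_form\<close> is determined on tangent vectors only. This
  variant uses the standard extension, makes sense for all arguments and is bilinear on the whole
  space, as \<open>trace_orthonormal_basis\<close> demands.\<close>

definition II where
  "II p v w = normal_component S p (frechet_derivative (tangent_field w) (at p) v)"

lemma second_fundamental_form_II:
  assumes p: "p \<in> S" and v: "v \<in> tangent_space S p" and w: "w \<in> tangent_space S p"
  shows "second_fundamental_form S p v w = II p v w"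
proof -
  have "p \<in> U" using p S_subset_U by auto
  from second_fundamental_form_eq[OF p open_U this smooth_tangent_field _ v]
  show ?thesis by (metis II_def IntE tangent_field_tangent tangent_field_base[OF p w])
qed

lemma bilinear_II:
  assumes p: "p \<in> S" shows "bilinear (II p)"
proof -
  have pU: "p \<in> U" using p S_subset_U by auto
  note nc = linear_normal_component[OF p]
  let ?G = "\<lambda>w. frechet_derivative (\<lambda>q. DF q w) (at p)"
  have dG: "((\<lambda>q. DF q w) has_derivative ?G w) (at p)" for w
    by (rule smooth_on_has_derivative[OF smooth_on_frechet[OF smooth_F] pU])
  have "((\<lambda>q. \<pi> w + DF q w) has_derivative (\<lambda>h. 0 + ?G w h)) (at p)" for w
    by (intro has_derivative_add has_derivative_const dG)
  from frechet_derivative_at[OF this]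
  have II: "II p v w = normal_component S p (?G w v)" for v w
    unfolding II_def tangent_field_def[abs_def] by simp
  have add: "?G (w + x) = (\<lambda>h. ?G w h + ?G x h)" for w x
  proof (rule frechet_derivative_at[symmetric])
    have "((\<lambda>q. DF q w + DF q x) has_derivative (\<lambda>h. ?G w h + ?G x h)) (at p)"
      by (intro has_derivative_add dG)
    then show "((\<lambda>q. DF q (w + x)) has_derivative (\<lambda>h. ?G w h + ?G x h)) (at p)"
      by (rule has_derivative_transform_within_open[OF _ open_U pU]) (simp add: linear_DF linear_add)
  qed
  have scale: "?G (c *\<^sub>R w) = (\<lambda>h. c *\<^sub>R ?G w h)" for w c
  proof (rule frechet_derivative_at[symmetric])
    have "((\<lambda>q. c *\<^sub>R DF q w) has_derivative (\<lambda>h. c *\<^sub>R ?G w h)) (at p)"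
      by (intro has_derivative_scaleR_right dG)
    then show "((\<lambda>q. DF q (c *\<^sub>R w)) has_derivative (\<lambda>h. c *\<^sub>R ?G w h)) (at p)"
      by (rule has_derivative_transform_within_open[OF _ open_U pU]) (simp add: linear_DF linear_scale)
  qed
  have "linear (\<lambda>w. II p v w)" for v
    unfolding II by (rule linearI) (simp_all add: add scale linear_add[OF nc] linear_scale[OF nc])
  moreover have "linear (\<lambda>v. II p v w)" for w
    unfolding II using linear_compose[OF has_derivative_linear[OF dG] nc] by (simp add: o_def)
  ultimately show ?thesis by (simp add: bilinear_def)
qed

text \<open>\<open>\<sigma>\<close> preserves \<open>C\<close> but perhaps not \<open>S\<close>.
  Once the domain of a curve is shrunk, its image stays in the open set \<open>U\<close>, hence in
  \<open>C \<inter> U\<close>.\<close>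

lemma tangent_space_symmetry:
  assumes S: "S = C \<inter> U" and \<sigma>: "linear \<sigma>" "\<And>c. c \<in> C \<Longrightarrow> \<sigma> c \<in> C"
    and q: "q \<in> S" "\<sigma> q \<in> U" and v: "v \<in> tangent_space S q"
  shows "\<sigma> v \<in> tangent_space S (\<sigma> q)"
proof -
  obtain \<gamma> \<epsilon> where g: "(\<epsilon>::real) > 0" "smooth_on {-\<epsilon><..<\<epsilon>} \<gamma>" "\<gamma> ` {-\<epsilon><..<\<epsilon>} \<subseteq> S" "\<gamma> 0 = q"
      "(\<gamma> has_vector_derivative v) (at 0)"
    using v unfolding tangent_space_def by auto
  have sm: "smooth_on {-\<epsilon><..<\<epsilon>} (\<lambda>t. \<sigma> (\<gamma> t))"
    by (rule smooth_on_compose_linear[OF _ \<sigma>(1) g(2)]) simp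
  have "open ({-\<epsilon><..<\<epsilon>} \<inter> (\<lambda>t. \<sigma> (\<gamma> t)) -` U)"
    using smooth_on_continuous[OF sm] open_U by (metis continuous_open_preimage open_greaterThanLessThan)
  moreover have "0 \<in> {-\<epsilon><..<\<epsilon>} \<inter> (\<lambda>t. \<sigma> (\<gamma> t)) -` U" using g q by auto
  ultimately obtain e where e: "e > 0" "ball 0 e \<subseteq> {-\<epsilon><..<\<epsilon>} \<inter> (\<lambda>t. \<sigma> (\<gamma> t)) -` U"
    using open_contains_ball by blast
  then have eW: "{-e<..<e} \<subseteq> {-\<epsilon><..<\<epsilon>} \<inter> (\<lambda>t. \<sigma> (\<gamma> t)) -` U"
    by (auto simp: ball_eq_greaterThanLessThan)
  have "(\<lambda>t. \<sigma> (\<gamma> t)) ` {-e<..<e} \<subseteq> S"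
    using eW g(3) \<sigma>(2) unfolding S by blast
  moreover have "((\<lambda>t. \<sigma> (\<gamma> t)) has_vector_derivative \<sigma> v) (at 0)"
    using bounded_linear.has_vector_derivative[OF _ g(5)] \<sigma>(1) by (simp add: linear_conv_bounded_linear)
  moreover have "smooth_on {-e<..<e} (\<lambda>t. \<sigma> (\<gamma> t))"
    using smooth_on_subset[OF sm] eW by blast
  ultimately show ?thesis
    unfolding tangent_space_def using e(1) g(4)
    by (intro CollectI exI[of _ "\<lambda>t. \<sigma> (\<gamma> t)"] exI[of _ e]) simp
qed

text \<open>Conjugating the standard extension of \<open>w\<close> by \<open>\<sigma>\<close> gives
  a tangential field near \<open>p\<close> with the value \<open>\<sigma> w\<close> at
  \<open>p\<close>, and any extension computes the form.\<close>

lemma second_fundamental_form_symmetry: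
  assumes p: "p \<in> S" and S: "S = C \<inter> U"
    and \<sigma>: "linear \<sigma>" "\<And>x. \<sigma> (\<sigma> x) = x" "\<And>x y. \<sigma> x \<bullet> \<sigma> y = x \<bullet> y" "\<sigma> p = p" "\<And>c. c \<in> C \<Longrightarrow> \<sigma> c \<in> C"
    and v: "v \<in> tangent_space S p" and w: "w \<in> tangent_space S p"
  shows "second_fundamental_form S p (\<sigma> v) (\<sigma> w) = \<sigma> (second_fundamental_form S p v w)"
proof -
  let ?T = "tangent_space S p"
  have pU: "p \<in> U" using p S_subset_U by auto
  have T: "\<sigma> x \<in> ?T" if "x \<in> ?T" for x
    using tangent_space_symmetry[OF S \<sigma>(1,5) p _ that] \<sigma>(4) pU by simp
  have nc: "normal_component S p (\<sigma> x) = \<sigma> (normal_component S p x)" for x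
  proof (rule normal_component(3)[OF p])
    show "\<sigma> x - \<sigma> (normal_component S p x) \<in> ?T"
      using T[OF normal_component(2)[OF p]] by (simp add: linear_diff[OF \<sigma>(1)])
    have "y \<bullet> \<sigma> (normal_component S p x) = 0" if "y \<in> ?T" for y
      using normal_component(1)[OF p, of x] T[OF that] \<sigma>(2) \<sigma>(3)[of "\<sigma> y" "normal_component S p x"]
      by (auto simp: orthogonal_comp_def real_inner_class.orthogonal_def)
    then show "\<sigma> (normal_component S p x) \<in> orthogonal_comp ?T"
      by (auto simp: orthogonal_comp_def real_inner_class.orthogonal_def)
  qed
  define Y where "Y = tangent_field w"
  note Y = smooth_tangent_field[of w, folded Y_def] tangent_field_tangent[of _ w, folded Y_def]
    tangent_field_base[OF p w, folded Y_def]
  \<comment> \<open>The summand 0 gives the set the shape required by the rules for affine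
    substitution.\<close>
  define V where "V = {q. 0 + \<sigma> q \<in> U}"
  have V: "open V" unfolding V_def by (rule open_affine_vimage[OF open_U \<sigma>(1)])
  have smV: "smooth_on V (\<lambda>q. \<sigma> (Y (0 + \<sigma> q)))"
    unfolding V_def by (rule smooth_on_compose_linear[OF V[unfolded V_def] \<sigma>(1) smooth_on_compose_affine[OF open_U \<sigma>(1) Y(1)]])
  let ?Z = "\<lambda>q. \<sigma> (Y (\<sigma> q))"
  have "second_fundamental_form S p (\<sigma> v) (?Z p) = normal_component S p (frechet_derivative ?Z (at p) (\<sigma> v))"
  proof (rule second_fundamental_form_eq[OF p _ _ _ _ T[OF v]])
    show "open (U \<inter> V)" "p \<in> U \<inter> V" using V open_U pU \<sigma>(4) by (auto simp: V_def)
    show "smooth_on (U \<inter> V) ?Z" using smV by (auto intro: smooth_on_subset)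
    fix q assume "q \<in> S \<inter> (U \<inter> V)"
    then have q: "q \<in> S" "q \<in> U" "\<sigma> q \<in> U" by (auto simp: V_def)
    then have sq: "\<sigma> q \<in> S" using \<sigma>(5) S by auto
    have "\<sigma> (Y (\<sigma> q)) \<in> tangent_space S (\<sigma> (\<sigma> q))"
      by (rule tangent_space_symmetry[OF S \<sigma>(1,5) sq _ Y(2)[OF sq]]) (use q \<sigma>(2) in auto)
    then show "?Z q \<in> tangent_space S q" by (simp add: \<sigma>(2))
  qed
  moreover have "(?Z has_derivative (\<lambda>h. \<sigma> (frechet_derivative Y (at p) (\<sigma> h)))) (at p)"
  proof -
    have d\<sigma>: "(\<sigma> has_derivative \<sigma>) (at q)" for q by (rule linear_imp_has_derivative[OF \<sigma>(1)])
    have "(Y has_derivative frechet_derivative Y (at p)) (at (\<sigma> p))"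
      using smooth_on_has_derivative[OF Y(1) pU] \<sigma>(4) by simp
    from diff_chain_at[OF diff_chain_at[OF d\<sigma> this] d\<sigma>] show ?thesis by (simp add: o_def)
  qed
  ultimately have "second_fundamental_form S p (\<sigma> v) (\<sigma> w) = normal_component S p (\<sigma> (frechet_derivative Y (at p) v))"
    using Y(3) \<sigma>(2,4) by (simp add: frechet_derivative_at[symmetric])
  also have "\<dots> = \<sigma> (second_fundamental_form S p v w)"
    using second_fundamental_form_eq[OF p open_U pU Y(1) _ v] Y nc by auto
  finally show ?thesis .
qed

text \<open>
  A linear isometry which fixes \<open>p\<close> and preserves \<open>C\<close> fixes the mean curvature vector; if it is a
  reflection, the vector has no component in the reversed directions.
\<close>

lemma mean_curvature_vector_eq_0:
  assumes p: "p \<in> S" and S: "S = C \<inter> U"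
    and criterion: "\<And>H. (\<And>v. (\<And>t. p + t *\<^sub>R v \<in> C) \<Longrightarrow> H \<bullet> v = 0) \<Longrightarrow>
      (\<And>K. (\<And>k. k \<in> K \<Longrightarrow> p \<bullet> k = 0) \<Longrightarrow>
        (\<And>c. c \<in> C \<Longrightarrow> \<exists>y z. c = y + z \<and> z \<in> span K \<and> (\<forall>k\<in>K. y \<bullet> k = 0) \<and> y - z \<in> C) \<Longrightarrow>
        (\<And>k. k \<in> K \<Longrightarrow> H \<bullet> k = 0)) \<Longrightarrow> H = 0"
  shows "mean_curvature_vector S p = 0"
proof -
  let ?T = "tangent_space S p"
  have pU: "p \<in> U" using p S_subset_U by auto
  define isB where "isB B \<longleftrightarrow> pairwise real_inner_class.orthogonal B \<and> (\<forall>e\<in>B. norm e = 1) \<and> span B = ?T"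
    for B :: "'a set"
  define B where "B = (SOME B. isB B)"
  have "\<exists>B. isB B"
    unfolding isB_def using orthonormal_basis_subspace[OF subspace_tangent_space[OF p]] by metis
  then have "isB B" unfolding B_def by (rule someI_ex)
  then have B: "pairwise real_inner_class.orthogonal B" "\<And>e. e \<in> B \<Longrightarrow> norm e = 1" "span B = ?T"
    by (auto simp: isB_def)
  have BT: "e \<in> ?T" if "e \<in> B" for e using that B(3) span_base by blast
  define H where "H = (\<Sum>e\<in>B. second_fundamental_form S p e e)"
  have H_II: "H = (\<Sum>e\<in>B. II p e e)"
    unfolding H_def by (intro sum.cong refl second_fundamental_form_II p BT)
  have "H = 0"
  proof (rule criterion)
    fix v assume v: "\<And>t. p + t *\<^sub>R v \<in> C"
    \<comment> \<open>A line in \<open>C\<close> stays in \<open>S\<close> for small parameters, as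
      \<open>U\<close> is open. So its direction is tangent, whereas all values of \<open>II\<close>
      are normal.\<close>
    have lin: "linear (\<lambda>t::real. t *\<^sub>R v)" by (simp add: linear_iff scaleR_add_left)
    have "open {t::real. p + t *\<^sub>R v \<in> U}" by (rule open_affine_vimage[OF open_U lin])
    moreover have "0 \<in> {t::real. p + t *\<^sub>R v \<in> U}" using pU by simp
    ultimately obtain e where e: "e > 0" "ball 0 e \<subseteq> {t::real. p + t *\<^sub>R v \<in> U}"
      using open_contains_ball by blast
    have "v \<in> ?T"
      unfolding tangent_space_def
    proof (intro CollectI exI conjI)
      show "e > 0" by fact
      show "smooth_on {-e<..<e} (\<lambda>t. p + t *\<^sub>R v)"
        by (intro smooth_on_add smooth_on_const smooth_on_linear lin) auto
      show "(\<lambda>t. p + t *\<^sub>R v) ` {-e<..<e} \<subseteq> S"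
        using v e(2) unfolding S by (auto simp: ball_eq_greaterThanLessThan)
      show "((\<lambda>t. p + t *\<^sub>R v) has_vector_derivative v) (at 0)"
        by (auto intro!: derivative_eq_intros)
    qed simp
    moreover have "II p x y \<bullet> v = 0" if "v \<in> ?T" for x y
      using normal_component(1)[OF p] that
      by (auto simp: II_def orthogonal_comp_def real_inner_class.orthogonal_def inner_commute)
    ultimately show "H \<bullet> v = 0" by (simp add: H_II inner_sum_left)
  next
    fix K k
    assume pK: "\<And>k. k \<in> K \<Longrightarrow> p \<bullet> k = 0" and k: "k \<in> K"
      and CK: "\<And>c. c \<in> C \<Longrightarrow> \<exists>y z. c = y + z \<and> z \<in> span K \<and> (\<forall>k\<in>K. y \<bullet> k = 0) \<and> y - z \<in> C"
    obtain \<sigma> where \<sigma>: "linear \<sigma>" "\<And>x. \<sigma> (\<sigma> x) = x" "\<And>x y. \<sigma> x \<bullet> \<sigma> y = x \<bullet> y"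
      and \<sigma>K: "\<And>x. x \<in> span K \<Longrightarrow> \<sigma> x = - x" "\<And>x. (\<And>k. k \<in> K \<Longrightarrow> x \<bullet> k = 0) \<Longrightarrow> \<sigma> x = x"
      using reflection_exists[of K] by blast
    have \<sigma>p: "\<sigma> p = p" using \<sigma>K(2) pK by blast
    have \<sigma>C: "\<sigma> c \<in> C" if c: "c \<in> C" for c
    proof -
      \<comment> \<open>\<open>\<sigma>\<close> sends \<open>c\<close> to \<open>y - z\<close>, so
        the splitting says exactly that \<open>C\<close> is preserved.\<close>
      obtain y z where "c = y + z" "z \<in> span K" "\<forall>k\<in>K. y \<bullet> k = 0" "y - z \<in> C" using CK[OF c] by blast
      then have "\<sigma> c = y - z" using linear_add[OF \<sigma>(1)] \<sigma>K by simp
      then show ?thesis using \<open>y - z \<in> C\<close> by simp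
    qed
    have \<sigma>T: "\<sigma> x \<in> ?T" if "x \<in> ?T" for x
      using tangent_space_symmetry[OF S \<sigma>(1) \<sigma>C p _ that] \<sigma>p pU by simp
    have inj: "inj \<sigma>" using \<sigma>(2) by (metis injI)
    \<comment> \<open>Applying \<open>\<sigma>\<close> to the trace amounts to moving the
      orthonormal basis by \<open>\<sigma>\<close>; the moved basis spans the same tangent space, so
      the trace does not change.\<close>
    have "\<sigma> H = (\<Sum>e\<in>B. \<sigma> (second_fundamental_form S p e e))"
      unfolding H_def by (rule linear_sum[OF \<sigma>(1)])
    also have "\<dots> = (\<Sum>e\<in>B. second_fundamental_form S p (\<sigma> e) (\<sigma> e))"
      by (intro sum.cong refl second_fundamental_form_symmetry[OF p S \<sigma> \<sigma>p \<sigma>C, symmetric] BT)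
    also have "\<dots> = (\<Sum>e\<in>B. II p (\<sigma> e) (\<sigma> e))"
      by (intro sum.cong refl second_fundamental_form_II p \<sigma>T BT)
    also have "\<dots> = (\<Sum>e\<in>\<sigma> ` B. II p e e)"
      using inj by (subst sum.reindex) (auto intro: inj_on_subset)
    also have "\<dots> = (\<Sum>e\<in>B. II p e e)"
    proof (rule trace_orthonormal_basis[OF bilinear_II[OF p] _ _ B(1,2)])
      show "pairwise real_inner_class.orthogonal (\<sigma> ` B)"
        using B(1) by (auto simp: pairwise_def real_inner_class.orthogonal_def \<sigma>(3))
      show "norm e = 1" if "e \<in> \<sigma> ` B" for e
        using that B(2) \<sigma>(3) by (auto simp: norm_eq_sqrt_inner)
      have "\<sigma> ` ?T = ?T" using \<sigma>T \<sigma>(2) by (auto simp: image_iff) metis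
      then show "span (\<sigma> ` B) = span B" using linear_span_image[OF \<sigma>(1)] B(3) by metis
    qed
    finally have "\<sigma> H = H" by (simp add: H_II)
    moreover have "\<sigma> k = - k" using \<sigma>K(1) k span_base by blast
    ultimately have "H \<bullet> k = - (H \<bullet> k)" using \<sigma>(3)[of H k] by simp
    then show "H \<bullet> k = 0" by simp
  qed
  then show ?thesis
    unfolding mean_curvature_vector_def Let_def using B_def isB_def H_def by simp
qed

end

section \<open>Rank bounds\<close>

text \<open>
  Submatrices of all sizes are handled at once by letting the entries be a function on all pairs of
  indices; only those below \<open>p\<close> and \<open>q\<close> matter.
\<close>

definition rank_le :: "nat \<Rightarrow> nat \<Rightarrow> nat \<Rightarrow> (nat \<Rightarrow> nat \<Rightarrow> real) \<Rightarrow> bool" where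
  "rank_le p q r a \<longleftrightarrow> (\<exists>f g. \<forall>i<p. \<forall>j<q. a i j = (\<Sum>k<r. f i k * g k j))"

lemma rank_le_cong:
  "(\<And>i j. i < p \<Longrightarrow> j < q \<Longrightarrow> a i j = b i j) \<Longrightarrow> rank_le p q r a \<longleftrightarrow> rank_le p q r b"
  unfolding rank_le_def by simp

lemma rank_le_mono:
  assumes "rank_le p q r a" "p' \<le> p" "q' \<le> q" "r \<le> r'"
  shows "rank_le p' q' r' a"
proof -
  obtain f g where fg: "\<forall>i<p. \<forall>j<q. a i j = (\<Sum>k<r. f i k * g k j)"
    using assms(1) unfolding rank_le_def by blast
  define f' where "f' i k = (if k < r then f i k else 0)" for i k
  have "(\<Sum>k<r'. f' i k * g k j) = (\<Sum>k<r. f i k * g k j)" for i j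
    by (rule sum.mono_neutral_cong_right) (use assms(4) in \<open>auto simp: f'_def\<close>)
  then show ?thesis unfolding rank_le_def using fg assms(2,3) by (metis less_le_trans)
qed

lemma rank_le_transpose: "rank_le p q r a \<longleftrightarrow> rank_le q p r (\<lambda>i j. a j i)"
proof -
  have "rank_le q p r (\<lambda>i j. a j i)" if a: "rank_le p q r a" for p q a
  proof -
    obtain f g where fg: "\<forall>i<p. \<forall>j<q. a i j = (\<Sum>k<r. f i k * g k j)"
      using a unfolding rank_le_def by blast
    show ?thesis unfolding rank_le_def
      by (rule exI[of _ "\<lambda>j k. g k j"], rule exI[of _ "\<lambda>k i. f i k"]) (simp add: fg mult.commute)
  qed
  from this[of p q a] this[of q p "\<lambda>i j. a j i"] show ?thesis by auto
qed

lemma rank_le_mult_left: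
  assumes "rank_le p q r a"
  shows "rank_le p' q r (\<lambda>i j. \<Sum>k<p. M i k * a k j)"
proof -
  obtain f g where fg: "\<forall>i<p. \<forall>j<q. a i j = (\<Sum>k<r. f i k * g k j)"
    using assms unfolding rank_le_def by blast
  have "(\<Sum>k<p. M i k * a k j) = (\<Sum>l<r. (\<Sum>k<p. M i k * f k l) * g l j)" if "j < q" for i j
  proof -
    have "(\<Sum>k<p. M i k * a k j) = (\<Sum>k<p. \<Sum>l<r. M i k * f k l * g l j)"
      using that fg by (intro sum.cong refl) (simp add: sum_distrib_left mult.assoc)
    also have "\<dots> = (\<Sum>l<r. (\<Sum>k<p. M i k * f k l) * g l j)"
      by (subst sum.swap) (simp add: sum_distrib_right)
    finally show ?thesis .
  qed
  then show ?thesis unfolding rank_le_def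
    by (intro exI[of _ "\<lambda>i l. \<Sum>k<p. M i k * f k l"] exI[of _ g]) simp
qed

lemma rank_le_mult_right:
  assumes "rank_le p q r a"
  shows "rank_le p q' r (\<lambda>i j. \<Sum>k<q. a i k * M k j)"
  using rank_le_mult_left[OF assms[unfolded rank_le_transpose[of p q]], of q' "\<lambda>j k. M k j"]
  by (simp add: rank_le_transpose[of q' p] mult.commute)

text \<open>The extra term of the factorisation is the new row itself, with coefficient 0 in all
  other rows.\<close>

lemma rank_le_add_row:
  assumes "rank_le p q r a"
  shows "rank_le (Suc p) q (Suc r) a"
proof -
  obtain f g where fg: "\<forall>i<p. \<forall>j<q. a i j = (\<Sum>k<r. f i k * g k j)"
    using assms unfolding rank_le_def by blast
  define f' where "f' i k = (if k < r then if i < p then f i k else 0 else if i < p then 0 else (1::real))" for i k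
  define g' where "g' k j = (if k < r then g k j else a p j)" for k j
  have "a i j = (\<Sum>k<Suc r. f' i k * g' k j)" if "i < Suc p" "j < q" for i j
  proof (cases "i < p")
    case True
    then show ?thesis using fg that by (simp add: f'_def g'_def)
  next
    case False
    then have "i = p" using that by simp
    then show ?thesis by (simp add: f'_def g'_def)
  qed
  then show ?thesis unfolding rank_le_def by blast
qed

lemma rank_le_add_col: "rank_le p q r a \<Longrightarrow> rank_le p (Suc q) (Suc r) a"
  using rank_le_add_row rank_le_transpose by blast

text \<open>A maximal independent set of columns yields a factorisation. Conversely, each of the
  \<open>r\<close> products has rank at most 1, and the rank is subadditive.\<close>

lemma rank_le_mat_rank:
  "mat_rank (upper_left p q A) \<le> r \<longleftrightarrow> rank_le p q r (\<lambda>i j. A $$ (i, j))"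
proof
  interpret vec_space "TYPE(real)" p .
  let ?A = "upper_left p q A"
  have A: "?A \<in> carrier_mat p q" by (simp add: upper_left_def)
  have rk: "mat_rank ?A = rank ?A" by (simp add: mat_rank_def upper_left_def)
  {
    assume le: "mat_rank ?A \<le> r"
    let ?P = "\<lambda>T. T \<subseteq> set (cols ?A) \<and> lin_indpt T"
    have "lin_indpt {}" using finite_lin_indpt2 by auto
    then obtain S where S: "finite S" "maximal S ?P"
      using maximal_exists_superset[of "set (cols ?A)" ?P "{}"] by auto
    then have Ssub: "S \<subseteq> set (cols ?A)" and Sind: "lin_indpt S" by (auto simp: maximal_def)
    have carr: "set (cols ?A) \<subseteq> carrier_vec p" using cols_dim[of ?A] A by simp
    have card: "card S \<le> r" using rank_card_indpt[OF A S(2)] le rk by simp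
    have in_span: "v \<in> span S" if v: "v \<in> set (cols ?A)" for v
    proof (rule ccontr)
      assume nv: "v \<notin> span S"
      moreover have "S \<subseteq> span S" by (rule in_own_span) (use Ssub carr in auto)
      ultimately have "v \<notin> S" by blast
      then have "lin_indpt (S \<union> {v})"
        using lin_dep_iff_in_span[of S v] nv Ssub carr Sind v by auto
      then have "?P (S \<union> {v})" using Ssub v by auto
      then have "S \<union> {v} = S" using S(2) unfolding maximal_def by blast
      then show False using \<open>v \<notin> S\<close> by auto
    qed
    have "\<exists>c. \<forall>i<p. A $$ (i, j) = (\<Sum>s\<in>S. c s * s $ i)" if j: "j < q" for j
    proof -
      have "col ?A j \<in> set (cols ?A)" using j A by (auto simp: cols_def)
      then have "\<exists>c. lincomb c S = col ?A j"
        using finite_in_span[OF S(1), of "col ?A j"] in_span Ssub carr by blast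
      then obtain c where c: "col ?A j = lincomb c S" by metis
      have "A $$ (i, j) = (\<Sum>s\<in>S. c s * s $ i)" if "i < p" for i
      proof -
        have "A $$ (i, j) = col ?A j $ i" using that j by (simp add: upper_left_def)
        also have "\<dots> = (\<Sum>s\<in>S. c s * s $ i)"
          unfolding c by (rule lincomb_index[OF that]) (use Ssub carr in blast)
        finally show ?thesis .
      qed
      then show ?thesis by blast
    qed
    then obtain c where c: "\<And>j i. j < q \<Longrightarrow> i < p \<Longrightarrow> A $$ (i, j) = (\<Sum>s\<in>S. c j s * s $ i)"
      by metis
    obtain e where e: "bij_betw e {..<card S} S"
      using ex_bij_betw_nat_finite[OF S(1)] by (auto simp: atLeast0LessThan)
    have "A $$ (i, j) = (\<Sum>k<card S. e k $ i * c j (e k))" if "i < p" "j < q" for i j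
      using c[OF that(2,1)] sum.reindex_bij_betw[OF e, of "\<lambda>s. c j s * s $ i"] by (simp add: mult.commute)
    then have "rank_le p q (card S) (\<lambda>i j. A $$ (i, j))"
      unfolding rank_le_def by (intro exI[of _ "\<lambda>i k. e k $ i"] exI[of _ "\<lambda>k j. c j (e k)"]) simp
    then show "rank_le p q r (\<lambda>i j. A $$ (i, j))" using rank_le_mono card by blast
  next
    assume "rank_le p q r (\<lambda>i j. A $$ (i, j))"
    then obtain f g where fg: "\<forall>i<p. \<forall>j<q. A $$ (i, j) = (\<Sum>k<r. f i k * g k j)"
      unfolding rank_le_def by blast
    have "rank (mat p q (\<lambda>(i, j). \<Sum>k<s. f i k * g k j)) \<le> s" for s
    proof (induction s)
      case 0
      have "mat p q (\<lambda>(i, j). \<Sum>k<0. f i k * g k j) = 0\<^sub>m p q" by (rule eq_matI) auto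
      then show ?case using rank_0I by (simp only:)
    next
      case (Suc s)
      let ?B = "mat p q (\<lambda>(i, j). \<Sum>k<s. f i k * g k j)" and ?C = "mat p q (\<lambda>(i, j). f i s * g s j)"
      have "mat p q (\<lambda>(i, j). \<Sum>k<Suc s. f i k * g k j) = ?B + ?C" by (rule eq_matI) auto
      moreover have "rank (?B + ?C) \<le> rank ?B + rank ?C" by (rule rank_subadditive) auto
      moreover have "rank ?C \<le> 1"
        by (rule rank_le_1_product_entries[of _ q "\<lambda>i. f i s" "\<lambda>j. g s j"]) auto
      ultimately show ?case using Suc by simp
    qed
    from this[of r] have "rank ?A \<le> r"
      by (subst (asm) cong_mat[of p p q q "\<lambda>(i, j). \<Sum>k<r. f i k * g k j" "\<lambda>(i, j). A $$ (i, j)"])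
        (use fg in \<open>auto simp: upper_left_def\<close>)
    then show "mat_rank ?A \<le> r" using rk by simp
  }
qed

text \<open>Factorisations only bound ranks from above. The lower bound in
  \<open>rank_le_echelon\<close> comes from here, through the determinant of the identity.\<close>

lemma rank_le_identity:
  assumes "rank_le k k r (\<lambda>i j. if i = j then 1 else 0)"
  shows "k \<le> r"
proof -
  interpret vec_space "TYPE(real)" k .
  have "upper_left k k (1\<^sub>m k :: real mat) = 1\<^sub>m k" by (rule eq_matI) (auto simp: upper_left_def)
  moreover have "rank (1\<^sub>m k :: real mat) = k" by (rule low_rank_det_zero) auto
  moreover have "rank_le k k r (\<lambda>i j. 1\<^sub>m k $$ (i, j))"
    using assms by (subst rank_le_cong[where b = "\<lambda>i j. if i = j then 1 else 0"]) auto
  then have "mat_rank (upper_left k k (1\<^sub>m k)) \<le> r" by (simp add: rank_le_mat_rank)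
  ultimately show ?thesis by (simp add: mat_rank_def)
qed

text \<open>Forward substitution: it applies to the left factor \<open>f\<close> the inverse of the
  unitriangular operation with coefficients \<open>c\<close>.\<close>

fun undo_rows :: "(nat \<Rightarrow> nat \<Rightarrow> real) \<Rightarrow> (nat \<Rightarrow> nat \<Rightarrow> real) \<Rightarrow> nat \<Rightarrow> nat \<Rightarrow> real" where
  "undo_rows c f i k = f i k - (\<Sum>i'<i. c i i' * undo_rows c f i' k)"

declare undo_rows.simps [simp del]

text \<open>Each row receives multiples of earlier rows only. So the operation is unitriangular,
  hence invertible, and it restricts to every upper-left corner.\<close>

lemma rank_le_row_operations:
  assumes a: "\<And>i j. i < p \<Longrightarrow> j < q \<Longrightarrow> a i j = b i j + (\<Sum>i'<i. c i i' * b i' j)"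
  shows "rank_le p q r a \<longleftrightarrow> rank_le p q r b"
proof
  assume "rank_le p q r a"
  then obtain f g where fg: "\<forall>i<p. \<forall>j<q. a i j = (\<Sum>k<r. f i k * g k j)"
    unfolding rank_le_def by blast
  have "b i j = (\<Sum>k<r. undo_rows c f i k * g k j)" if "i < p" "j < q" for i j
    using that(1)
  proof (induction i rule: less_induct)
    case (less i)
    have "b i j = (\<Sum>k<r. f i k * g k j) - (\<Sum>i'<i. c i i' * (\<Sum>k<r. undo_rows c f i' k * g k j))"
      using a[of i j] fg less that(2) by simp
    also have "(\<Sum>i'<i. c i i' * (\<Sum>k<r. undo_rows c f i' k * g k j)) =
        (\<Sum>k<r. (\<Sum>i'<i. c i i' * undo_rows c f i' k) * g k j)"
      unfolding sum_distrib_left sum_distrib_right by (subst sum.swap) (simp add: mult.assoc)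
    finally show ?case
      by (simp add: undo_rows.simps[of c f i] left_diff_distrib sum_subtractf)
  qed
  then show "rank_le p q r b" unfolding rank_le_def by blast
next
  assume "rank_le p q r b"
  define M where "M i k = (if k = i then 1 else if k < i then c i k else 0)" for i k
  have "(\<Sum>k<p. M i k * b k j) = a i j" if "i < p" "j < q" for i j
  proof -
    have "(\<Sum>k<p. M i k * b k j) = (\<Sum>k<Suc i. M i k * b k j)"
      by (rule sum.mono_neutral_right) (use that in \<open>auto simp: M_def\<close>)
    also have "\<dots> = (\<Sum>k<i. c i k * b k j) + b i j"
      by (simp add: M_def)
    finally show ?thesis using a[OF that] by simp
  qed
  then show "rank_le p q r a"
    using rank_le_mult_left[OF \<open>rank_le p q r b\<close>, of p M]
      rank_le_cong[of p q "\<lambda>i j. \<Sum>k<p. M i k * b k j" a r] by simp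
qed

text \<open>The leading columns are distinct but need not increase with the row. A row with
  \<open>pj i \<ge> q\<close> vanishes on the first \<open>q\<close> columns. For the lower bound,
  column operations reduce \<open>b\<close> to a 0-1 matrix which contains an identity
  matrix.\<close>

lemma rank_le_echelon:
  assumes inj: "\<And>i i'. \<lbrakk>i < p; i' < p; pj i < q; pj i' = pj i\<rbrakk> \<Longrightarrow> i = i'"
    and zero: "\<And>i j. \<lbrakk>i < p; j < q; j < pj i\<rbrakk> \<Longrightarrow> b i j = 0"
    and nonzero: "\<And>i. \<lbrakk>i < p; pj i < q\<rbrakk> \<Longrightarrow> b i (pj i) \<noteq> 0"
  shows "rank_le p q r b \<longleftrightarrow> card {i. i < p \<and> pj i < q} \<le> r"
proof
  let ?I = "{i. i < p \<and> pj i < q}"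
  obtain e where e: "bij_betw e {..<card ?I} ?I"
    using ex_bij_betw_nat_finite[of ?I] by (auto simp: atLeast0LessThan)
  have eI: "e k < p" "pj (e k) < q" if "k < card ?I" for k
    using bij_betwE[OF e] that by auto
  {
    assume "card ?I \<le> r"
    define f where "f i k = (if e k = i then 1 else (0::real))" for i k
    have "b i j = (\<Sum>k<card ?I. f i k * b (e k) j)" if "i < p" "j < q" for i j
    proof -
      have "(\<Sum>k<card ?I. f i k * b (e k) j) = (\<Sum>i'\<in>?I. (if i' = i then 1 else 0) * b i' j)"
        unfolding f_def by (rule sum.reindex_bij_betw[OF e])
      also have "\<dots> = (\<Sum>i'\<in>?I. if i' = i then b i j else 0)" by (intro sum.cong) auto
      also have "\<dots> = b i j" using that zero[of i j] by (auto simp: not_less)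
      finally show ?thesis by simp
    qed
    then have "rank_le p q (card ?I) b"
      unfolding rank_le_def by (intro exI[of _ f] exI[of _ "\<lambda>k j. b (e k) j"]) simp
    then show "rank_le p q r b" using rank_le_mono \<open>card ?I \<le> r\<close> by blast
  next
    assume b: "rank_le p q r b"
    define w where "w i j = (if pj i = j then 1 else (0::real))" for i j
    \<comment> \<open>\<open>V\<close> is upper triangular with nonzero diagonal: its row
      \<open>l\<close> is the row of \<open>b\<close> that leads in column \<open>l\<close>, or a
      unit vector if there is none. Then \<open>b = w V\<close>, a column operation on
      \<open>w\<close>.\<close>
    define V where "V l j = (if \<exists>i<p. pj i = l then b (THE i. i < p \<and> pj i = l) j else if l = j then 1 else 0)" for l j
    have V: "V (pj i) j = b i j" if "i < p" "pj i < q" for i j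
    proof -
      have "(THE i'. i' < p \<and> pj i' = pj i) = i" using that inj by (intro the_equality) auto
      then show ?thesis using that by (auto simp: V_def)
    qed
    have Vd: "V j j \<noteq> 0" if "j < q" for j
    proof (cases "\<exists>i<p. pj i = j")
      case True
      then show ?thesis using V nonzero that by auto
    qed (auto simp: V_def)
    \<comment> \<open>Dividing the columns by the diagonal of \<open>V\<close> makes this column
      operation unitriangular.\<close>
    have "rank_le p q r (\<lambda>i j. b i j / V j j)"
    proof -
      obtain f g where "\<forall>i<p. \<forall>j<q. b i j = (\<Sum>k<r. f i k * g k j)"
        using b unfolding rank_le_def by blast
      then show ?thesis unfolding rank_le_def
        by (intro exI[of _ f] exI[of _ "\<lambda>k j. g k j / V j j"]) (simp add: sum_divide_distrib)
    qed
    then have "rank_le q p r (\<lambda>j i. b i j / V j j)" by (subst (asm) rank_le_transpose)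
    moreover have "b i j / V j j = w i j + (\<Sum>l<j. V l j / V j j * w i l)" if "j < q" "i < p" for i j
    proof -
      have "(\<Sum>l<j. V l j / V j j * w i l) = (\<Sum>l<j. if pj i = l then V (pj i) j / V j j else 0)"
        by (intro sum.cong) (auto simp: w_def)
      then have "(\<Sum>l<j. V l j / V j j * w i l) = (if pj i < j then V (pj i) j / V j j else 0)" by simp
      moreover have "pj i < q" if "pj i \<le> j" using that \<open>j < q\<close> by simp
      ultimately show ?thesis
        using that V[of i j] Vd[of j] zero[of i j] by (cases j "pj i" rule: linorder_cases) (auto simp: w_def)
    qed
    ultimately have "rank_le q p r (\<lambda>j i. w i j)"
      using rank_le_row_operations[of q p "\<lambda>j i. b i j / V j j" "\<lambda>j i. w i j" "\<lambda>j l. V l j / V j j" r] by simp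
    then have "rank_le p q r w" by (subst rank_le_transpose)
    then obtain f g where fg: "\<forall>i<p. \<forall>j<q. w i j = (\<Sum>k<r. f i k * g k j)"
      unfolding rank_le_def by blast
    have "(if k = l then 1 else 0) = (\<Sum>m<r. f (e k) m * g m (pj (e l)))" if "k < card ?I" "l < card ?I" for k l
    proof -
      note kl = eI[OF that(1)] eI[OF that(2)]
      have "k = l" if "pj (e k) = pj (e l)"
      proof (rule inj_onD[OF bij_betw_imp_inj_on[OF e]])
        show "e k = e l" by (rule inj[OF kl(1,3,2) that[symmetric]])
      qed (use \<open>k < card ?I\<close> \<open>l < card ?I\<close> in blast)+
      then have "w (e k) (pj (e l)) = (if k = l then 1 else 0)" unfolding w_def by argo
      then show ?thesis using fg[rule_format, OF kl(1,4)] by argo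
    qed
    then have *: "\<forall>k<card ?I. \<forall>l<card ?I. (if k = l then 1 else 0) = (\<Sum>m<r. f (e k) m * g m (pj (e l)))"
      by blast
    have "rank_le (card ?I) (card ?I) r (\<lambda>i j. if i = j then 1 else 0)"
      unfolding rank_le_def by (intro exI[of _ "\<lambda>k m. f (e k) m"] exI[of _ "\<lambda>m l. g m (pj (e l))"]) (rule *)
    then show "card ?I \<le> r" by (rule rank_le_identity)
  }
qed

section \<open>Elimination along prescribed pivots\<close>

text \<open>
  Rows are numbered from 0, and \<open>P i\<close> is the column of the pivot in row \<open>i\<close>, or \<open>n\<close> if there is none.
  Row \<open>i\<close> is reduced by the multiples \<open>elim_coeff i i'\<close> of the reduced rows \<open>i' < i\<close> which clear the
  columns of the earlier pivots; left of its own pivot, the reduced row is replaced by 0. So all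
  quantities depend only on the entries which lie weakly below or weakly to the right of a pivot.
\<close>

function elim_coeff :: "nat \<Rightarrow> (nat \<Rightarrow> nat) \<Rightarrow> (nat \<Rightarrow> nat \<Rightarrow> real) \<Rightarrow> nat \<Rightarrow> nat \<Rightarrow> real"
  and elim_row :: "nat \<Rightarrow> (nat \<Rightarrow> nat) \<Rightarrow> (nat \<Rightarrow> nat \<Rightarrow> real) \<Rightarrow> nat \<Rightarrow> nat \<Rightarrow> real" where
  "elim_coeff n P a i i' = (if i' < i \<and> P i' < n then
     (a i (P i') - (\<Sum>k<i'. elim_coeff n P a i k * elim_row n P a k (P i'))) / elim_row n P a i' (P i') else 0)"
| "elim_row n P a i b = (if b < P i then 0 else a i b - (\<Sum>k<i. elim_coeff n P a i k * elim_row n P a k b))"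
  by pat_completeness auto
termination
  \<comment> \<open>Coefficients are ranked at \<open>(i, i')\<close> and the row \<open>i\<close>
    at \<open>(i, i)\<close>, above its own coefficients and all earlier rows.\<close>
  by (relation "inv_image (less_than <*lex*> less_than)
    (\<lambda>x. case x of Inl (n, P, a, i, i') \<Rightarrow> (i, i') | Inr (n, P, a, i, b) \<Rightarrow> (i, i))") auto

declare elim_coeff.simps [simp del] elim_row.simps [simp del]

lemma elim_row_left: "b < P i \<Longrightarrow> elim_row n P a i b = 0"
  by (subst elim_row.simps) simp

locale pivots =
  fixes m n :: nat and P :: "nat \<Rightarrow> nat"
  assumes P_inj: "\<lbrakk>i < m; i' < m; P i < n; P i' = P i\<rbrakk> \<Longrightarrow> i = i'"
begin

abbreviation "ecoeff \<equiv> elim_coeff n P"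
abbreviation "erow \<equiv> elim_row n P"

text \<open>This is the Rothe diagram with indices from 0, read off from the pivots; see
  \<open>rothe_diagram_eq_cells\<close>.\<close>

definition cells :: "(nat \<times> nat) set" where
  "cells = {(i, b). i < m \<and> b < n \<and> b < P i \<and> (\<forall>i'<i. P i' \<noteq> b)}"

definition pivot_count where "pivot_count p q = card {i. i < p \<and> P i < q}"

text \<open>\<open>good\<close> becomes the open set \<open>U\<close> and \<open>on_graph\<close>
  the graph equation; \<open>ranks_le\<close> and \<open>ranks_eq\<close> describe the closed
  variety and its open stratum.\<close>

definition good where "good a \<longleftrightarrow> (\<forall>i<m. P i < n \<longrightarrow> erow a i (P i) \<noteq> 0)"

definition on_graph where "on_graph a \<longleftrightarrow> (\<forall>(i, b)\<in>cells. a i b = (\<Sum>k<i. ecoeff a i k * erow a k b))"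

definition ranks_le where "ranks_le a \<longleftrightarrow> (\<forall>p\<le>m. \<forall>q\<le>n. rank_le p q (pivot_count p q) a)"

definition ranks_eq where
  "ranks_eq a \<longleftrightarrow> (\<forall>p\<le>m. \<forall>q\<le>n. \<forall>r. rank_le p q r a \<longleftrightarrow> pivot_count p q \<le> r)"

text \<open>The elimination never reads a cell: coefficients look at columns of earlier pivots,
  reduced rows at columns from their own pivot on. Hence the graph map is constant along the
  fibres.\<close>

lemma elim_cong:
  assumes "\<And>i j. \<lbrakk>i < m; j < n; (i, j) \<notin> cells\<rbrakk> \<Longrightarrow> a i j = a' i j" "i < m"
  shows "ecoeff a i i' = ecoeff a' i i'" and "b < n \<Longrightarrow> erow a i b = erow a' i b"
proof -
  have "(\<forall>i'. ecoeff a i i' = ecoeff a' i i') \<and> (\<forall>b<n. erow a i b = erow a' i b)"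
    using assms(2)
  proof (induction i rule: less_induct)
    case (less i)
    have rows: "erow a k b = erow a' k b" if "k < i" "b < n" for k b
      using less that by simp
    have c: "ecoeff a i i' = ecoeff a' i i'" for i'
    proof (induction i' rule: less_induct)
      case (less i')
      show ?case
      proof (cases "i' < i \<and> P i' < n")
        case True
        then have "(i, P i') \<notin> cells" unfolding cells_def by auto
        then have "a i (P i') = a' i (P i')" using assms(1) \<open>i < m\<close> True by blast
        moreover have "(\<Sum>k<i'. ecoeff a i k * erow a k (P i')) = (\<Sum>k<i'. ecoeff a' i k * erow a' k (P i'))"
          using less.IH rows True by (intro sum.cong) auto
        ultimately show ?thesis
          using True rows by (simp add: elim_coeff.simps[of _ _ _ i i'])
      next
        case False
        then show ?thesis by (auto simp: elim_coeff.simps[of _ _ _ i i'])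
      qed
    qed
    have "erow a i b = erow a' i b" if "b < n" for b
    proof (cases "b < P i")
      case True
      then show ?thesis by (simp add: elim_row_left)
    next
      case False
      then have "(i, b) \<notin> cells" unfolding cells_def by auto
      then have "a i b = a' i b" using assms(1) less.prems that by blast
      moreover have "(\<Sum>k<i. ecoeff a i k * erow a k b) = (\<Sum>k<i. ecoeff a' i k * erow a' k b)"
        using c rows that by (intro sum.cong) auto
      ultimately show ?thesis using False by (simp add: elim_row.simps[of _ _ _ i])
    qed
    then show ?case using c by blast
  qed
  then show "ecoeff a i i' = ecoeff a' i i'" "b < n \<Longrightarrow> erow a i b = erow a' i b" by auto
qed

lemma sum_split_at:
  fixes f :: "nat \<Rightarrow> real"
  assumes "k < i" "\<And>j. k < j \<Longrightarrow> j < i \<Longrightarrow> f j = 0"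
  shows "(\<Sum>j<i. f j) = (\<Sum>j<k. f j) + f k"
proof -
  have "(\<Sum>j<i. f j) = (\<Sum>j<Suc k. f j)"
    by (rule sum.mono_neutral_right) (use assms in auto)
  then show ?thesis by simp
qed

text \<open>Below row \<open>k\<close>, the reduced rows vanish in the pivot column of row
  \<open>k\<close>. So the sum stops at \<open>k\<close>, where the coefficient was chosen to
  complete the entry.\<close>

lemma elim_pivot_column:
  assumes "k < i" "P k < n" "\<And>j. \<lbrakk>j < i; P j < n\<rbrakk> \<Longrightarrow> erow a j (P j) \<noteq> 0"
  shows "erow a i (P k) = 0" and "(\<Sum>j<i. ecoeff a i j * erow a j (P k)) = a i (P k)"
proof -
  have "erow a i (P k) = 0 \<and> (\<Sum>j<i. ecoeff a i j * erow a j (P k)) = a i (P k)"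
    using assms(1,3)
  proof (induction i rule: less_induct)
    case (less i)
    have "(\<Sum>j<i. ecoeff a i j * erow a j (P k)) = (\<Sum>j<k. ecoeff a i j * erow a j (P k)) + ecoeff a i k * erow a k (P k)"
      by (rule sum_split_at) (use less in auto)
    also have "\<dots> = a i (P k)"
      using less.prems assms(2) by (simp add: elim_coeff.simps[of _ _ _ i k])
    finally show ?case by (simp add: elim_row.simps[of _ _ _ i])
  qed
  then show "erow a i (P k) = 0" "(\<Sum>j<i. ecoeff a i j * erow a j (P k)) = a i (P k)" by auto
qed

text \<open>Outside the cells, an entry left of the pivot of its row lies in an earlier pivot
  column, where \<open>elim_pivot_column\<close> applies. Elsewhere the identity is the definition
  of \<open>elim_row\<close>.\<close>

lemma elim_decompose:
  assumes "i < m" "b < n" "(i, b) \<notin> cells" "\<And>j. \<lbrakk>j < i; P j < n\<rbrakk> \<Longrightarrow> erow a j (P j) \<noteq> 0"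
  shows "a i b = erow a i b + (\<Sum>k<i. ecoeff a i k * erow a k b)"
proof (cases "b < P i")
  case True
  then obtain k where "k < i" "P k = b" using assms(1-3) unfolding cells_def by auto
  then show ?thesis using elim_pivot_column[of k i a] assms by simp
next
  case False
  then show ?thesis by (simp add: elim_row.simps[of _ _ _ i])
qed

text \<open>The graph equation supplies the decomposition in the cells as well, so on every corner
  \<open>a\<close> is row equivalent to \<open>erow a\<close>, whose rank is a count of
  pivots.\<close>

lemma ranks_eq_if_on_graph:
  assumes "good a" "on_graph a"
  shows "ranks_eq a"
  unfolding ranks_eq_def
proof (intro allI impI)
  fix p q r assume pq: "p \<le> m" "q \<le> n"
  have "a i j = erow a i j + (\<Sum>k<i. ecoeff a i k * erow a k j)" if "i < p" "j < q" for i j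
  proof (cases "(i, j) \<in> cells")
    case True
    then show ?thesis using assms(2) unfolding on_graph_def
      by (auto simp: elim_row_left cells_def)
  next
    case False
    then show ?thesis using assms(1) that pq by (intro elim_decompose) (auto simp: good_def)
  qed
  then have "rank_le p q r a \<longleftrightarrow> rank_le p q r (erow a)"
    by (rule rank_le_row_operations)
  also have "\<dots> \<longleftrightarrow> pivot_count p q \<le> r"
    unfolding pivot_count_def
    by (rule rank_le_echelon) (use P_inj pq assms(1) in \<open>auto simp: good_def elim_row_left\<close>)
  finally show "rank_le p q r a \<longleftrightarrow> pivot_count p q \<le> r" .
qed

text \<open>
  Once the rows above are in reduced position, the residual \<open>x\<close> of row \<open>i\<close> behaves like a reduced row
  with pivot column \<open>v\<close>.
\<close>

lemma rank_le_next_row: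
  assumes i: "i < m" and b: "b < n"
    and above: "\<And>k j. \<lbrakk>k < i; j < n\<rbrakk> \<Longrightarrow> a k j = erow a k j + (\<Sum>l<k. ecoeff a k l * erow a l j)"
    and nz: "\<And>k. \<lbrakk>k < i; P k < n\<rbrakk> \<Longrightarrow> erow a k (P k) \<noteq> 0"
    and x: "\<And>j. x j = a i j - (\<Sum>k<i. ecoeff a i k * erow a k j)"
    and zero: "\<And>j. \<lbrakk>j < v; j \<le> b\<rbrakk> \<Longrightarrow> x j = 0" and lead: "v \<le> b \<Longrightarrow> x v \<noteq> 0"
    and fresh: "\<And>k. k < i \<Longrightarrow> P k \<noteq> v \<or> b < v"
  shows "rank_le (Suc i) (Suc b) r a \<longleftrightarrow> pivot_count i (Suc b) + (if v \<le> b then 1 else 0) \<le> r"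
proof -
  let ?R = "\<lambda>k j. if k = i then x j else erow a k j"
  \<comment> \<open>Row \<open>i\<close> is treated as if its pivot were in column \<open>v\<close>;
    a value \<open>v > b\<close> encodes a residual that vanishes through column
    \<open>b\<close>.\<close>
  let ?Q = "P(i := v)"
  have "rank_le (Suc i) (Suc b) r a \<longleftrightarrow> rank_le (Suc i) (Suc b) r ?R"
  proof (rule rank_le_row_operations)
    fix k j assume kj: "k < Suc i" "j < Suc b"
    have "(\<Sum>l<k. ecoeff a k l * ?R l j) = (\<Sum>l<k. ecoeff a k l * erow a l j)"
      using kj by (intro sum.cong) auto
    then show "a k j = ?R k j + (\<Sum>l<k. ecoeff a k l * ?R l j)"
      using kj b above[of k j] x[of j] by (cases "k = i") auto
  qed
  also have "\<dots> \<longleftrightarrow> card {k. k < Suc i \<and> ?Q k < Suc b} \<le> r"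
  proof (rule rank_le_echelon)
    fix k k' assume k: "k < Suc i" "k' < Suc i" "?Q k < Suc b" "?Q k' = ?Q k"
    consider "k = i" "k' = i" | "k = i" "k' < i" | "k < i" "k' = i" | "k < i" "k' < i"
      using k(1,2) by linarith
    then show "k = k'"
    proof cases
      case 4
      then have "k < m" "k' < m" "P k < n" "P k' = P k" using k i b by auto
      then show ?thesis by (rule P_inj)
    qed (use k fresh[of k] fresh[of k'] in auto)
  next
    fix k j assume "k < Suc i" "j < Suc b" "j < ?Q k"
    then show "?R k j = 0" using zero[of j] by (cases "k = i") (auto simp: elim_row_left)
  next
    fix k assume "k < Suc i" "?Q k < Suc b"
    then show "?R k (?Q k) \<noteq> 0" using lead nz[of k] b by (cases "k = i") auto
  qed
  also have "{k. k < Suc i \<and> ?Q k < Suc b} = {k. k < i \<and> P k < Suc b} \<union> (if v \<le> b then {i} else {})"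
    by (auto split: if_splits)
  also have "card \<dots> = pivot_count i (Suc b) + (if v \<le> b then 1 else 0)"
    unfolding pivot_count_def by (subst card_Un_disjoint) auto
  finally show ?thesis .
qed

lemma pivot_count_Suc: "pivot_count (Suc i) q = pivot_count i q + (if P i < q then 1 else 0)"
proof -
  have *: "{k. k < Suc i \<and> P k < q} = {k. k < i \<and> P k < q} \<union> (if P i < q then {i} else {})"
    by (auto simp: less_Suc_eq)
  show ?thesis unfolding pivot_count_def * by (subst card_Un_disjoint) auto
qed

text \<open>If the residual of row \<open>i\<close> began at some \<open>b < P i\<close>, the corner
  ending at \<open>(i, b)\<close> would have rank one too large. If it still vanished at
  \<open>P i\<close>, the corner ending there would have rank one too small.\<close>

lemma on_graph_next_row:
  assumes a: "ranks_le a" and i: "i < m"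
    and above: "\<And>k j. \<lbrakk>k < i; (k, j) \<in> cells\<rbrakk> \<Longrightarrow> a k j = (\<Sum>l<k. ecoeff a k l * erow a l j)"
    and nz: "\<And>k. \<lbrakk>k < i; P k < n\<rbrakk> \<Longrightarrow> erow a k (P k) \<noteq> 0"
  shows "\<lbrakk>b < n; b < P i\<rbrakk> \<Longrightarrow> a i b = (\<Sum>k<i. ecoeff a i k * erow a k b)"
    and "\<lbrakk>ranks_eq a; P i < n\<rbrakk> \<Longrightarrow> erow a i (P i) \<noteq> 0"
proof -
  have dec: "a k j = erow a k j + (\<Sum>l<k. ecoeff a k l * erow a l j)" if "k < i" "j < n" for k j
  proof (cases "(k, j) \<in> cells")
    case True
    then show ?thesis using above that by (auto simp: elim_row_left cells_def)
  next
    case False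
    then show ?thesis using nz that i by (intro elim_decompose) auto
  qed
  define x where "x j = a i j - (\<Sum>k<i. ecoeff a i k * erow a k j)" for j
  have x0: "x b = 0" if "b < n" "b < P i" for b
    using that
  proof (induction b rule: less_induct)
    case (less b)
    show ?case
    proof (rule ccontr)
      assume xb: "x b \<noteq> 0"
      \<comment> \<open>The residual vanishes in all earlier pivot columns, so its first nonzero
        entry lies in a new column.\<close>
      have fresh: "P k \<noteq> b" if "k < i" for k
        using elim_pivot_column(2)[OF that, of a] nz xb less.prems unfolding x_def by auto
      have "rank_le (Suc i) (Suc b) (pivot_count (Suc i) (Suc b)) a"
        using a i less.prems unfolding ranks_le_def by auto
      then show False
        using rank_le_next_row[OF i less.prems(1) dec nz x_def, of b] less xb fresh
        by (auto simp: pivot_count_Suc)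
    qed
  qed
  then show "\<lbrakk>b < n; b < P i\<rbrakk> \<Longrightarrow> a i b = (\<Sum>k<i. ecoeff a i k * erow a k b)"
    by (simp add: x_def)
  show "erow a i (P i) \<noteq> 0" if eq: "ranks_eq a" and Pi: "P i < n"
  proof
    assume "erow a i (P i) = 0"
    then have "x (P i) = 0" by (simp add: elim_row.simps[of _ _ _ i] x_def)
    then have "x j = 0" if "j \<le> P i" for j using x0 that Pi by (cases "j = P i") auto
    \<comment> \<open>The value \<open>n\<close> for \<open>v\<close> lies beyond every column, so
      row \<open>i\<close> adds nothing to the rank.\<close>
    then have "rank_le (Suc i) (Suc (P i)) (pivot_count i (Suc (P i))) a"
      using rank_le_next_row[OF i Pi dec nz x_def, of n] Pi by auto
    then have "pivot_count (Suc i) (Suc (P i)) \<le> pivot_count i (Suc (P i))"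
      using eq i Pi unfolding ranks_eq_def by (metis Suc_leI)
    then show False by (simp add: pivot_count_Suc)
  qed
qed

lemma ranks_eq_imp_le: "ranks_eq a \<Longrightarrow> ranks_le a"
  unfolding ranks_eq_def ranks_le_def by auto

lemma on_graph_if_ranks_le:
  assumes "ranks_le a" "good a" shows "on_graph a"
proof -
  have "\<forall>b. (i, b) \<in> cells \<longrightarrow> a i b = (\<Sum>k<i. ecoeff a i k * erow a k b)" for i
  proof (induction i rule: less_induct)
    case (less i)
    show ?case
    proof (intro allI impI)
      fix b assume b: "(i, b) \<in> cells"
      then have i: "i < m" by (simp add: cells_def)
      show "a i b = (\<Sum>k<i. ecoeff a i k * erow a k b)"
        by (rule on_graph_next_row(1)[OF assms(1) i])
          (use less b assms(2) i in \<open>auto simp: cells_def good_def\<close>)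
    qed
  qed
  then show ?thesis unfolding on_graph_def by auto
qed

text \<open>The induction carries both claims, since the pivot of a row can be examined only after
  the rows above are known to be reduced with nonzero pivots.\<close>

lemma good_if_ranks_eq:
  assumes "ranks_eq a" shows "good a"
proof -
  have "i < m \<Longrightarrow> (P i < n \<longrightarrow> erow a i (P i) \<noteq> 0) \<and> (\<forall>b. (i, b) \<in> cells \<longrightarrow> a i b = (\<Sum>k<i. ecoeff a i k * erow a k b))" for i
  proof (induction i rule: less_induct)
    case (less i)
    have 1: "a k j = (\<Sum>l<k. ecoeff a k l * erow a l j)" if "k < i" "(k, j) \<in> cells" for k j
      using less that by auto
    have 2: "erow a k (P k) \<noteq> 0" if "k < i" "P k < n" for k
      using less that by auto
    show ?case
      using on_graph_next_row[OF ranks_eq_imp_le[OF assms] less.prems 1 2] assms by (auto simp: cells_def)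
  qed
  then show ?thesis by (simp add: good_def)
qed

text \<open>The first equivalence gives relative openness in the closed variety, the second the
  graph.\<close>

lemma ranks_eq_iff_good: "ranks_eq a \<longleftrightarrow> good a \<and> ranks_le a"
  and ranks_eq_iff_on_graph: "ranks_eq a \<longleftrightarrow> good a \<and> on_graph a"
  using good_if_ranks_eq on_graph_if_ranks_le ranks_eq_if_on_graph ranks_eq_imp_le by blast+

text \<open>On \<open>G k\<close> the pivots before row \<open>k\<close> do not vanish, so the
  divisions in row \<open>k\<close> are legitimate. Openness of \<open>G k\<close> in turn uses the
  continuity of the previous row, hence a single induction.\<close>

lemma elim_smooth:
  fixes a :: "'e::euclidean_space \<Rightarrow> nat \<Rightarrow> nat \<Rightarrow> real"
  assumes a: "\<And>i j. linear (\<lambda>x. a x i j)"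
  defines "G \<equiv> \<lambda>k. {x. \<forall>i<k. P i < n \<longrightarrow> erow (a x) i (P i) \<noteq> 0}"
  shows "open (G k) \<and> (\<forall>b. smooth_on (G k) (\<lambda>x. erow (a x) k b)) \<and> (\<forall>i. smooth_on (G k) (\<lambda>x. ecoeff (a x) k i))"
proof (induction k rule: less_induct)
  case (less k)
  have Gmono: "G k \<subseteq> G j" if "j \<le> k" for j using that unfolding G_def by auto
  have redG: "smooth_on (G k) (\<lambda>x. erow (a x) j b)" if "j < k" for j b
    using less[OF that] Gmono[of j] that smooth_on_subset less_imp_le by blast
  have open_G: "open (G k)"
  proof (cases k)
    case 0
    then show ?thesis by (simp add: G_def)
  next
    case (Suc j)
    show ?thesis
    proof (cases "P j < n")
      case True
      have "continuous_on (G j) (\<lambda>x. erow (a x) j (P j))"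
        using less[of j] Suc smooth_on_continuous by blast
      then have "open (G j \<inter> (\<lambda>x. erow (a x) j (P j)) -` (- {0}))"
        using less[of j] Suc by (intro continuous_open_preimage) auto
      also have "G j \<inter> (\<lambda>x. erow (a x) j (P j)) -` (- {0}) = G k"
        using True Suc by (auto simp: G_def less_Suc_eq)
      finally show ?thesis .
    next
      case False
      then have "G k = G j" using Suc by (auto simp: G_def less_Suc_eq)
      then show ?thesis using less[of j] Suc by simp
    qed
  qed
  have sa: "smooth_on (G k) (\<lambda>x. a x k b)" for b
    by (rule smooth_on_linear[OF open_G a])
  have ca: "smooth_on (G k) (\<lambda>x. ecoeff (a x) k i)" for i
  proof (induction i rule: less_induct)
    case (less i)
    show ?case
    proof (cases "i < k \<and> P i < n")
      case True
      have "smooth_on (G k) (\<lambda>x. (a x k (P i) - (\<Sum>j<i. ecoeff (a x) k j * erow (a x) j (P i))) / erow (a x) i (P i))"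
        using True less redG
        by (intro smooth_on_divide smooth_on_diff smooth_on_sum smooth_on_mult sa open_G)
          (auto simp: G_def)
      then show ?thesis using True by (simp add: elim_coeff.simps[of _ _ _ k i])
    next
      case False
      then show ?thesis by (auto simp: elim_coeff.simps[of _ _ _ k i] intro: smooth_on_const)
    qed
  qed
  have "smooth_on (G k) (\<lambda>x. erow (a x) k b)" for b
  proof (cases "b < P k")
    case True
    then show ?thesis by (simp add: elim_row_left smooth_on_const)
  next
    case False
    have "smooth_on (G k) (\<lambda>x. a x k b - (\<Sum>j<k. ecoeff (a x) k j * erow (a x) j b))"
      using ca redG
      by (intro smooth_on_diff smooth_on_sum smooth_on_mult sa open_G) auto
    then show ?thesis using False by (simp add: elim_row.simps[of _ _ _ k])
  qed
  then show ?case using open_G ca by blast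
qed

end

section \<open>Partial permutations and their diagrams\<close>

context pivots
begin

lemma pivot_count_Suc_col:
  assumes "k < p" "p \<le> m" "P k = b" "b < n"
  shows "pivot_count p (Suc b) = Suc (pivot_count p b)"
proof -
  have "{i. i < p \<and> P i < Suc b} = insert k {i. i < p \<and> P i < b}"
    using assms P_inj[of k] by (auto simp: less_Suc_eq dest: less_le_trans)
  then show ?thesis unfolding pivot_count_def using assms by simp
qed

text \<open>At a corner that does not end in a cell, either the last row has its pivot inside or the
  last column is an earlier pivot column. Deleting that row or column lowers the prescribed rank by
  one, so the bound follows from a smaller corner.\<close>

lemma ranks_le_iff_cells:
  "ranks_le a \<longleftrightarrow> (\<forall>(i, b)\<in>cells. rank_le (Suc i) (Suc b) (pivot_count (Suc i) (Suc b)) a)"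
proof (intro iffI)
  assume "ranks_le a"
  then show "\<forall>(i, b)\<in>cells. rank_le (Suc i) (Suc b) (pivot_count (Suc i) (Suc b)) a"
    unfolding ranks_le_def cells_def by auto
next
  assume cells: "\<forall>(i, b)\<in>cells. rank_le (Suc i) (Suc b) (pivot_count (Suc i) (Suc b)) a"
  have "rank_le p q (pivot_count p q) a" if "p \<le> m" "q \<le> n" for p q
    using that
  proof (induction "p + q" arbitrary: p q rule: less_induct)
    case less
    show ?case
    proof (cases "p = 0 \<or> q = 0")
      case True
      then show ?thesis unfolding rank_le_def by auto
    next
      case False
      then obtain i b where pq: "p = Suc i" "q = Suc b" by (metis not0_implies_Suc)
      consider "(i, b) \<in> cells" | "P i \<le> b" | k where "k < i" "P k = b"
        using less.prems pq unfolding cells_def by force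
      then show ?thesis
      proof cases
        case 1
        then show ?thesis using cells pq by auto
      next
        case 2
        then show ?thesis
          using rank_le_add_row[OF less.hyps[of i q]] less.prems pq by (simp add: pivot_count_Suc)
      next
        case 3
        then show ?thesis
          using rank_le_add_col[OF less.hyps[of p b]] less.prems pq pivot_count_Suc_col[of k p b] by simp
      qed
    qed
  qed
  then show "ranks_le a" by (simp add: ranks_le_def)
qed

text \<open>For a cell in row \<open>i\<close>, the columns up to \<open>b\<close> split into the
  cells of that row and the pivot columns of earlier rows. So the rank bounds depend on the diagram
  alone, which reduces \<open>Gr2_tilde\<close> to \<open>Gr2\<close>.\<close>

lemma pivot_count_eq_cells:
  assumes "(i, b) \<in> cells"
  shows "pivot_count (Suc i) (Suc b) = Suc b - card {j. j \<le> b \<and> (i, j) \<in> cells}"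
proof -
  let ?K = "{k. k < Suc i \<and> P k < Suc b}" and ?J = "{j. j \<le> b \<and> (i, j) \<in> cells}"
  have ib: "i < m" "b < n" "b < P i" using assms by (auto simp: cells_def)
  have "inj_on P ?K" using P_inj ib by (auto intro!: inj_onI)
  then have "card (P ` ?K) = pivot_count (Suc i) (Suc b)" by (simp add: card_image pivot_count_def)
  moreover have "{..b} = ?J \<union> P ` ?K"
    using ib by (auto simp: cells_def less_Suc_eq image_iff)
  moreover have "?J \<inter> P ` ?K = {}" using ib by (auto simp: cells_def less_Suc_eq)
  ultimately have "card {..b} = card ?J + pivot_count (Suc i) (Suc b)"
    using card_Un_disjoint[of ?J "P ` ?K"] by simp
  then show ?thesis by simp
qed

end

definition pivot_col :: "real mat \<Rightarrow> nat \<Rightarrow> nat" where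
  "pivot_col \<omega> i = (if \<exists>j<dim_col \<omega>. \<omega> $$ (i, j) = 1
     then THE j. j < dim_col \<omega> \<and> \<omega> $$ (i, j) = 1 else dim_col \<omega>)"

locale partial_perm =
  fixes \<omega> :: "real mat" and m n P
  assumes pp: "partial_permutation \<omega>"
  defines "m \<equiv> dim_row \<omega>" and "n \<equiv> dim_col \<omega>" and "P \<equiv> pivot_col \<omega>"
begin

lemma P_eqI:
  assumes "i < m" "j < n" "\<omega> $$ (i, j) = 1" shows "P i = j"
proof -
  have "(THE j. j < dim_col \<omega> \<and> \<omega> $$ (i, j) = 1) = j"
    using pp assms unfolding partial_permutation_def m_def n_def by (intro the_equality) auto
  then show ?thesis using assms by (auto simp: P_def pivot_col_def n_def)
qed

lemma P_none: "(\<And>j. j < n \<Longrightarrow> \<omega> $$ (i, j) \<noteq> 1) \<Longrightarrow> P i = n"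
  by (auto simp: P_def pivot_col_def n_def)

lemma P_one: "i < m \<Longrightarrow> P i < n \<Longrightarrow> \<omega> $$ (i, P i) = 1"
  using P_eqI P_none by fastforce

lemma entry: "i < m \<Longrightarrow> j < n \<Longrightarrow> \<omega> $$ (i, j) = (if P i = j then 1 else 0)"
  using P_eqI[of i j] P_one[of i] pp unfolding partial_permutation_def m_def n_def by metis

sublocale pivots m n P
proof
  fix i i' assume "i < m" "i' < m" "P i < n" "P i' = P i"
  then show "i = i'" using P_one[of i] P_one[of i'] pp unfolding partial_permutation_def m_def n_def by auto
qed

lemma mat_rank_pivot_count:
  assumes "p \<le> m" "q \<le> n"
  shows "mat_rank (upper_left p q \<omega>) = pivot_count p q"
proof -
  have "rank_le p q r (\<lambda>i j. \<omega> $$ (i, j)) \<longleftrightarrow> pivot_count p q \<le> r" for r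
    unfolding pivot_count_def
    by (rule rank_le_echelon) (use P_inj P_one entry assms in auto)
  then show ?thesis using rank_le_mat_rank by (metis order_antisym order_refl)
qed

lemma X_closed_iff: "A \<in> X_closed \<omega> \<longleftrightarrow> A \<in> carrier_mat m n \<and> ranks_le (\<lambda>i j. A $$ (i, j))"
proof -
  have "rank_le p q (pivot_count p q) a" if "p = 0 \<or> q = 0" for p q a
    using that unfolding rank_le_def by auto
  then have "ranks_le a \<longleftrightarrow> (\<forall>p\<in>{1..m}. \<forall>q\<in>{1..n}. rank_le p q (pivot_count p q) a)" for a
    unfolding ranks_le_def by (metis atLeastAtMost_iff less_one not_le)
  then show ?thesis
    unfolding X_closed_def by (auto simp: m_def[symmetric] n_def[symmetric] mat_rank_pivot_count rank_le_mat_rank)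
qed

lemma X_open_iff: "A \<in> X_open \<omega> \<longleftrightarrow> A \<in> carrier_mat m n \<and> ranks_eq (\<lambda>i j. A $$ (i, j))"
proof -
  have 0: "rank_le p q r a" "pivot_count p q = 0" if "p = 0 \<or> q = 0" for p q r a
    using that unfolding rank_le_def pivot_count_def by auto
  have "ranks_eq a \<longleftrightarrow> (\<forall>p\<in>{1..m}. \<forall>q\<in>{1..n}. \<forall>r. rank_le p q r a \<longleftrightarrow> pivot_count p q \<le> r)" for a
    unfolding ranks_eq_def using 0 by (metis atLeastAtMost_iff le0 less_one not_le)
  moreover have "mat_rank (upper_left p q A) = pivot_count p q \<longleftrightarrow>
      (\<forall>r. rank_le p q r (\<lambda>i j. A $$ (i, j)) \<longleftrightarrow> pivot_count p q \<le> r)" for p q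
    unfolding rank_le_mat_rank[symmetric] by (metis order_antisym order_refl)
  ultimately show ?thesis
    unfolding X_open_def by (auto simp: m_def[symmetric] n_def[symmetric] mat_rank_pivot_count)
qed

section \<open>Values of the extension and the Rothe diagram\<close>

lemma row_image_eq:
  assumes "i \<in> {1..m}"
  shows "row_image \<omega> i = (if P (i - 1) < n then Some (Suc (P (i - 1))) else None)"
proof -
  have i: "i - 1 < m" using assms by auto
  show ?thesis
  proof (cases "P (i - 1) < n")
    case True
    have "(THE j. j \<in> {1..dim_col \<omega>} \<and> \<omega> $$ (i - 1, j - 1) = 1) = Suc (P (i - 1))"
    proof (rule the_equality)
      show "Suc (P (i - 1)) \<in> {1..dim_col \<omega>} \<and> \<omega> $$ (i - 1, Suc (P (i - 1)) - 1) = 1"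
        using True P_one[OF i] by (auto simp: n_def)
      show "j = Suc (P (i - 1))" if "j \<in> {1..dim_col \<omega>} \<and> \<omega> $$ (i - 1, j - 1) = 1" for j
        using P_eqI[OF i, of "j - 1"] that by (auto simp: n_def)
    qed
    moreover have "\<exists>j\<in>{1..dim_col \<omega>}. \<omega> $$ (i - 1, j - 1) = 1"
      using True P_one[OF i] by (intro bexI[of _ "Suc (P (i - 1))"]) (auto simp: n_def)
    ultimately show ?thesis using True by (simp add: row_image_def)
  next
    case False
    have "\<omega> $$ (i - 1, j - 1) \<noteq> 1" if "j \<in> {1..dim_col \<omega>}" for j
    proof
      assume "\<omega> $$ (i - 1, j - 1) = 1"
      moreover have "j - 1 < n" using that by (auto simp: n_def)
      ultimately show False using P_eqI[OF i, of "j - 1"] False by simp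
    qed
    then show ?thesis using False by (simp add: row_image_def)
  qed
qed

abbreviation "ext \<equiv> extension \<omega>"

lemma ext_pivot: "i \<in> {1..m} \<Longrightarrow> P (i - 1) < n \<Longrightarrow> ext i = Suc (P (i - 1))"
  by (subst extension.simps) (auto simp: row_image_eq m_def[symmetric])

lemma Min_diff:
  fixes B :: "nat set"
  assumes "finite A" "finite B" "card B < card A"
  shows "Min (A - B) \<in> A - B" and "\<And>x. x \<in> A - B \<Longrightarrow> Min (A - B) \<le> x"
proof -
  have "A - B \<noteq> {}" using assms card_mono[of B A] by auto
  then show "Min (A - B) \<in> A - B" using assms(1) by (intro Min_in) auto
  show "\<And>x. x \<in> A - B \<Longrightarrow> Min (A - B) \<le> x" using assms(1) by (intro Min_le) auto
qed

text \<open>Fewer than \<open>i\<close> values are taken before step \<open>i\<close>, so the minima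
  in the extension range over nonempty sets: there are \<open>m\<close> candidates above
  \<open>n\<close> for a row, and \<open>m + n\<close> afterwards.\<close>

lemma card_ext_image: "1 \<le> i \<Longrightarrow> card (ext ` {1..<i}) < i"
  using card_image_le[of "{1..<i}" ext] by simp

lemma ext_no_pivot:
  assumes "i \<in> {1..m}" "\<not> P (i - 1) < n"
  shows "ext i \<in> {n + 1..m + n} - ext ` {1..<i}"
    and "\<And>x. x \<in> {n + 1..m + n} - ext ` {1..<i} \<Longrightarrow> ext i \<le> x"
proof -
  have eq: "ext i = Min ({n + 1..m + n} - ext ` {1..<i})"
    using assms by (subst extension.simps) (simp add: row_image_eq m_def[symmetric] n_def[symmetric])
  have "card (ext ` {1..<i}) < card {n + 1..m + n}" using card_ext_image[of i] assms(1) by simp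
  then show "ext i \<in> {n + 1..m + n} - ext ` {1..<i}"
    and "\<And>x. x \<in> {n + 1..m + n} - ext ` {1..<i} \<Longrightarrow> ext i \<le> x"
    unfolding eq by (intro Min_diff; simp)+
qed

lemma ext_below:
  assumes "i \<in> {m + 1..m + n}"
  shows "ext i \<in> {1..m + n} - ext ` {1..<i}"
    and "\<And>x. x \<in> {1..m + n} - ext ` {1..<i} \<Longrightarrow> ext i \<le> x"
proof -
  have eq: "ext i = Min ({1..m + n} - ext ` {1..<i})"
    using assms by (subst extension.simps) (simp add: m_def[symmetric] n_def[symmetric])
  have "card (ext ` {1..<i}) < card {1..m + n}" using card_ext_image[of i] assms(1) by simp
  then show "ext i \<in> {1..m + n} - ext ` {1..<i}"
    and "\<And>x. x \<in> {1..m + n} - ext ` {1..<i} \<Longrightarrow> ext i \<le> x"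
    unfolding eq by (intro Min_diff; simp)+
qed

lemma ext_less_neq:
  assumes "1 \<le> i'" "i' < i" "i \<le> m + n" shows "ext i' \<noteq> ext i"
proof -
  have prev: "ext i' \<notin> A - ext ` {1..<i}" for A using assms by auto
  consider "i \<in> {1..m}" "P (i - 1) < n" | "i \<in> {1..m}" "\<not> P (i - 1) < n" | "i \<in> {m + 1..m + n}"
    using assms by force
  then show ?thesis
  proof cases
    case 1
    have i': "i' \<in> {1..m}" using 1 assms by auto
    show ?thesis
    proof (cases "P (i' - 1) < n")
      case True
      then show ?thesis using ext_pivot[OF i' True] ext_pivot[OF 1] P_inj[of "i - 1" "i' - 1"] 1 assms i' by fastforce
    next
      case False
      then show ?thesis using ext_no_pivot(1)[OF i' False] ext_pivot[OF 1] 1 by auto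
    qed
  next
    case 2
    then show ?thesis using ext_no_pivot(1)[OF 2] prev by metis
  next
    case 3
    then show ?thesis using ext_below(1)[OF 3] prev by metis
  qed
qed

lemma ext_bij: "bij_betw ext {1..m + n} {1..m + n}"
proof -
  have "inj_on ext {1..m + n}"
    by (rule inj_onI) (metis ext_less_neq atLeastAtMost_iff nat_neq_iff)
  moreover have "ext ` {1..m + n} \<subseteq> {1..m + n}"
  proof
    fix x assume "x \<in> ext ` {1..m + n}"
    then obtain i where i: "i \<in> {1..m + n}" "x = ext i" by auto
    consider "i \<in> {1..m}" "P (i - 1) < n" | "i \<in> {1..m}" "\<not> P (i - 1) < n" | "i \<in> {m + 1..m + n}"
      using i by force
    then show "x \<in> {1..m + n}"
      by cases (use i ext_pivot ext_no_pivot(1) ext_below(1) in force)+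
  qed
  ultimately show ?thesis
    by (simp add: bij_betw_def card_image card_subset_eq)
qed

lemma rothe_diagram_iff:
  "(i, j) \<in> rothe_diagram \<omega> \<longleftrightarrow> i \<in> {1..m + n} \<and> ext i > j \<and> (\<exists>k\<in>{1..m + n}. ext k = j \<and> k > i)"
proof -
  have "inv_into {1..m + n} ext (ext k) = k" if "k \<in> {1..m + n}" for k
    using ext_bij that by (intro inv_into_f_f) (auto simp: bij_betw_def)
  moreover have "j \<in> {1..m + n} \<longleftrightarrow> (\<exists>k\<in>{1..m + n}. ext k = j)"
    using bij_betw_imp_surj_on[OF ext_bij] by (metis imageE imageI)
  ultimately show ?thesis
    unfolding rothe_diagram_def Let_def m_def[symmetric] n_def[symmetric] mem_Collect_eq prod.case by metis
qed

text \<open>A smaller value that is still free would have been preferred wherever the extension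
  takes a minimum over it. This excludes \<open>i > m\<close>, and \<open>j > n\<close> in rows
  without a pivot; what remains are the cells.\<close>

lemma rothe_diagram_eq_cells: "rothe_diagram \<omega> = (\<lambda>(i, j). (Suc i, Suc j)) ` cells"
proof (intro equalityI subsetI)
  fix x assume "x \<in> rothe_diagram \<omega>"
  then obtain i j k where x: "x = (i, j)" and i: "i \<in> {1..m + n}" "ext i > j"
    and k: "k \<in> {1..m + n}" "ext k = j" "k > i"
    using rothe_diagram_iff by (metis surj_pair)
  have j: "j \<in> {1..m + n}" using k ext_bij by (auto simp: bij_betw_def)
  have fresh: "ext i' \<noteq> j" if "i' \<in> {1..<i}" for i'
    using ext_less_neq[of i' k] that k by auto
  then have new: "j \<notin> ext ` {1..<i}" by blast
  have im: "i \<in> {1..m}"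
  proof (rule ccontr)
    assume "i \<notin> {1..m}"
    then have "i \<in> {m + 1..m + n}" using i by auto
    then show False using ext_below(2)[of i j] new j i by auto
  qed
  have jn: "j \<le> n" and Pi: "j - 1 < P (i - 1)"
  proof -
    show "j \<le> n"
    proof (cases "P (i - 1) < n")
      case True
      then show ?thesis using ext_pivot[OF im True] i by auto
    next
      case False
      then show ?thesis using ext_no_pivot(2)[OF im False, of j] new j i by force
    qed
    then show "j - 1 < P (i - 1)" using ext_pivot[OF im] i j by (cases "P (i - 1) < n") auto
  qed
  have "P i' \<noteq> j - 1" if "i' < i - 1" for i'
  proof
    assume "P i' = j - 1"
    moreover have "j - 1 < n" "Suc i' \<in> {1..m}" "Suc i' \<in> {1..<i}" using that im jn j by auto
    ultimately show False using ext_pivot[of "Suc i'"] fresh[of "Suc i'"] j by auto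
  qed
  then have "(i - 1, j - 1) \<in> cells" using im jn j Pi by (auto simp: cells_def)
  then show "x \<in> (\<lambda>(i, j). (Suc i, Suc j)) ` cells"
    using x im j by (intro image_eqI[of _ _ "(i - 1, j - 1)"]) auto
next
  fix x assume "x \<in> (\<lambda>(i, j). (Suc i, Suc j)) ` cells"
  then obtain i b where x: "x = (Suc i, Suc b)" and c: "i < m" "b < n" "b < P i" "\<forall>i'<i. P i' \<noteq> b"
    by (auto simp: cells_def)
  have im: "Suc i \<in> {1..m}" using c by auto
  have gt: "ext (Suc i) > Suc b"
    using ext_pivot[OF im] ext_no_pivot(1)[OF im] c by (cases "P i < n") auto
  have "Suc b \<in> ext ` {1..m + n}" using ext_bij c by (auto simp: bij_betw_def)
  then obtain k where k: "k \<in> {1..m + n}" "ext k = Suc b" by auto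
  have "k > Suc i"
  proof (rule ccontr)
    assume "\<not> k > Suc i"
    then have "k < Suc i" using gt k by (cases "k = Suc i") auto
    then have km: "k \<in> {1..m}" using k im by auto
    show False
    proof (cases "P (k - 1) < n")
      case True
      have "k - 1 < i" using km \<open>k < Suc i\<close> by auto
      then have "P (k - 1) \<noteq> b" using c(4) by blast
      then show ?thesis using ext_pivot[OF km True] k by simp
    next
      case False
      then show ?thesis using ext_no_pivot(1)[OF km False] k c by auto
    qed
  qed
  then show "x \<in> rothe_diagram \<omega>" unfolding x rothe_diagram_iff using im gt k by auto
qed

end

text \<open>The bounds at the cells suffice, and they are counted from the cells. Since the sizes
  may differ, the conditions are written with \<open>\<omega>\<close> and the carrier with
  \<open>\<mu>\<close>.\<close>

lemma X_closed_same_diagram: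
  assumes "partial_permutation \<mu>" "partial_permutation \<omega>" "rothe_diagram \<mu> = rothe_diagram \<omega>"
  shows "pivots.cells (dim_row \<mu>) (dim_col \<mu>) (pivot_col \<mu>) =
      pivots.cells (dim_row \<omega>) (dim_col \<omega>) (pivot_col \<omega>)"
    and "A \<in> X_closed \<mu> \<longleftrightarrow> A \<in> carrier_mat (dim_row \<mu>) (dim_col \<mu>) \<and>
      (\<forall>(i, b)\<in>pivots.cells (dim_row \<omega>) (dim_col \<omega>) (pivot_col \<omega>).
         rank_le (Suc i) (Suc b) (card {k. k < Suc i \<and> pivot_col \<omega> k < Suc b}) (\<lambda>i j. A $$ (i, j)))"
proof -
  interpret \<mu>: partial_perm \<mu> "dim_row \<mu>" "dim_col \<mu>" "pivot_col \<mu>" by unfold_locales (rule assms)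
  interpret \<omega>: partial_perm \<omega> "dim_row \<omega>" "dim_col \<omega>" "pivot_col \<omega>" by unfold_locales (rule assms)
  have inj: "inj (\<lambda>(i, j). (Suc i, Suc j))" by (auto intro: injI)
  show cells: "\<mu>.cells = \<omega>.cells"
    using assms(3) unfolding \<mu>.rothe_diagram_eq_cells \<omega>.rothe_diagram_eq_cells
    by (rule inj_image_eq_iff[OF inj, THEN iffD1])
  have "\<mu>.pivot_count (Suc i) (Suc b) = card {k. k < Suc i \<and> pivot_col \<omega> k < Suc b}" if "(i, b) \<in> \<omega>.cells" for i b
    using \<mu>.pivot_count_eq_cells[of i b] \<omega>.pivot_count_eq_cells[of i b] that cells
    by (simp add: \<omega>.pivot_count_def)
  then show "A \<in> X_closed \<mu> \<longleftrightarrow> A \<in> carrier_mat (dim_row \<mu>) (dim_col \<mu>) \<and>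
      (\<forall>(i, b)\<in>\<omega>.cells.
         rank_le (Suc i) (Suc b) (card {k. k < Suc i \<and> pivot_col \<omega> k < Suc b}) (\<lambda>i j. A $$ (i, j)))"
    unfolding \<mu>.X_closed_iff \<mu>.ranks_le_iff_cells cells by auto
qed

section \<open>The block forms\<close>

text \<open>The diagram consists of two rectangles: the rows from \<open>r1\<close> on in the
  \<open>b\<close> columns starting at \<open>r1\<close>, and the last \<open>a\<close> rows in the
  last \<open>c\<close> columns. The prescribed rank is constant on each, so its lower right corner
  decides; both corners lie in the last row, hence the common \<open>p\<close>.\<close>

lemma X_closed_Gr2_tilde_block_form2:
  assumes \<mu>: "partial_permutation \<mu>" and \<omega>: "partial_permutation \<omega>" and D: "rothe_diagram \<mu> = rothe_diagram \<omega>"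
    and form: "\<omega> = block_form2 r1 r2 a b c"
  shows "\<exists>p q1 q2 s1 s2. p \<le> dim_row \<mu> \<and> q1 \<le> q2 \<and> q2 \<le> dim_col \<mu> \<and>
    X_closed \<mu> = {A \<in> carrier_mat (dim_row \<mu>) (dim_col \<mu>).
      rank_le p q1 s1 (\<lambda>i j. A $$ (i, j)) \<and> rank_le p q2 s2 (\<lambda>i j. A $$ (i, j))}"
proof -
  interpret \<mu>: partial_perm \<mu> "dim_row \<mu>" "dim_col \<mu>" "pivot_col \<mu>" by unfold_locales (rule \<mu>)
  interpret \<omega>: partial_perm \<omega> "dim_row \<omega>" "dim_col \<omega>" "pivot_col \<omega>" by unfold_locales (rule \<omega>)
  let ?P = "pivot_col \<omega>" and ?M = "r1 + r2 + a" and ?N = "r1 + b + r2 + c"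
  have dims: "dim_row \<omega> = ?M" "dim_col \<omega> = ?N" by (simp_all add: form block_form2_def)
  have P1: "?P i = i" if "i < r1" for i
    by (rule \<omega>.P_eqI) (use that in \<open>auto simp: form block_form2_def\<close>)
  have P2: "?P i = i + b" if "r1 \<le> i" "i < r1 + r2" for i
    by (rule \<omega>.P_eqI) (use that in \<open>auto simp: form block_form2_def\<close>)
  have P3: "?P i = ?N" if "r1 + r2 \<le> i" "i < ?M" for i
  proof -
    have "?P i = dim_col \<omega>"
      by (rule \<omega>.P_none) (use that in \<open>auto simp: form block_form2_def\<close>)
    then show ?thesis by (simp add: dims)
  qed
  have cellsI: "(i, j) \<in> \<omega>.cells" if "i < ?M" "j < ?N" "j < ?P i" "\<And>k. k < i \<Longrightarrow> ?P k \<noteq> j" for i j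
    using that unfolding \<omega>.cells_def unfolding dims by auto
  let ?cnt = "\<lambda>p q. card {k. k < p \<and> ?P k < q}"
  have cnt_ge: "s \<le> ?cnt p q" if "\<And>k. k < s \<Longrightarrow> k < p \<and> ?P k < q" for s p q
    using card_mono[of "{k. k < p \<and> ?P k < q}" "{..<s}"] that by auto
  have cnt_le: "?cnt p q \<le> s" if "\<And>k. k < p \<Longrightarrow> ?P k < q \<Longrightarrow> k < s" for s p q
    using card_mono[of "{..<s}" "{k. k < p \<and> ?P k < q}"] that by auto
  \<comment> \<open>\<open>C1\<close> and \<open>C2\<close> say that the first and the second
    rectangle are nonempty.\<close>
  define C1 where "C1 \<longleftrightarrow> 0 < b \<and> 0 < r2 + a"
  define C2 where "C2 \<longleftrightarrow> 0 < a \<and> 0 < c"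
  have key: "(\<forall>(i, j)\<in>\<omega>.cells. rank_le (Suc i) (Suc j) (?cnt (Suc i) (Suc j)) x) \<longleftrightarrow>
      (C1 \<longrightarrow> rank_le ?M (r1 + b) r1 x) \<and> (C2 \<longrightarrow> rank_le ?M ?N (r1 + r2) x)"
    and corner1: "C1 \<Longrightarrow> (?M - 1, r1 + b - 1) \<in> \<omega>.cells"
    and corner2: "C2 \<Longrightarrow> (?M - 1, ?N - 1) \<in> \<omega>.cells" for x
  proof -
    show c1: "(?M - 1, r1 + b - 1) \<in> \<omega>.cells" if C1
    proof (rule cellsI)
      show "r1 + b - 1 < ?P (?M - 1)"
        using that P2[of "?M - 1"] P3[of "?M - 1"] by (cases "a = 0") (auto simp: C1_def)
      show "?P k \<noteq> r1 + b - 1" if "k < ?M - 1" for k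
        using that \<open>C1\<close> P1[of k] P2[of k] P3[of k] by (cases "k < r1"; cases "k < r1 + r2") (auto simp: C1_def)
    qed (use that in \<open>auto simp: C1_def\<close>)
    show c2: "(?M - 1, ?N - 1) \<in> \<omega>.cells" if C2
    proof (rule cellsI)
      show "?N - 1 < ?P (?M - 1)"
        using that P3[of "?M - 1"] by (auto simp: C2_def)
      show "?P k \<noteq> ?N - 1" if "k < ?M - 1" for k
        using that \<open>C2\<close> P1[of k] P2[of k] P3[of k] by (cases "k < r1"; cases "k < r1 + r2") (auto simp: C2_def)
    qed (use that in \<open>auto simp: C2_def\<close>)
    show "(\<forall>(i, j)\<in>\<omega>.cells. rank_le (Suc i) (Suc j) (?cnt (Suc i) (Suc j)) x) \<longleftrightarrow>
      (C1 \<longrightarrow> rank_le ?M (r1 + b) r1 x) \<and> (C2 \<longrightarrow> rank_le ?M ?N (r1 + r2) x)"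
    proof (intro iffI conjI impI)
      assume cells: "\<forall>(i, j)\<in>\<omega>.cells. rank_le (Suc i) (Suc j) (?cnt (Suc i) (Suc j)) x"
      show "rank_le ?M (r1 + b) r1 x" if C1
      proof -
        have "rank_le ?M (r1 + b) (?cnt ?M (r1 + b)) x"
          using cells c1[OF that] that by (auto simp: C1_def)
        moreover have "?cnt ?M (r1 + b) \<le> r1"
        proof (rule cnt_le)
          fix k assume "k < ?M" "?P k < r1 + b"
          then show "k < r1" using P2[of k] P3[of k] by (cases "k < r1"; cases "k < r1 + r2") auto
        qed
        ultimately show ?thesis using rank_le_mono by blast
      qed
      show "rank_le ?M ?N (r1 + r2) x" if C2
      proof -
        have "rank_le ?M ?N (?cnt ?M ?N) x"
          using cells c2[OF that] that by (auto simp: C2_def)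
        moreover have "?cnt ?M ?N \<le> r1 + r2"
        proof (rule cnt_le)
          fix k assume "k < ?M" "?P k < ?N"
          then show "k < r1 + r2" using P3[of k] by (cases "k < r1 + r2") auto
        qed
        ultimately show ?thesis using rank_le_mono by blast
      qed
    next
      assume *: "(C1 \<longrightarrow> rank_le ?M (r1 + b) r1 x) \<and> (C2 \<longrightarrow> rank_le ?M ?N (r1 + r2) x)"
      have "rank_le (Suc i) (Suc j) (?cnt (Suc i) (Suc j)) x" if "(i, j) \<in> \<omega>.cells" for i j
      proof -
        have ij: "i < ?M" "j < ?N" "j < ?P i" "\<And>k. k < i \<Longrightarrow> ?P k \<noteq> j"
          using that unfolding \<omega>.cells_def unfolding dims by auto
        have i: "r1 \<le> i" using ij(3) ij(4)[of j] P1[of i] P1[of j] by (cases "i < r1") auto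
        have j: "r1 \<le> j" using ij(4)[of j] P1[of j] i by (cases "j < r1") auto
        have cnt1: "r1 \<le> ?cnt (Suc i) (Suc j)" by (rule cnt_ge) (use P1 i j in auto)
        show ?thesis
        proof (cases "j < r1 + b")
          case True
          then have C1 using i j ij(1) by (auto simp: C1_def)
          then show ?thesis
            using * rank_le_mono[of ?M "r1 + b" r1 x "Suc i" "Suc j", OF _ _ _ cnt1] True ij(1) by (simp add: Suc_le_eq)
        next
          case False
          \<comment> \<open>In this case and the next, row \<open>j - b\<close> would be an earlier
            row with its pivot in column \<open>j\<close>.\<close>
          have i2: "r1 + r2 \<le> i"
          proof (rule ccontr)
            assume "\<not> r1 + r2 \<le> i"
            moreover from this have "j - b < i" "r1 \<le> j - b" "b \<le> j" using P2[of i] ij(3) i False by auto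
            ultimately show False using P2[of "j - b"] ij(4)[of "j - b"] by auto
          qed
          have j2: "r1 + b + r2 \<le> j"
          proof (rule ccontr)
            assume "\<not> r1 + b + r2 \<le> j"
            moreover from this have "j - b < i" "r1 \<le> j - b" "b \<le> j" "j - b < r1 + r2" using i2 False by auto
            ultimately show False using P2[of "j - b"] ij(4)[of "j - b"] by auto
          qed
          have C2 using i2 j2 ij by (auto simp: C2_def)
          have "r1 + r2 \<le> ?cnt (Suc i) (Suc j)"
          proof (rule cnt_ge)
            fix k assume "k < r1 + r2"
            then show "k < Suc i \<and> ?P k < Suc j" using P1[of k] P2[of k] i2 j2 by (cases "k < r1") auto
          qed
          then show ?thesis using * \<open>C2\<close> rank_le_mono[of ?M ?N "r1 + r2" x] ij by (simp add: Suc_le_eq)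
        qed
      qed
      then show "\<forall>(i, j)\<in>\<omega>.cells. rank_le (Suc i) (Suc j) (?cnt (Suc i) (Suc j)) x" by auto
    qed
  qed
  note same = X_closed_same_diagram[OF \<mu> \<omega> D]
  \<comment> \<open>The corner cells also belong to \<open>\<mu>\<close>, so the submatrices fit
    into its size, even where \<open>\<mu>\<close> is smaller than \<open>\<omega>\<close>.\<close>
  have inM: "i < dim_row \<mu> \<and> j < dim_col \<mu>" if "(i, j) \<in> \<omega>.cells" for i j
    using that unfolding same(1)[symmetric] \<mu>.cells_def by auto
  have X: "X_closed \<mu> = {A \<in> carrier_mat (dim_row \<mu>) (dim_col \<mu>).
      (C1 \<longrightarrow> rank_le ?M (r1 + b) r1 (\<lambda>i j. A $$ (i, j))) \<and> (C2 \<longrightarrow> rank_le ?M ?N (r1 + r2) (\<lambda>i j. A $$ (i, j)))}"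
    using same(2) key by auto
  \<comment> \<open>An empty rectangle is accounted for by repeating the other condition or by a
    vacuous one on an empty corner.\<close>
  have triv: "rank_le p 0 0 x" for p x unfolding rank_le_def by simp
  have bounds1: "?M \<le> dim_row \<mu>" "r1 + b \<le> dim_col \<mu>" if C1
    using inM[OF corner1[OF that]] by auto
  have bounds2: "?M \<le> dim_row \<mu>" "?N \<le> dim_col \<mu>" if C2
    using inM[OF corner2[OF that]] by auto
  consider C1 C2 | C1 "\<not> C2" | "\<not> C1" C2 | "\<not> C1" "\<not> C2" by blast
  then show ?thesis
  proof cases
    case 1
    then show ?thesis unfolding X using bounds2
      by (intro exI[of _ ?M] exI[of _ "r1 + b"] exI[of _ ?N] exI[of _ r1] exI[of _ "r1 + r2"]) simp
  next
    case 2
    then show ?thesis unfolding X using bounds1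
      by (intro exI[of _ ?M] exI[of _ "r1 + b"] exI[of _ "r1 + b"] exI[of _ r1] exI[of _ r1]) simp
  next
    case 3
    then show ?thesis unfolding X using bounds2
      by (intro exI[of _ ?M] exI[of _ 0] exI[of _ ?N] exI[of _ 0] exI[of _ "r1 + r2"]) (simp add: triv)
  next
    case 4
    then show ?thesis unfolding X
      by (intro exI[of _ 0] exI[of _ 0] exI[of _ 0] exI[of _ 0] exI[of _ 0]) (simp add: triv)
  qed
qed

text \<open>Now the rectangles are the \<open>a\<close> rows after the first block, from column
  \<open>r1\<close> on, and the last \<open>b\<close> rows, from column \<open>r1 + r2\<close> on.
  Their corners lie in the last column, hence the common \<open>q\<close>.\<close>

lemma X_closed_Gr2_tilde_block_form3:
  assumes \<mu>: "partial_permutation \<mu>" and \<omega>: "partial_permutation \<omega>" and D: "rothe_diagram \<mu> = rothe_diagram \<omega>"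
    and form: "\<omega> = block_form3 r1 r2 a b c"
  shows "\<exists>p1 p2 q s1 s2. p1 \<le> p2 \<and> p2 \<le> dim_row \<mu> \<and> q \<le> dim_col \<mu> \<and>
    X_closed \<mu> = {A \<in> carrier_mat (dim_row \<mu>) (dim_col \<mu>).
      rank_le p1 q s1 (\<lambda>i j. A $$ (i, j)) \<and> rank_le p2 q s2 (\<lambda>i j. A $$ (i, j))}"
proof -
  interpret \<mu>: partial_perm \<mu> "dim_row \<mu>" "dim_col \<mu>" "pivot_col \<mu>" by unfold_locales (rule \<mu>)
  interpret \<omega>: partial_perm \<omega> "dim_row \<omega>" "dim_col \<omega>" "pivot_col \<omega>" by unfold_locales (rule \<omega>)
  let ?P = "pivot_col \<omega>" and ?M = "r1 + a + r2 + b" and ?N = "r1 + r2 + c"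
  have dims: "dim_row \<omega> = ?M" "dim_col \<omega> = ?N" by (simp_all add: form block_form3_def)
  have P1: "?P i = i" if "i < r1" for i
    by (rule \<omega>.P_eqI) (use that in \<open>auto simp: form block_form3_def\<close>)
  have P2: "?P i = i - a" if "r1 + a \<le> i" "i < r1 + a + r2" for i
    by (rule \<omega>.P_eqI) (use that in \<open>auto simp: form block_form3_def\<close>)
  have none: "?P i = ?N" if "r1 \<le> i \<and> i < r1 + a \<or> r1 + a + r2 \<le> i" "i < ?M" for i
  proof -
    have "?P i = dim_col \<omega>"
      by (rule \<omega>.P_none) (use that in \<open>auto simp: form block_form3_def\<close>)
    then show ?thesis by (simp add: dims)
  qed
  have P3: "?P i = ?N" if "r1 \<le> i" "i < r1 + a" for i using none that by simp
  have P4: "?P i = ?N" if "r1 + a + r2 \<le> i" "i < ?M" for i using none that by simp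
  have regions: "i < r1 \<or> r1 \<le> i \<and> i < r1 + a \<or> r1 + a \<le> i \<and> i < r1 + a + r2 \<or> r1 + a + r2 \<le> i" for i
    by linarith
  have cellsI: "(i, j) \<in> \<omega>.cells" if "i < ?M" "j < ?N" "j < ?P i" "\<And>k. k < i \<Longrightarrow> ?P k \<noteq> j" for i j
    using that unfolding \<omega>.cells_def unfolding dims by auto
  \<comment> \<open>The rows with a pivot, collected in \<open>?J\<close>, no longer form an initial
    segment.\<close>
  let ?cnt = "\<lambda>p q. card {k. k < p \<and> ?P k < q}" and ?J = "{..<r1} \<union> {r1 + a..<r1 + a + r2}"
  have cardJ: "card ?J = r1 + r2" by (subst card_Un_disjoint) auto
  have cnt_ge: "card K \<le> ?cnt p q" if "\<And>k. k \<in> K \<Longrightarrow> k < p \<and> ?P k < q" for K p q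
    using card_mono[of "{k. k < p \<and> ?P k < q}" K] that by auto
  have cnt_le: "?cnt p q \<le> card K" if "\<And>k. k < p \<Longrightarrow> ?P k < q \<Longrightarrow> k \<in> K" "finite K" for K p q
    using card_mono[of K "{k. k < p \<and> ?P k < q}"] that by auto
  define C1 where "C1 \<longleftrightarrow> 0 < a \<and> 0 < r2 + c"
  define C2 where "C2 \<longleftrightarrow> 0 < b \<and> 0 < c"
  have key: "(\<forall>(i, j)\<in>\<omega>.cells. rank_le (Suc i) (Suc j) (?cnt (Suc i) (Suc j)) x) \<longleftrightarrow>
      (C1 \<longrightarrow> rank_le (r1 + a) ?N r1 x) \<and> (C2 \<longrightarrow> rank_le ?M ?N (r1 + r2) x)"
    and corner1: "C1 \<Longrightarrow> (r1 + a - 1, ?N - 1) \<in> \<omega>.cells"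
    and corner2: "C2 \<Longrightarrow> (?M - 1, ?N - 1) \<in> \<omega>.cells" for x
  proof -
    show c1: "(r1 + a - 1, ?N - 1) \<in> \<omega>.cells" if C1
    proof (rule cellsI)
      show "?N - 1 < ?P (r1 + a - 1)"
        using that P3[of "r1 + a - 1"] by (auto simp: C1_def)
      show "?P k \<noteq> ?N - 1" if "k < r1 + a - 1" for k
        using that \<open>C1\<close> P1[of k] P3[of k] by (cases "k < r1") (auto simp: C1_def)
    qed (use that in \<open>auto simp: C1_def\<close>)
    show c2: "(?M - 1, ?N - 1) \<in> \<omega>.cells" if C2
    proof (rule cellsI)
      show "?N - 1 < ?P (?M - 1)"
        using that P4[of "?M - 1"] by (auto simp: C2_def)
      show "?P k \<noteq> ?N - 1" if "k < ?M - 1" for k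
        using regions[of k] that \<open>C2\<close> P1[of k] P2[of k] P3[of k] P4[of k] by (elim disjE) (auto simp: C2_def)
    qed (use that in \<open>auto simp: C2_def\<close>)
    show "(\<forall>(i, j)\<in>\<omega>.cells. rank_le (Suc i) (Suc j) (?cnt (Suc i) (Suc j)) x) \<longleftrightarrow>
      (C1 \<longrightarrow> rank_le (r1 + a) ?N r1 x) \<and> (C2 \<longrightarrow> rank_le ?M ?N (r1 + r2) x)"
    proof (intro iffI conjI impI)
      assume cells: "\<forall>(i, j)\<in>\<omega>.cells. rank_le (Suc i) (Suc j) (?cnt (Suc i) (Suc j)) x"
      show "rank_le (r1 + a) ?N r1 x" if C1
      proof -
        have "rank_le (r1 + a) ?N (?cnt (r1 + a) ?N) x"
          using cells c1[OF that] that by (auto simp: C1_def)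
        moreover have "?cnt (r1 + a) ?N \<le> card {..<r1}"
        proof (rule cnt_le)
          fix k assume "k < r1 + a" "?P k < ?N"
          then show "k \<in> {..<r1}" using P3[of k] by (cases "k < r1") auto
        qed simp
        then have "?cnt (r1 + a) ?N \<le> r1" by (simp only: card_lessThan)
        ultimately show ?thesis by (blast intro: rank_le_mono)
      qed
      show "rank_le ?M ?N (r1 + r2) x" if C2
      proof -
        have "rank_le ?M ?N (?cnt ?M ?N) x"
          using cells c2[OF that] that by (auto simp: C2_def)
        moreover have "?cnt ?M ?N \<le> card ?J"
        proof (rule cnt_le)
          fix k assume "k < ?M" "?P k < ?N"
          then show "k \<in> ?J" using regions[of k] P3[of k] P4[of k] by auto
        qed simp
        then have "?cnt ?M ?N \<le> r1 + r2" by (simp only: cardJ)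
        ultimately show ?thesis by (blast intro: rank_le_mono)
      qed
    next
      assume *: "(C1 \<longrightarrow> rank_le (r1 + a) ?N r1 x) \<and> (C2 \<longrightarrow> rank_le ?M ?N (r1 + r2) x)"
      have "rank_le (Suc i) (Suc j) (?cnt (Suc i) (Suc j)) x" if "(i, j) \<in> \<omega>.cells" for i j
      proof -
        have ij: "i < ?M" "j < ?N" "j < ?P i" "\<And>k. k < i \<Longrightarrow> ?P k \<noteq> j"
          using that unfolding \<omega>.cells_def unfolding dims by auto
        have i: "r1 \<le> i" using ij(3) ij(4)[of j] P1[of i] P1[of j] by (cases "i < r1") auto
        have j: "r1 \<le> j" using ij(4)[of j] P1[of j] i by (cases "j < r1") auto
        have cnt1: "r1 \<le> ?cnt (Suc i) (Suc j)" using cnt_ge[of "{..<r1}" "Suc i" "Suc j"] P1 i j by auto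
        show ?thesis
        proof (cases "i < r1 + a")
          case True
          then have C1 using i j ij(2) by (auto simp: C1_def)
          then show ?thesis
            using * rank_le_mono[of "r1 + a" ?N r1 x "Suc i" "Suc j", OF _ _ _ cnt1] True ij(2) by (simp add: Suc_le_eq)
        next
          case False
          have i2: "r1 + a + r2 \<le> i"
          proof (rule ccontr)
            assume "\<not> r1 + a + r2 \<le> i"
            then have "j + a < i" using P2[of i] ij(3) False by auto
            then show False using P2[of "j + a"] ij(4)[of "j + a"] j \<open>\<not> r1 + a + r2 \<le> i\<close> by auto
          qed
          have j2: "r1 + r2 \<le> j"
          proof (rule ccontr)
            assume "\<not> r1 + r2 \<le> j"
            then show False using P2[of "j + a"] ij(4)[of "j + a"] i2 j by auto
          qed
          have C2 using i2 j2 ij by (auto simp: C2_def)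
          have "card ?J \<le> ?cnt (Suc i) (Suc j)"
          proof (rule cnt_ge)
            fix k assume "k \<in> ?J"
            then show "k < Suc i \<and> ?P k < Suc j" using P1[of k] P2[of k] i2 j2 by auto
          qed
          then show ?thesis using * \<open>C2\<close> rank_le_mono[of ?M ?N "r1 + r2" x] ij cardJ by (simp add: Suc_le_eq)
        qed
      qed
      then show "\<forall>(i, j)\<in>\<omega>.cells. rank_le (Suc i) (Suc j) (?cnt (Suc i) (Suc j)) x" by auto
    qed
  qed
  note same = X_closed_same_diagram[OF \<mu> \<omega> D]
  have inM: "i < dim_row \<mu> \<and> j < dim_col \<mu>" if "(i, j) \<in> \<omega>.cells" for i j
    using that unfolding same(1)[symmetric] \<mu>.cells_def by auto
  have X: "X_closed \<mu> = {A \<in> carrier_mat (dim_row \<mu>) (dim_col \<mu>).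
      (C1 \<longrightarrow> rank_le (r1 + a) ?N r1 (\<lambda>i j. A $$ (i, j))) \<and> (C2 \<longrightarrow> rank_le ?M ?N (r1 + r2) (\<lambda>i j. A $$ (i, j)))}"
    using same(2) key by auto
  have triv: "rank_le 0 q 0 x" for q x unfolding rank_le_def by simp
  have bounds1: "r1 + a \<le> dim_row \<mu>" "?N \<le> dim_col \<mu>" if C1
    using inM[OF corner1[OF that]] by auto
  have bounds2: "?M \<le> dim_row \<mu>" "?N \<le> dim_col \<mu>" if C2
    using inM[OF corner2[OF that]] by auto
  consider C1 C2 | C1 "\<not> C2" | "\<not> C1" C2 | "\<not> C1" "\<not> C2" by blast
  then show ?thesis
  proof cases
    case 1
    then show ?thesis unfolding X using bounds2
      by (intro exI[of _ "r1 + a"] exI[of _ ?M] exI[of _ ?N] exI[of _ r1] exI[of _ "r1 + r2"]) simp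
  next
    case 2
    then show ?thesis unfolding X using bounds1
      by (intro exI[of _ "r1 + a"] exI[of _ "r1 + a"] exI[of _ ?N] exI[of _ r1] exI[of _ r1]) simp
  next
    case 3
    then show ?thesis unfolding X using bounds2
      by (intro exI[of _ 0] exI[of _ ?M] exI[of _ ?N] exI[of _ 0] exI[of _ "r1 + r2"]) (simp add: triv)
  next
    case 4
    then show ?thesis unfolding X
      by (intro exI[of _ 0] exI[of _ 0] exI[of _ 0] exI[of _ 0] exI[of _ 0]) (simp add: triv)
  qed
qed

lemma block_form1_eq: "block_form1 r a b = block_form2 r 0 a b 0"
  unfolding block_form1_def block_form2_def by (rule eq_matI) auto

section \<open>Rigidity of the block forms\<close>

definition entry_inner :: "nat \<Rightarrow> nat \<Rightarrow> (nat \<Rightarrow> nat \<Rightarrow> real) \<Rightarrow> (nat \<Rightarrow> nat \<Rightarrow> real) \<Rightarrow> real" where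
  "entry_inner m n a b = (\<Sum>i<m. \<Sum>j<n. a i j * b i j)"

definition normal_to_lines where
  "normal_to_lines m n C a g \<longleftrightarrow>
     (\<forall>v. (\<forall>t. (\<lambda>i j. a i j + t * v i j) \<in> C) \<longrightarrow> entry_inner m n v g = 0)"

text \<open>
  \<open>K\<close> consists of the directions reversed by a reflection which maps \<open>C\<close> to itself and fixes \<open>a\<close>.
\<close>

definition reflection_dirs where
  "reflection_dirs m n C a K \<longleftrightarrow> (\<forall>k\<in>K. entry_inner m n a k = 0) \<and>
     (\<forall>x\<in>C. \<exists>y z. x = (\<lambda>i j. y i j + z i j) \<and> z \<in> K \<and> (\<forall>k\<in>K. entry_inner m n y k = 0) \<and>
        (\<lambda>i j. y i j - z i j) \<in> C)"

text \<open>The criterion of \<open>mean_curvature_vector_eq_0\<close> for a single factor, demanded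
  at every point of \<open>C\<close>.\<close>

definition rigid where
  "rigid m n C \<longleftrightarrow> (\<forall>a\<in>C. \<forall>g. normal_to_lines m n C a g \<longrightarrow>
     (\<forall>K. reflection_dirs m n C a K \<longrightarrow> (\<forall>k\<in>K. entry_inner m n g k = 0)) \<longrightarrow>
     (\<forall>i<m. \<forall>j<n. g i j = 0))"

lemma entry_inner_block:
  assumes "p \<le> m" "q \<le> n" "\<And>i j. \<not> (i < p \<and> j < q) \<Longrightarrow> b i j = 0"
  shows "entry_inner m n a b = (\<Sum>i<p. \<Sum>j<q. a i j * b i j)"
proof -
  have "(\<Sum>j<n. a i j * b i j) = (\<Sum>j<q. a i j * b i j)" for i
    by (rule sum.mono_neutral_right) (use assms in auto)
  moreover have "(\<Sum>i<m. \<Sum>j<q. a i j * b i j) = (\<Sum>i<p. \<Sum>j<q. a i j * b i j)"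
    by (rule sum.mono_neutral_right) (use assms in auto)
  ultimately show ?thesis by (simp add: entry_inner_def)
qed

lemma entry_inner_commute: "entry_inner m n a b = entry_inner m n b a"
  by (simp add: entry_inner_def mult.commute)

lemma entry_inner_transpose: "entry_inner m n (\<lambda>i j. a j i) (\<lambda>i j. b j i) = entry_inner n m a b"
  unfolding entry_inner_def by (rule sum.swap)

lemma sum_delta_mult:
  fixes f :: "nat \<Rightarrow> real"
  shows "(\<Sum>l<p. (if i = l then 1 else 0) * f l) = (if i < p then f i else 0)"
    and "(\<Sum>l<p. f l * (if l = i then 1 else 0)) = (if i < p then f i else 0)"
    and "(\<Sum>l<p. (if l = k then t else 0) * f l) = (if k < p then t * f k else 0)"
    and "(\<Sum>l<p. f l * (if l = k then t else 0)) = (if k < p then f k * t else 0)"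
proof -
  have "(\<Sum>l<p. (if i = l then 1 else 0) * f l) = (\<Sum>l<p. if i = l then f l else 0)"
    "(\<Sum>l<p. f l * (if l = i then 1 else 0)) = (\<Sum>l<p. if i = l then f l else 0)"
    "(\<Sum>l<p. (if l = k then t else 0) * f l) = (\<Sum>l<p. if k = l then t * f l else 0)"
    "(\<Sum>l<p. f l * (if l = k then t else 0)) = (\<Sum>l<p. if k = l then f l * t else 0)"
    by (intro sum.cong; simp)+
  then show "(\<Sum>l<p. (if i = l then 1 else 0) * f l) = (if i < p then f i else 0)"
    "(\<Sum>l<p. f l * (if l = i then 1 else 0)) = (if i < p then f i else 0)"
    "(\<Sum>l<p. (if l = k then t else 0) * f l) = (if k < p then t * f k else 0)"
    "(\<Sum>l<p. f l * (if l = k then t else 0)) = (if k < p then f k * t else 0)"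
    by simp_all
qed

text \<open>Right multiplication by an elementary matrix does not raise the rank, for any
  \<open>t\<close>, including the singular case \<open>j0 = k\<close>, \<open>t = -1\<close>. So the
  whole line stays inside.\<close>

lemma rank_le_add_multiple_of_column:
  assumes "rank_le p q r a" "k < q"
  shows "rank_le p q r (\<lambda>i j. a i j + (if j = j0 then t * a i k else 0))"
proof -
  let ?M = "\<lambda>l j. (if l = j then 1 else 0) + (if l = k then if j = j0 then t else 0 else 0)"
  have "rank_le p q r (\<lambda>i j. \<Sum>l<q. a i l * ?M l j)" by (rule rank_le_mult_right[OF assms(1)])
  moreover have "(\<Sum>l<q. a i l * ?M l j) = a i j + (if j = j0 then t * a i k else 0)" if "j < q" for i j
    using assms(2) that by (simp add: distrib_left sum.distrib sum_delta_mult mult.commute del: mult_if_delta)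
  ultimately show ?thesis by (subst rank_le_cong) auto
qed

lemma rank_le_add_multiple_of_row:
  "rank_le p q r a \<Longrightarrow> k < p \<Longrightarrow> rank_le p q r (\<lambda>i j. a i j + (if i = i0 then t * a k j else 0))"
  using rank_le_add_multiple_of_column[of q p r "\<lambda>i j. a j i" k i0 t] by (simp add: rank_le_transpose[of p q])

text \<open>This is left multiplication by \<open>I - c x x^T\<close>, a Householder reflection when
  \<open>c\<close> is \<open>2 / |x|^2\<close>.\<close>

lemma rank_le_householder_left:
  assumes "rank_le p q r b"
  shows "rank_le p q r (\<lambda>i j. b i j - x i * (c * (\<Sum>l<p. x l * b l j)))"
proof -
  let ?M = "\<lambda>i l. (if i = l then 1 else 0) - x i * (c * x l)"
  have "rank_le p q r (\<lambda>i j. \<Sum>l<p. ?M i l * b l j)" by (rule rank_le_mult_left[OF assms])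
  moreover have "(\<Sum>l<p. ?M i l * b l j) = b i j - x i * (c * (\<Sum>l<p. x l * b l j))" if "i < p" for i j
    using that by (simp add: left_diff_distrib sum_subtractf sum_delta_mult sum_distrib_left mult.assoc del: mult_if_delta)
  ultimately show ?thesis by (subst rank_le_cong) auto
qed

lemma rank_le_householder_right:
  "rank_le p q r b \<Longrightarrow> rank_le p q r (\<lambda>i j. b i j - x j * (c * (\<Sum>l<q. x l * b i l)))"
  using rank_le_householder_left[of q p r "\<lambda>i j. b j i" x c] by (simp add: rank_le_transpose[of p q])

text \<open>
  A column \<open>x\<close> of \<open>g\<close> in the second block is orthogonal to the columns of \<open>a\<close>, by the lines from
  column operations. So the Householder reflection along \<open>x\<close> is admissible and forces \<open>x = 0\<close>. Then
  the lines from row operations make the rows of \<open>g\<close> in the first block orthogonal to those of \<open>a\<close>,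
  and Householder reflections acting on the rows finish the argument.
\<close>

lemma rigid_rank_conditions:
  assumes p: "p \<le> m" and q: "q1 \<le> q2" "q2 \<le> n"
  shows "rigid m n {x. rank_le p q1 s1 x \<and> rank_le p q2 s2 x}"
  unfolding rigid_def
proof (intro ballI allI impI)
  let ?C = "{x. rank_le p q1 s1 x \<and> rank_le p q2 s2 x}"
  fix a g i j
  assume a: "a \<in> ?C" and lines: "normal_to_lines m n ?C a g"
    and refl: "\<forall>K. reflection_dirs m n ?C a K \<longrightarrow> (\<forall>k\<in>K. entry_inner m n g k = 0)"
    and ij: "i < m" "j < n"
  have line: "entry_inner m n v g = 0"
    if "\<And>t. rank_le p q1 s1 (\<lambda>i j. a i j + t * v i j)" "\<And>t. rank_le p q2 s2 (\<lambda>i j. a i j + t * v i j)" for v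
    using lines that unfolding normal_to_lines_def by blast
  \<comment> \<open>Entries outside the larger corner are unconstrained, so each coordinate
    direction there is a line.\<close>
  have outside: "g i j = 0" if "\<not> (i < p \<and> j < q2)" "i < m" "j < n" for i j
  proof -
    let ?v = "\<lambda>i' j'. if i' = i then if j' = j then 1 else 0 else 0"
    have "rank_le p q1 s1 (\<lambda>i j. a i j + t * ?v i j)" "rank_le p q2 s2 (\<lambda>i j. a i j + t * ?v i j)" for t
      using a that q by (subst rank_le_cong[where b = a]; auto)+
    then have "entry_inner m n ?v g = 0" by (rule line)
    moreover have "entry_inner m n ?v g = (\<Sum>i'<m. if i' = i then \<Sum>j'<n. if j' = j then g i' j' else 0 else 0)"
      unfolding entry_inner_def by (intro sum.cong) (auto simp: sum_delta_mult(3))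
    ultimately show ?thesis using that by simp
  qed
  \<comment> \<open>A column \<open>j0\<close> outside the first corner may receive multiples of any
    column of the second corner.\<close>
  have col_orth: "(\<Sum>i<p. a i k * g i j0) = 0" if "k < q2" "q1 \<le> j0" "j0 < q2" for k j0
  proof -
    let ?v = "\<lambda>i j. if i < p then if j = j0 then a i k else 0 else 0"
    have "rank_le p q1 s1 (\<lambda>i j. a i j + t * ?v i j)" for t
      using a that by (subst rank_le_cong[where b = a]) auto
    moreover have "rank_le p q2 s2 (\<lambda>i j. a i j + t * ?v i j)" for t
      using rank_le_add_multiple_of_column[of p q2 s2 a k j0 t] a that
      by (subst rank_le_cong[where b = "\<lambda>i j. a i j + (if j = j0 then t * a i k else 0)"]) auto
    ultimately have "entry_inner m n ?v g = 0" by (rule line)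
    moreover have "entry_inner m n ?v g = (\<Sum>i<p. \<Sum>j<q2. g i j * ?v i j)"
      by (subst entry_inner_commute, rule entry_inner_block) (use p q that in auto)
    moreover have "\<dots> = (\<Sum>i<p. \<Sum>j<q2. if j = j0 then a i k * g i j else 0)"
      by (intro sum.cong) auto
    ultimately show ?thesis using that by simp
  qed
  have second_block: "g i j0 = 0" if j0: "q1 \<le> j0" "j0 < q2" and i: "i < p" for i j0
  proof (rule ccontr)
    assume "g i j0 \<noteq> 0"
    define x where "x i = g i j0" for i
    define s where "s = (\<Sum>i<p. x i * x i)"
    have "0 < x i * x i" using \<open>g i j0 \<noteq> 0\<close> by (auto simp: x_def zero_less_mult_iff)
    also have "x i * x i \<le> s" unfolding s_def by (rule member_le_sum) (use i in auto)
    finally have s: "s > 0" .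
    \<comment> \<open>The matrices \<open>x w^T\<close>, that is, those with all columns parallel to
      \<open>x\<close>, are the directions reversed by the reflection on the left.\<close>
    define z where "z w = (\<lambda>i j. if i < p \<and> j < q2 then x i * w j else (0::real))" for w
    have ip: "entry_inner m n b (z w) = (\<Sum>j<q2. w j * (\<Sum>i<p. x i * b i j))" for b w
    proof -
      have "entry_inner m n b (z w) = (\<Sum>i<p. \<Sum>j<q2. b i j * z w i j)"
        by (rule entry_inner_block) (use p q in \<open>auto simp: z_def\<close>)
      also have "\<dots> = (\<Sum>i<p. \<Sum>j<q2. w j * (x i * b i j))" by (intro sum.cong) (auto simp: z_def)
      also have "\<dots> = (\<Sum>j<q2. w j * (\<Sum>i<p. x i * b i j))"
        by (subst sum.swap) (simp add: sum_distrib_left)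
      finally show ?thesis .
    qed
    have "reflection_dirs m n ?C a (range z)"
      unfolding reflection_dirs_def
    proof (intro conjI ballI)
      show "entry_inner m n a k = 0" if "k \<in> range z" for k
        using that col_orth[OF _ j0] by (auto simp: ip x_def mult.commute)
      fix b assume b: "b \<in> ?C"
      \<comment> \<open>The coefficients of the orthogonal projections of the columns of
        \<open>b\<close> onto \<open>x\<close>; then \<open>y - z w\<close> is the reflected
        matrix.\<close>
      define w where "w j = (\<Sum>i<p. x i * b i j) / s" for j
      define y where "y i j = b i j - z w i j" for i j
      have "entry_inner m n y k = 0" if K: "k \<in> range z" for k
      proof -
        obtain w' where k: "k = z w'" using K by auto
        have "(\<Sum>i<p. x i * y i j) = 0" if "j < q2" for j
        proof -
          have "(\<Sum>i<p. x i * y i j) = (\<Sum>i<p. x i * b i j) - (\<Sum>i<p. x i * x i) * w j"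
            using that by (simp add: y_def z_def right_diff_distrib sum_subtractf sum_distrib_right mult.assoc)
          then show ?thesis using s by (simp add: w_def flip: s_def)
        qed
        then show ?thesis by (simp add: k ip)
      qed
      moreover have "(\<lambda>i j. y i j - z w i j) \<in> ?C"
      proof -
        have "y i j - z w i j = b i j - x i * (2 / s * (\<Sum>l<p. x l * b l j))" if "i < p" "j < q2" for i j
          using that s by (simp add: y_def z_def w_def)
        then show ?thesis
          using rank_le_householder_left[of p q1 s1 b x "2 / s"] rank_le_householder_left[of p q2 s2 b x "2 / s"] b q
          by (auto cong: rank_le_cong)
      qed
      moreover have "b = (\<lambda>i j. y i j + z w i j)" by (simp add: y_def)
      ultimately show "\<exists>y z'. b = (\<lambda>i j. y i j + z' i j) \<and> z' \<in> range z \<and> (\<forall>k\<in>range z. entry_inner m n y k = 0) \<and>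
          (\<lambda>i j. y i j - z' i j) \<in> ?C" by blast
    qed
    \<comment> \<open>With a unit vector for \<open>w\<close>, the inner product with
      \<open>g\<close> is the squared length of \<open>x\<close>.\<close>
    then have "entry_inner m n g (z (\<lambda>j. if j = j0 then 1 else 0)) = 0" using refl by blast
    moreover have "(\<Sum>j<q2. (if j = j0 then 1 else 0) * (\<Sum>i<p. x i * g i j)) = (\<Sum>i<p. x i * g i j0)"
      using j0 by (subst sum_delta_mult(3)) simp
    ultimately have "s = 0" unfolding ip s_def by (simp add: x_def)
    then show False using s by simp
  qed
  have row_orth: "(\<Sum>j<q1. a k j * g i0 j) = 0" if "k < p" "i0 < p" for k i0
  proof -
    let ?v = "\<lambda>i j. if i = i0 then if j < q2 then a k j else 0 else 0"
    have "rank_le p q1 s1 (\<lambda>i j. a i j + t * ?v i j)" for t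
      using rank_le_add_multiple_of_row[of p q1 s1 a k i0 t] a that q
      by (subst rank_le_cong[where b = "\<lambda>i j. a i j + (if i = i0 then t * a k j else 0)"]) auto
    moreover have "rank_le p q2 s2 (\<lambda>i j. a i j + t * ?v i j)" for t
      using rank_le_add_multiple_of_row[of p q2 s2 a k i0 t] a that q
      by (subst rank_le_cong[where b = "\<lambda>i j. a i j + (if i = i0 then t * a k j else 0)"]) auto
    ultimately have "entry_inner m n ?v g = 0" by (rule line)
    moreover have "entry_inner m n ?v g = (\<Sum>i<p. \<Sum>j<q2. g i j * ?v i j)"
      by (subst entry_inner_commute, rule entry_inner_block) (use p q that in auto)
    moreover have "\<dots> = (\<Sum>i<p. if i = i0 then \<Sum>j<q2. a k j * g i j else 0)"
      by (intro sum.cong) (auto intro!: sum.cong)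
    \<comment> \<open>The row operation has to act on the whole larger corner; the sum shortens to
      \<open>q1\<close> because \<open>g\<close> vanishes in the second block.\<close>
    moreover have "(\<Sum>j<q2. a k j * g i0 j) = (\<Sum>j<q1. a k j * g i0 j)"
      by (rule sum.mono_neutral_right) (use q second_block that in auto)
    ultimately show ?thesis using that by simp
  qed
  have first_block: "g i0 j = 0" if j: "j < q1" and i0: "i0 < p" for i0 j
  proof (rule ccontr)
    assume "g i0 j \<noteq> 0"
    \<comment> \<open>Cutting \<open>x\<close> off at \<open>q1\<close> makes the reflection on the
      right act trivially on the later columns, so it respects both corners.\<close>
    define x where "x j = (if j < q1 then g i0 j else 0)" for j
    define s where "s = (\<Sum>j<q1. x j * x j)"
    have "0 < x j * x j" using \<open>g i0 j \<noteq> 0\<close> j by (auto simp: x_def zero_less_mult_iff)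
    also have "x j * x j \<le> s" unfolding s_def by (rule member_le_sum) (use j in auto)
    finally have s: "s > 0" .
    define z where "z w = (\<lambda>i j. if i < p \<and> j < q1 then w i * x j else (0::real))" for w
    have ip: "entry_inner m n b (z w) = (\<Sum>i<p. w i * (\<Sum>j<q1. x j * b i j))" for b w
    proof -
      have "entry_inner m n b (z w) = (\<Sum>i<p. \<Sum>j<q1. b i j * z w i j)"
        by (rule entry_inner_block) (use p q in \<open>auto simp: z_def\<close>)
      also have "\<dots> = (\<Sum>i<p. \<Sum>j<q1. w i * (x j * b i j))" by (intro sum.cong) (auto simp: z_def)
      finally show ?thesis by (simp add: sum_distrib_left)
    qed
    have "reflection_dirs m n ?C a (range z)"
      unfolding reflection_dirs_def
    proof (intro conjI ballI)
      show "entry_inner m n a k = 0" if "k \<in> range z" for k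
      proof -
        have "(\<Sum>j<q1. x j * a i j) = 0" if "i < p" for i
          using row_orth[OF that i0] by (simp add: x_def mult.commute)
        then show ?thesis using that by (auto simp: ip)
      qed
      fix b assume b: "b \<in> ?C"
      define w where "w i = (\<Sum>j<q1. x j * b i j) / s" for i
      define y where "y i j = b i j - z w i j" for i j
      have "entry_inner m n y k = 0" if K: "k \<in> range z" for k
      proof -
        obtain w' where k: "k = z w'" using K by auto
        have "(\<Sum>j<q1. x j * y i j) = 0" if "i < p" for i
        proof -
          have "(\<Sum>j<q1. x j * y i j) = (\<Sum>j<q1. x j * b i j) - w i * (\<Sum>j<q1. x j * x j)"
            using that by (simp add: y_def z_def right_diff_distrib sum_subtractf sum_distrib_left mult.left_commute)
          then show ?thesis using s by (simp add: w_def flip: s_def)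
        qed
        then show ?thesis by (simp add: k ip)
      qed
      moreover have "(\<lambda>i j. y i j - z w i j) \<in> ?C"
      proof -
        have sum2: "(\<Sum>l<q2. x l * b i l) = (\<Sum>l<q1. x l * b i l)" for i
          by (rule sum.mono_neutral_right) (use q in \<open>auto simp: x_def\<close>)
        have "y i j - z w i j = b i j - x j * (2 / s * (\<Sum>l<q1. x l * b i l))" if "i < p" for i j
          using that s by (auto simp: y_def z_def w_def x_def)
        then show ?thesis
          using rank_le_householder_right[of p q1 s1 b x "2 / s"] rank_le_householder_right[of p q2 s2 b x "2 / s"] b q
          by (auto simp: sum2 cong: rank_le_cong)
      qed
      moreover have "b = (\<lambda>i j. y i j + z w i j)" by (simp add: y_def)
      ultimately show "\<exists>y z'. b = (\<lambda>i j. y i j + z' i j) \<and> z' \<in> range z \<and> (\<forall>k\<in>range z. entry_inner m n y k = 0) \<and>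
          (\<lambda>i j. y i j - z' i j) \<in> ?C" by blast
    qed
    then have "entry_inner m n g (z (\<lambda>i. if i = i0 then 1 else 0)) = 0" using refl by blast
    moreover have "(\<Sum>i<p. (if i = i0 then 1 else 0) * (\<Sum>j<q1. x j * g i j)) = (\<Sum>j<q1. x j * g i0 j)"
      using i0 by (subst sum_delta_mult(3)) simp
    ultimately have "s = 0" unfolding ip s_def by (simp add: x_def)
    then show False using s by simp
  qed
  show "g i j = 0"
    using outside first_block second_block ij by (metis not_less)
qed

lemma rigid_transpose:
  assumes "rigid n m C"
  shows "rigid m n {x. (\<lambda>i j. x j i) \<in> C}"
  unfolding rigid_def
proof (intro ballI allI impI)
  let ?C = "{x. (\<lambda>i j. x j i) \<in> C}" and ?t = "\<lambda>(x :: nat \<Rightarrow> nat \<Rightarrow> real) i j. x j i"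
  fix a g i j
  assume a: "a \<in> ?C" and lines: "normal_to_lines m n ?C a g"
    and refl: "\<forall>K. reflection_dirs m n ?C a K \<longrightarrow> (\<forall>k\<in>K. entry_inner m n g k = 0)"
    and ij: "i < m" "j < n"
  have ip: "entry_inner n m (?t x) y = entry_inner m n x (?t y)" for x y
    using entry_inner_transpose[of n m x "?t y"] by simp
  have "normal_to_lines n m C (?t a) (?t g)"
    unfolding normal_to_lines_def
  proof (intro allI impI)
    fix v assume "\<forall>t. (\<lambda>i j. ?t a i j + t * v i j) \<in> C"
    then have "\<forall>t. (\<lambda>i j. a i j + t * ?t v i j) \<in> ?C" by simp
    then show "entry_inner n m v (?t g) = 0"
      using lines entry_inner_transpose[of n m "?t v" g] unfolding normal_to_lines_def by simp
  qed
  moreover have "\<forall>k\<in>K. entry_inner n m (?t g) k = 0" if K: "reflection_dirs n m C (?t a) K" for K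
  proof
    fix k assume k: "k \<in> K"
    have "reflection_dirs m n ?C a (?t ` K)"
      unfolding reflection_dirs_def
    proof (intro conjI ballI)
      show "entry_inner m n a k = 0" if "k \<in> ?t ` K" for k
        using that K ip[of a] unfolding reflection_dirs_def by auto
      fix x assume "x \<in> ?C"
      then obtain y z where yz: "?t x = (\<lambda>i j. y i j + z i j)" "z \<in> K" "\<forall>k\<in>K. entry_inner n m y k = 0"
        "(\<lambda>i j. y i j - z i j) \<in> C"
        using K unfolding reflection_dirs_def by blast
      have "x = (\<lambda>i j. ?t y i j + ?t z i j)" using yz(1) by (metis (full_types))
      moreover have "\<forall>k\<in>?t ` K. entry_inner m n (?t y) k = 0"
        using yz(3) ip[of "?t y"] by auto
      ultimately show "\<exists>y z. x = (\<lambda>i j. y i j + z i j) \<and> z \<in> ?t ` K \<and> (\<forall>k\<in>?t ` K. entry_inner m n y k = 0) \<and>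
          (\<lambda>i j. y i j - z i j) \<in> ?C"
        using yz(2,4) by (intro exI[of _ "?t y"] exI[of _ "?t z"]) auto
    qed
    then have "entry_inner m n g (?t k) = 0" using refl k by blast
    then show "entry_inner n m (?t g) k = 0" by (simp add: ip)
  qed
  ultimately have "\<forall>j<n. \<forall>i<m. ?t g j i = 0"
    using assms a unfolding rigid_def by blast
  then show "g i j = 0" using ij by blast
qed

lemma rigid_Gr2_tilde:
  assumes "\<mu> \<in> Gr2_tilde"
  shows "rigid (dim_row \<mu>) (dim_col \<mu>) {x. Matrix.mat (dim_row \<mu>) (dim_col \<mu>) (\<lambda>(i, j). x i j) \<in> X_closed \<mu>}"
proof -
  let ?m = "dim_row \<mu>" and ?n = "dim_col \<mu>"
  obtain \<omega> where pp: "partial_permutation \<mu>" "partial_permutation \<omega>" and D: "rothe_diagram \<mu> = rothe_diagram \<omega>"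
    and form: "(\<exists>r1 r2 a b c. \<omega> = block_form2 r1 r2 a b c) \<or> (\<exists>r1 r2 a b c. \<omega> = block_form3 r1 r2 a b c)"
    using assms block_form1_eq unfolding Gr2_tilde_def Gr2_def by blast
  have cong: "rank_le p q s (\<lambda>i j. Matrix.mat ?m ?n (\<lambda>(i, j). x i j) $$ (i, j)) \<longleftrightarrow> rank_le p q s x"
    if "p \<le> ?m" "q \<le> ?n" for p q s x
    by (rule rank_le_cong) (use that in auto)
  from form show ?thesis
  proof (elim disjE exE)
    fix r1 r2 a b c assume "\<omega> = block_form2 r1 r2 a b c"
    from X_closed_Gr2_tilde_block_form2[OF pp D this] obtain p q1 q2 s1 s2 where
      b: "p \<le> ?m" "q1 \<le> q2" "q2 \<le> ?n" and
      X: "X_closed \<mu> = {A \<in> carrier_mat ?m ?n. rank_le p q1 s1 (\<lambda>i j. A $$ (i, j)) \<and> rank_le p q2 s2 (\<lambda>i j. A $$ (i, j))}"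
      by blast
    have "{x. Matrix.mat ?m ?n (\<lambda>(i, j). x i j) \<in> X_closed \<mu>} = {x. rank_le p q1 s1 x \<and> rank_le p q2 s2 x}"
      unfolding X using b by (simp add: cong)
    then show ?thesis using rigid_rank_conditions[OF b] by simp
  next
    fix r1 r2 a b c assume "\<omega> = block_form3 r1 r2 a b c"
    from X_closed_Gr2_tilde_block_form3[OF pp D this] obtain p1 p2 q s1 s2 where
      b: "p1 \<le> p2" "p2 \<le> ?m" "q \<le> ?n" and
      X: "X_closed \<mu> = {A \<in> carrier_mat ?m ?n. rank_le p1 q s1 (\<lambda>i j. A $$ (i, j)) \<and> rank_le p2 q s2 (\<lambda>i j. A $$ (i, j))}"
      by blast
    have "{x. Matrix.mat ?m ?n (\<lambda>(i, j). x i j) \<in> X_closed \<mu>} =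
        {x. (\<lambda>i j. x j i) \<in> {x. rank_le q p1 s1 x \<and> rank_le q p2 s2 x}}"
      unfolding X using b by (auto simp: cong rank_le_transpose[of q p1] rank_le_transpose[of q p2])
    then show ?thesis using rigid_transpose[OF rigid_rank_conditions[OF b(3,1,2)]] by simp
  qed
qed

section \<open>Transfer to the Euclidean space of matrices\<close>

lemma index_pos_less: "index_pos (i :: 'i::{finite,linorder}) < CARD('i)"
  using bij_betw_index_pos[where 'i = 'i] by (auto simp: bij_betw_def)

definition index_at :: "nat \<Rightarrow> 'i::{finite,linorder}" where
  "index_at = inv_into UNIV index_pos"

lemma index_at_pos [simp]: "index_at (index_pos i) = i"
  unfolding index_at_def using bij_betw_index_pos by (intro inv_f_f) (auto simp: bij_betw_def)

lemma index_pos_at [simp]: "k < CARD('i) \<Longrightarrow> index_pos (index_at k :: 'i::{finite,linorder}) = k"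
  unfolding index_at_def using bij_betw_index_pos[where 'i = 'i]
  by (intro f_inv_into_f) (auto simp: bij_betw_def)

definition entries :: "real ^ 'n::{finite,linorder} ^ 'm::{finite,linorder} \<Rightarrow> nat \<Rightarrow> nat \<Rightarrow> real" where
  "entries x i j = vec_nth (vec_nth x (index_at i)) (index_at j)"

lemma entries_cart_of_mat:
  "i < CARD('m) \<Longrightarrow> j < CARD('n) \<Longrightarrow>
    entries (cart_of_mat A :: real ^ 'n::{finite,linorder} ^ 'm::{finite,linorder}) i j = A $$ (i, j)"
  by (simp add: entries_def cart_of_mat_def)

lemma linear_entries: "linear (\<lambda>x. entries x i j)"
  by (rule linearI) (simp_all add: entries_def)

lemma cart_of_mat_of_entries:
  "cart_of_mat (Matrix.mat CARD('m) CARD('n) (\<lambda>(i, j). entries x i j)) = (x :: real ^ 'n::{finite,linorder} ^ 'm::{finite,linorder})"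
  by (simp add: Finite_Cartesian_Product.vec_eq_iff cart_of_mat_def index_pos_less) (simp add: entries_def)

lemma cart_of_mat_image_iff:
  fixes x :: "real ^ 'n::{finite,linorder} ^ 'm::{finite,linorder}"
  assumes X: "\<And>A. A \<in> X \<longleftrightarrow> A \<in> carrier_mat CARD('m) CARD('n) \<and> Q (\<lambda>i j. A $$ (i, j))"
    and cong: "\<And>a b. (\<And>i j. \<lbrakk>i < CARD('m); j < CARD('n)\<rbrakk> \<Longrightarrow> a i j = b i j) \<Longrightarrow> Q a \<longleftrightarrow> Q b"
  shows "x \<in> cart_of_mat ` X \<longleftrightarrow> Q (entries x)"
proof
  assume "x \<in> cart_of_mat ` X"
  then obtain A where "A \<in> X" "x = cart_of_mat A" by auto
  then show "Q (entries x)" using X cong[of "entries x" "\<lambda>i j. A $$ (i, j)"] by (simp add: entries_cart_of_mat)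
next
  assume Q: "Q (entries x)"
  let ?A = "Matrix.mat CARD('m) CARD('n) (\<lambda>(i, j). entries x i j)"
  have "?A \<in> X" using X Q cong[of "entries x" "\<lambda>i j. ?A $$ (i, j)"] by simp
  then show "x \<in> cart_of_mat ` X" using cart_of_mat_of_entries[of x] by (metis imageI)
qed

lemma smooth_on_componentwise:
  fixes f :: "'a::euclidean_space \<Rightarrow> real ^ 'n ^ 'm"
  assumes "open U" "\<And>i j. smooth_on U (\<lambda>x. vec_nth (vec_nth (f x) i) j)"
  shows "smooth_on U f"
proof -
  have "smooth_on U (\<lambda>x. f x \<bullet> b)" if b: "b \<in> Basis" for b
  proof -
    obtain i j where "b = axis i (axis j 1)" using b by (auto simp: Basis_vec_def)
    then show ?thesis using assms(2)[of i j] by (simp add: inner_axis)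
  qed
  then have "smooth_on U (\<lambda>x. \<Sum>b\<in>Basis. (f x \<bullet> b) *\<^sub>R b)"
    by (intro smooth_on_sum smooth_on_scaleR smooth_on_const assms(1))
  then show ?thesis by (simp add: euclidean_representation)
qed

text \<open>\<open>\<pi>\<close> erases the entries in the cells, \<open>F\<close> refills them with
  the values forced by the elimination, and \<open>U\<close> is the set where all pivots are
  nonzero.\<close>

lemma X_open_graph_submanifold:
  fixes \<omega> :: "real mat"
  assumes \<omega>: "\<omega> \<in> carrier_mat CARD('m::{finite,linorder}) CARD('n::{finite,linorder})"
    and pp: "partial_permutation \<omega>"
  shows "\<exists>\<pi> F U. graph_submanifold \<pi> F U (cart_of_mat ` X_open \<omega> :: (real ^ 'n::_ ^ 'm::_) set) \<and>
    cart_of_mat ` X_open \<omega> = (cart_of_mat ` X_closed \<omega> \<inter> U :: (real ^ 'n::_ ^ 'm::_) set)"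
proof -
  interpret partial_perm \<omega> "dim_row \<omega>" "dim_col \<omega>" "pivot_col \<omega>" by unfold_locales (rule pp)
  have dims: "dim_row \<omega> = CARD('m)" "dim_col \<omega> = CARD('n)" using \<omega> by auto
  let ?S = "cart_of_mat ` X_open \<omega> :: (real ^ 'n::_ ^ 'm::_) set" and ?C = "cart_of_mat ` X_closed \<omega> :: (real ^ 'n::_ ^ 'm::_) set"
  have rank_cong: "rank_le p q r a \<longleftrightarrow> rank_le p q r b"
    if "\<And>i j. \<lbrakk>i < CARD('m); j < CARD('n)\<rbrakk> \<Longrightarrow> a i j = b i j" "p \<le> CARD('m)" "q \<le> CARD('n)" for a b p q r
    by (rule rank_le_cong) (use that in auto)
  have rank_cong': "rank_le p q r a \<longleftrightarrow> rank_le p q r b"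
    if "\<And>i j. \<lbrakk>i < CARD('m); j < CARD('n)\<rbrakk> \<Longrightarrow> a i j = b i j" "p \<le> dim_row \<omega>" "q \<le> dim_col \<omega>" for a b p q r
    using rank_cong[of a b p q r] that dims by simp
  have S_iff: "x \<in> ?S \<longleftrightarrow> ranks_eq (entries x)" for x
  proof (rule cart_of_mat_image_iff)
    show "A \<in> X_open \<omega> \<longleftrightarrow> A \<in> carrier_mat CARD('m) CARD('n) \<and> ranks_eq (\<lambda>i j. A $$ (i, j))" for A
      by (simp only: X_open_iff dims)
    show "ranks_eq a \<longleftrightarrow> ranks_eq b" if "\<And>i j. \<lbrakk>i < CARD('m); j < CARD('n)\<rbrakk> \<Longrightarrow> a i j = b i j" for a b
      unfolding ranks_eq_def using rank_cong'[OF that] by simp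
  qed
  have C_iff: "x \<in> ?C \<longleftrightarrow> ranks_le (entries x)" for x
  proof (rule cart_of_mat_image_iff)
    show "A \<in> X_closed \<omega> \<longleftrightarrow> A \<in> carrier_mat CARD('m) CARD('n) \<and> ranks_le (\<lambda>i j. A $$ (i, j))" for A
      by (simp only: X_closed_iff dims)
    show "ranks_le a \<longleftrightarrow> ranks_le b" if "\<And>i j. \<lbrakk>i < CARD('m); j < CARD('n)\<rbrakk> \<Longrightarrow> a i j = b i j" for a b
      unfolding ranks_le_def using rank_cong'[OF that] by simp
  qed
  define \<pi> :: "real ^ 'n::_ ^ 'm::_ \<Rightarrow> real ^ 'n::_ ^ 'm::_" where
    "\<pi> x = (\<chi> i j. if (index_pos i, index_pos j) \<in> cells then 0 else vec_nth (vec_nth x i) j)" for x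
  define F :: "real ^ 'n::_ ^ 'm::_ \<Rightarrow> real ^ 'n::_ ^ 'm::_" where
    "F x = (\<chi> i j. if (index_pos i, index_pos j) \<in> cells
      then \<Sum>k<index_pos i. ecoeff (entries x) (index_pos i) k * erow (entries x) k (index_pos j) else 0)" for x
  define U :: "(real ^ 'n::_ ^ 'm::_) set" where "U = {x. good (entries x)}"
  have pos: "index_pos (i :: 'm) < dim_row \<omega>" "index_pos (j :: 'n) < dim_col \<omega>" for i j
    using index_pos_less dims by metis+
  have ent: "entries (\<pi> x) i j = entries x i j" if "i < dim_row \<omega>" "j < dim_col \<omega>" "(i, j) \<notin> cells" for x i j
    using that by (simp add: entries_def \<pi>_def dims)
  have smooth: "open {x::real ^ 'n::_ ^ 'm::_. \<forall>i<k. pivot_col \<omega> i < dim_col \<omega> \<longrightarrow> erow (entries x) i (pivot_col \<omega> i) \<noteq> 0}"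
     "smooth_on {x::real ^ 'n::_ ^ 'm::_. \<forall>i<k. pivot_col \<omega> i < dim_col \<omega> \<longrightarrow> erow (entries x) i (pivot_col \<omega> i) \<noteq> 0} (\<lambda>x. erow (entries x) k b)"
     "smooth_on {x::real ^ 'n::_ ^ 'm::_. \<forall>i<k. pivot_col \<omega> i < dim_col \<omega> \<longrightarrow> erow (entries x) i (pivot_col \<omega> i) \<noteq> 0} (\<lambda>x. ecoeff (entries x) k i)"
    for k b i
    using elim_smooth[where a = "entries :: real ^ 'n::_ ^ 'm::_ \<Rightarrow> _", OF linear_entries] by blast+
  have openU: "open U" using smooth(1)[of "dim_row \<omega>"] by (simp add: U_def good_def)
  have smoothU: "smooth_on U (\<lambda>x. erow (entries x) k b)" "smooth_on U (\<lambda>x. ecoeff (entries x) k i)"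
    if "k < dim_row \<omega>" for k b i
  proof -
    have "U \<subseteq> {x. \<forall>i<k. pivot_col \<omega> i < dim_col \<omega> \<longrightarrow> erow (entries x) i (pivot_col \<omega> i) \<noteq> 0}"
      using that by (auto simp: U_def good_def)
    then show "smooth_on U (\<lambda>x. erow (entries x) k b)" "smooth_on U (\<lambda>x. ecoeff (entries x) k i)"
      using smooth_on_subset smooth(2,3) by blast+
  qed
  have "graph_submanifold \<pi> F U ?S"
  proof (rule graph_submanifold.intro)
    show "linear \<pi>" by (rule linearI) (simp_all add: \<pi>_def Finite_Cartesian_Product.vec_eq_iff)
    show "\<pi> (\<pi> x) = \<pi> x" for x by (simp add: \<pi>_def Finite_Cartesian_Product.vec_eq_iff)
    show "open U" by (rule openU)
    show "\<pi> x \<in> U \<longleftrightarrow> x \<in> U" for x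
      unfolding U_def good_def using elim_cong(2)[of "entries (\<pi> x)" "entries x"] ent by simp
    show "F (\<pi> x) = F x" for x
    proof -
      have "(\<Sum>k<index_pos i. ecoeff (entries (\<pi> x)) (index_pos i) k * erow (entries (\<pi> x)) k (index_pos j)) =
          (\<Sum>k<index_pos i. ecoeff (entries x) (index_pos i) k * erow (entries x) k (index_pos j))"
        for i :: 'm and j :: 'n
      proof (rule sum.cong[OF refl])
        fix k assume "k \<in> {..<index_pos i}"
        then have "k < dim_row \<omega>" using pos(1)[of i] by simp
        then show "ecoeff (entries (\<pi> x)) (index_pos i) k * erow (entries (\<pi> x)) k (index_pos j) =
            ecoeff (entries x) (index_pos i) k * erow (entries x) k (index_pos j)"
          using elim_cong[of "entries (\<pi> x)" "entries x"] ent pos by simp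
      qed
      then show ?thesis unfolding F_def by (simp only:)
    qed
    show "\<pi> (F x) = 0" for x by (simp add: \<pi>_def F_def Finite_Cartesian_Product.vec_eq_iff)
    show "smooth_on U F"
    proof (rule smooth_on_componentwise[OF openU])
      fix i :: 'm and j :: 'n
      have "smooth_on U (\<lambda>x. \<Sum>k<index_pos i. ecoeff (entries x) (index_pos i) k * erow (entries x) k (index_pos j))"
        using pos(1)[of i] by (intro smooth_on_sum smooth_on_mult openU smoothU) auto
      then show "smooth_on U (\<lambda>x. vec_nth (vec_nth (F x) i) j)"
        by (cases "(index_pos i, index_pos j) \<in> cells") (simp_all add: F_def smooth_on_const)
    qed
    show "?S = {x \<in> U. x - \<pi> x = F x}"
    proof -
      have "x - \<pi> x = F x \<longleftrightarrow> on_graph (entries x)" for x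
      proof
        assume eq: "x - \<pi> x = F x"
        show "on_graph (entries x)"
          unfolding on_graph_def
        proof (intro ballI, unfold split_paired_all prod.case)
          fix i b assume c: "(i, b) \<in> cells"
          then have "i < dim_row \<omega>" "b < dim_col \<omega>" by (auto simp: cells_def)
          then have "i < CARD('m)" "b < CARD('n)" by (simp_all add: dims)
          moreover have "vec_nth (vec_nth (x - \<pi> x) (index_at i)) (index_at b) = vec_nth (vec_nth (F x) (index_at i)) (index_at b)"
            using eq by simp
          ultimately show "entries x i b = (\<Sum>k<i. ecoeff (entries x) i k * erow (entries x) k b)"
            using c by (simp add: \<pi>_def F_def entries_def[of x i b])
        qed
      next
        assume g: "on_graph (entries x)"
        have "entries x (index_pos i) (index_pos j) = vec_nth (vec_nth x i) j" for i j
          by (simp add: entries_def)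
        then show "x - \<pi> x = F x"
          using g unfolding on_graph_def by (auto simp: Finite_Cartesian_Product.vec_eq_iff \<pi>_def F_def)
      qed
      then show ?thesis using S_iff ranks_eq_iff_on_graph by (auto simp: U_def)
    qed
  qed
  moreover have "?S = ?C \<inter> U"
    by (rule Set.set_eqI) (simp only: Int_iff S_iff C_iff U_def mem_Collect_eq ranks_eq_iff_good conj_commute)
  ultimately show ?thesis by blast
qed

lemma cart_of_mat_add:
  "A \<in> carrier_mat CARD('m) CARD('n) \<Longrightarrow> B \<in> carrier_mat CARD('m) CARD('n) \<Longrightarrow>
    cart_of_mat (A + B) = (cart_of_mat A + cart_of_mat B :: real ^ 'n::{finite,linorder} ^ 'm::{finite,linorder})"
  by (simp add: Finite_Cartesian_Product.vec_eq_iff cart_of_mat_def index_pos_less)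

lemma cart_of_mat_smult:
  "A \<in> carrier_mat CARD('m) CARD('n) \<Longrightarrow>
    cart_of_mat (c \<cdot>\<^sub>m A) = (c *\<^sub>R cart_of_mat A :: real ^ 'n::{finite,linorder} ^ 'm::{finite,linorder})"
  by (simp add: Finite_Cartesian_Product.vec_eq_iff cart_of_mat_def index_pos_less)

lemma mat_inner_entry_inner:
  assumes "A \<in> carrier_mat m n" "B \<in> carrier_mat m n"
  shows "mat_inner A B = entry_inner m n (\<lambda>i j. A $$ (i, j)) (\<lambda>i j. B $$ (i, j))"
proof -
  have "mat_inner A B = (\<Sum>j<n. \<Sum>i<m. A $$ (i, j) * B $$ (i, j))"
    using assms unfolding mat_inner_def by (auto simp: scalar_prod_def atLeast0LessThan intro!: sum.cong)
  then show ?thesis unfolding entry_inner_def by (simp add: sum.swap[of _ "{..<m}"])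
qed

lemma listset_iff: "xs \<in> listset Ss \<longleftrightarrow> length xs = length Ss \<and> (\<forall>i<length Ss. xs ! i \<in> Ss ! i)"
proof (induction Ss arbitrary: xs)
  case Nil
  then show ?case by simp
next
  case (Cons A Ss)
  show ?case
    by (cases xs) (auto simp: set_Cons_def Cons.IH nth_Cons split: nat.splits)
qed

section \<open>Transport of lines and reflections along a congruence\<close>

locale product_embedding =
  fixes \<omega> :: "real mat" and \<omega>s :: "real mat list" and N :: nat and \<Phi> :: "real mat list \<times> real Matrix.vec \<Rightarrow> real mat"
    and emb :: "real mat list \<Rightarrow> real Matrix.vec \<Rightarrow> real ^ 'n::{finite,linorder} ^ 'm::{finite,linorder}"
  assumes \<omega>: "\<omega> \<in> carrier_mat CARD('m) CARD('n)"
    and \<Phi>: "\<Phi> \<in> product_space \<omega>s N \<rightarrow> carrier_mat (dim_row \<omega>) (dim_col \<omega>)"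
    and \<Phi>_add: "\<forall>(As, v) \<in> product_space \<omega>s N. \<forall>(Bs, w) \<in> product_space \<omega>s N.
           \<Phi> (map2 (+) As Bs, v + w) = \<Phi> (As, v) + \<Phi> (Bs, w)"
    and \<Phi>_smult: "\<forall>c. \<forall>(As, v) \<in> product_space \<omega>s N.
           \<Phi> (map (\<lambda>A. c \<cdot>\<^sub>m A) As, c \<cdot>\<^sub>v v) = c \<cdot>\<^sub>m \<Phi> (As, v)"
    and \<Phi>_inner: "\<forall>(As, v) \<in> product_space \<omega>s N. \<forall>(Bs, w) \<in> product_space \<omega>s N.
           mat_inner (\<Phi> (As, v)) (\<Phi> (Bs, w)) =
             (\<Sum>j<length \<omega>s. mat_inner (As ! j) (Bs ! j)) + scalar_prod v w"
    and \<Phi>_X: "\<Phi> ` product_X_closed \<omega>s N = X_closed \<omega>"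
  defines "emb \<equiv> \<lambda>As v. cart_of_mat (\<Phi> (As, v))"
begin

text \<open>\<open>\<Phi>\<close> is known to be linear and isometric on
  \<open>product_space\<close> only, so the rules below are guarded by this predicate.\<close>

definition space where
  "space As v \<longleftrightarrow> length As = length \<omega>s \<and> v \<in> carrier_vec N \<and>
     (\<forall>j<length \<omega>s. As ! j \<in> carrier_mat (dim_row (\<omega>s ! j)) (dim_col (\<omega>s ! j)))"

definition closed_space where
  "closed_space As v \<longleftrightarrow> length As = length \<omega>s \<and> v \<in> carrier_vec N \<and> (\<forall>j<length \<omega>s. As ! j \<in> X_closed (\<omega>s ! j))"

lemma space_iff: "(As, v) \<in> product_space \<omega>s N \<longleftrightarrow> space As v"
  unfolding product_space_def space_def by (auto simp: listset_iff)

lemma closed_space_iff: "(As, v) \<in> product_X_closed \<omega>s N \<longleftrightarrow> closed_space As v"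
  unfolding product_X_closed_def closed_space_def by (auto simp: listset_iff)

lemma closed_space_imp_space: "closed_space As v \<Longrightarrow> space As v"
  unfolding closed_space_def space_def X_closed_def by blast

lemma image_carrier: "space As v \<Longrightarrow> \<Phi> (As, v) \<in> carrier_mat CARD('m) CARD('n)"
  using \<Phi> \<omega> by (auto simp: Pi_iff space_iff)

lemma emb_add: "\<lbrakk>space As v; space Bs w\<rbrakk> \<Longrightarrow> emb (map2 (+) As Bs) (v + w) = emb As v + emb Bs w"
proof -
  assume sp: "space As v" "space Bs w"
  have "\<forall>(Bs, w)\<in>product_space \<omega>s N. \<Phi> (map2 (+) As Bs, v + w) = \<Phi> (As, v) + \<Phi> (Bs, w)"
    using bspec[OF \<Phi>_add, of "(As, v)"] sp by (simp add: space_iff)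
  from bspec[OF this, of "(Bs, w)"] show ?thesis
    using sp image_carrier by (simp add: emb_def space_iff cart_of_mat_add)
qed

lemma emb_smult: "space As v \<Longrightarrow> emb (map (\<lambda>A. c \<cdot>\<^sub>m A) As) (c \<cdot>\<^sub>v v) = c *\<^sub>R emb As v"
  using bspec[OF spec[OF \<Phi>_smult, of c], of "(As, v)"] image_carrier[of As v] unfolding emb_def
  by (simp add: space_iff cart_of_mat_smult)

lemma emb_inner:
  "\<lbrakk>space As v; space Bs w\<rbrakk> \<Longrightarrow>
    emb As v \<bullet> emb Bs w = (\<Sum>j<length \<omega>s. mat_inner (As ! j) (Bs ! j)) + scalar_prod v w"
  using \<Phi>_inner image_carrier[of As v] image_carrier[of Bs w] unfolding emb_def
  by (auto simp: space_iff[symmetric] inner_cart_of_mat)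

abbreviation C :: "(real ^ 'n::_ ^ 'm::_) set" where "C \<equiv> cart_of_mat ` X_closed \<omega>"

lemma C_iff: "x \<in> C \<longleftrightarrow> (\<exists>As v. closed_space As v \<and> x = emb As v)"
  unfolding \<Phi>_X[symmetric] emb_def by (force simp: closed_space_iff)

definition "zeros = map (\<lambda>\<mu>. 0\<^sub>m (dim_row \<mu>) (dim_col \<mu>) :: real mat) \<omega>s"

definition "W = {emb As v | As v. space As v}"

lemma space_zeros: "v \<in> carrier_vec N \<Longrightarrow> space zeros v"
  by (simp add: space_def zeros_def)

lemma space_add: "\<lbrakk>space As v; space Bs w\<rbrakk> \<Longrightarrow> space (map2 (+) As Bs) (v + w)"
  by (simp add: space_def)

lemma space_smult: "space As v \<Longrightarrow> space (map (\<lambda>A. c \<cdot>\<^sub>m A) As) (c \<cdot>\<^sub>v v)"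
  by (simp add: space_def)

lemma subspace_W: "Real_Vector_Spaces.subspace W"
proof (rule Real_Vector_Spaces.subspaceI)
  have z: "space zeros (0\<^sub>v N)" by (simp add: space_zeros)
  show "0 \<in> W"
    using emb_smult[OF z, of 0] space_smult[OF z, of 0] unfolding W_def by force
  show "x + y \<in> W" if "x \<in> W" "y \<in> W" for x y
    using that emb_add space_add unfolding W_def by (smt (verit) mem_Collect_eq)
  show "c *\<^sub>R x \<in> W" if "x \<in> W" for c x
    using that emb_smult space_smult unfolding W_def by (smt (verit) mem_Collect_eq)
qed

definition mat_at where
  "mat_at j x = Matrix.mat (dim_row (\<omega>s ! j)) (dim_col (\<omega>s ! j)) (\<lambda>(i, k). x i k :: real)"

text \<open>The restriction of the embedding to factor \<open>j\<close>, with zero in all other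
  components.\<close>

definition inc where "inc j x = emb (zeros[j := mat_at j x]) (0\<^sub>v N)"

lemma space_update:
  "space As v \<Longrightarrow> j < length \<omega>s \<Longrightarrow> space (As[j := mat_at j x]) v"
  by (auto simp: space_def mat_at_def nth_list_update)

text \<open>Moving along \<open>inc j y\<close> changes component \<open>j\<close> only, so lines
  and reflections of one factor act on \<open>C\<close> with the other components held
  fixed.\<close>

lemma emb_update_add:
  assumes "space As v" "j < length \<omega>s"
  shows "emb (As[j := mat_at j x]) v + t *\<^sub>R inc j y = emb (As[j := mat_at j (\<lambda>i k. x i k + t * y i k)]) v"
proof -
  have z: "space (zeros[j := mat_at j y]) (0\<^sub>v N)" using assms by (intro space_update space_zeros) auto
  have "emb (As[j := mat_at j x]) v + t *\<^sub>R inc j y =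
      emb (map2 (+) (As[j := mat_at j x]) (map (\<lambda>A. t \<cdot>\<^sub>m A) (zeros[j := mat_at j y]))) (v + t \<cdot>\<^sub>v 0\<^sub>v N)"
    unfolding inc_def using emb_add[OF space_update[OF assms] space_smult[OF z]] emb_smult[OF z] by simp
  also have "map2 (+) (As[j := mat_at j x]) (map (\<lambda>A. t \<cdot>\<^sub>m A) (zeros[j := mat_at j y])) =
      As[j := mat_at j (\<lambda>i k. x i k + t * y i k)]"
  proof (rule nth_equalityI)
    have len: "length As = length \<omega>s" "length zeros = length \<omega>s" using assms(1) by (auto simp: space_def zeros_def)
    then show "length (map2 (+) (As[j := mat_at j x]) (map (\<lambda>A. t \<cdot>\<^sub>m A) (zeros[j := mat_at j y]))) =
      length (As[j := mat_at j (\<lambda>i k. x i k + t * y i k)])" by simp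
    fix i assume "i < length (map2 (+) (As[j := mat_at j x]) (map (\<lambda>A. t \<cdot>\<^sub>m A) (zeros[j := mat_at j y])))"
    then have i: "i < length \<omega>s" using len by simp
    have "As ! i \<in> carrier_mat (dim_row (\<omega>s ! i)) (dim_col (\<omega>s ! i))" using assms(1) i by (simp add: space_def)
    then have "As ! i + t \<cdot>\<^sub>m zeros ! i = As ! i" using i by (auto simp: zeros_def intro!: eq_matI)
    moreover have "mat_at j x + t \<cdot>\<^sub>m mat_at j y = mat_at j (\<lambda>i k. x i k + t * y i k)"
      by (auto simp: mat_at_def intro!: eq_matI)
    ultimately show "map2 (+) (As[j := mat_at j x]) (map (\<lambda>A. t \<cdot>\<^sub>m A) (zeros[j := mat_at j y])) ! i =
      As[j := mat_at j (\<lambda>i k. x i k + t * y i k)] ! i"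
      using i len by (cases "i = j") simp_all
  qed
  also have "v + t \<cdot>\<^sub>v 0\<^sub>v N = v" using assms(1) by (auto simp: space_def intro!: eq_vecI)
  finally show ?thesis .
qed

lemma emb_update_inner:
  assumes "space As v" "j < length \<omega>s"
  shows "emb (As[j := mat_at j x]) v \<bullet> inc j y = entry_inner (dim_row (\<omega>s ! j)) (dim_col (\<omega>s ! j)) x y"
proof -
  have z: "space (zeros[j := mat_at j y]) (0\<^sub>v N)" using assms by (intro space_update space_zeros) auto
  have len: "length As = length \<omega>s" "length zeros = length \<omega>s" using assms(1) by (auto simp: space_def zeros_def)
  have 1: "mat_inner (As[j := mat_at j x] ! i) (zeros[j := mat_at j y] ! i) =
      (if i = j then entry_inner (dim_row (\<omega>s ! j)) (dim_col (\<omega>s ! j)) x y else 0)" if "i < length \<omega>s" for i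
  proof (cases "i = j")
    case True
    have "mat_inner (mat_at j x) (mat_at j y) = entry_inner (dim_row (\<omega>s ! j)) (dim_col (\<omega>s ! j)) x y"
      by (subst mat_inner_entry_inner[of _ "dim_row (\<omega>s ! j)" "dim_col (\<omega>s ! j)"])
        (auto simp: mat_at_def entry_inner_def)
    then show ?thesis using True len assms(2) by simp
  next
    case False
    have A: "As ! i \<in> carrier_mat (dim_row (\<omega>s ! i)) (dim_col (\<omega>s ! i))" using assms(1) that by (simp add: space_def)
    have "mat_inner (As ! i) (0\<^sub>m (dim_row (\<omega>s ! i)) (dim_col (\<omega>s ! i))) = 0"
      by (subst mat_inner_entry_inner[OF A]) (auto simp: entry_inner_def)
    then show ?thesis using False that by (simp add: zeros_def)
  qed
  have "emb (As[j := mat_at j x]) v \<bullet> inc j y =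
      (\<Sum>i<length \<omega>s. mat_inner (As[j := mat_at j x] ! i) (zeros[j := mat_at j y] ! i)) + scalar_prod v (0\<^sub>v N)"
    unfolding inc_def by (rule emb_inner[OF space_update[OF assms] z])
  also have "scalar_prod v (0\<^sub>v N) = 0" using assms(1) by (simp add: space_def scalar_prod_right_zero)
  finally show ?thesis using 1 assms(2) by simp
qed

lemma mat_at_entries:
  "space As v \<Longrightarrow> j < length \<omega>s \<Longrightarrow> As[j := mat_at j (\<lambda>i k. As ! j $$ (i, k))] = As"
proof -
  assume "space As v" "j < length \<omega>s"
  then have "As ! j \<in> carrier_mat (dim_row (\<omega>s ! j)) (dim_col (\<omega>s ! j))" by (simp add: space_def)
  then have "mat_at j (\<lambda>i k. As ! j $$ (i, k)) = As ! j" by (auto simp: mat_at_def)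
  then show ?thesis by simp
qed

lemma closed_update:
  "closed_space As v \<Longrightarrow> mat_at j x \<in> X_closed (\<omega>s ! j) \<Longrightarrow> closed_space (As[j := mat_at j x]) v"
  unfolding closed_space_def by (metis length_list_update nth_list_update_eq nth_list_update_neq)

lemma normal_vector_eq_0:
  assumes Gr: "set \<omega>s \<subseteq> Gr2_tilde" and p: "p \<in> C"
    and lines: "\<And>v. (\<And>t. p + t *\<^sub>R v \<in> C) \<Longrightarrow> h \<bullet> v = 0"
    and refl: "\<And>K. (\<And>k. k \<in> K \<Longrightarrow> p \<bullet> k = 0) \<Longrightarrow>
        (\<And>c. c \<in> C \<Longrightarrow> \<exists>y z. c = y + z \<and> z \<in> span K \<and> (\<forall>k\<in>K. y \<bullet> k = 0) \<and> y - z \<in> C) \<Longrightarrow>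
        (\<And>k. k \<in> K \<Longrightarrow> h \<bullet> k = 0)"
  shows "h = 0"
proof -
  obtain As v where As: "closed_space As v" "p = emb As v" using p C_iff by blast
  note spA = closed_space_imp_space[OF As(1)]
  have CW: "c \<in> W" if "c \<in> C" for c using that C_iff closed_space_imp_space unfolding W_def by blast
  have spanW: "span W = W" using subspace_W span_eq_iff by blast
  \<comment> \<open>\<open>C\<close> lies in the subspace \<open>W\<close>, so the reflection that
    reverses the part \<open>z\<close> of \<open>h\<close> orthogonal to \<open>W\<close> fixes
    \<open>C\<close> pointwise. Hence \<open>z\<close> vanishes.\<close>
  have "h \<in> W"
  proof -
    obtain y z where yz: "y \<in> span W" "\<And>w. w \<in> span W \<Longrightarrow> real_inner_class.orthogonal z w" "h = y + z"
      using orthogonal_subspace_decomp_exists by blast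
    have z: "w \<bullet> z = 0" if "w \<in> W" for w
      using yz(2)[of w] that spanW by (simp add: real_inner_class.orthogonal_def inner_commute)
    have "h \<bullet> z = 0"
    proof (rule refl[of "{z}"])
      show "p \<bullet> k = 0" if "k \<in> {z}" for k using z[OF CW[OF p]] that by simp
      show "\<exists>y za. c = y + za \<and> za \<in> span {z} \<and> (\<forall>k\<in>{z}. y \<bullet> k = 0) \<and> y - za \<in> C" if "c \<in> C" for c
        using z[OF CW[OF that]] that span_zero by (intro exI[of _ c] exI[of _ 0]) auto
    qed simp
    then have "z \<bullet> z = 0" using z yz(1,3) spanW by (simp add: inner_add_left)
    then show ?thesis using yz(1,3) spanW by simp
  qed
  then obtain Gs g where G: "space Gs g" "h = emb Gs g" unfolding W_def by blast
  \<comment> \<open>The Euclidean component is unconstrained, so \<open>g\<close> itself is the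
    direction of a line in \<open>C\<close>.\<close>
  have gg: "scalar_prod g g = 0"
  proof -
    have g: "g \<in> carrier_vec N" and v: "v \<in> carrier_vec N" using G spA by (auto simp: space_def)
    have z: "space zeros g" by (rule space_zeros[OF g])
    have "p + t *\<^sub>R emb zeros g \<in> C" for t
    proof -
      have "p + t *\<^sub>R emb zeros g = emb (map2 (+) As (map (\<lambda>A. t \<cdot>\<^sub>m A) zeros)) (v + t \<cdot>\<^sub>v g)"
        using emb_add[OF spA space_smult[OF z]] emb_smult[OF z] As(2) by simp
      also have "map2 (+) As (map (\<lambda>A. t \<cdot>\<^sub>m A) zeros) = As"
      proof (rule nth_equalityI)
        show "length (map2 (+) As (map (\<lambda>A. t \<cdot>\<^sub>m A) zeros)) = length As"
          using spA by (simp add: space_def zeros_def)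
        fix i assume "i < length (map2 (+) As (map (\<lambda>A. t \<cdot>\<^sub>m A) zeros))"
        then have i: "i < length \<omega>s" "length As = length \<omega>s" using spA by (simp_all add: space_def zeros_def)
        have "As ! i \<in> carrier_mat (dim_row (\<omega>s ! i)) (dim_col (\<omega>s ! i))" using spA i by (simp add: space_def)
        then show "map2 (+) As (map (\<lambda>A. t \<cdot>\<^sub>m A) zeros) ! i = As ! i"
          using i by (auto simp: zeros_def intro!: eq_matI)
      qed
      finally have "p + t *\<^sub>R emb zeros g = emb As (v + t \<cdot>\<^sub>v g)" .
      moreover have "closed_space As (v + t \<cdot>\<^sub>v g)" using As(1) g v by (simp add: closed_space_def)
      ultimately show ?thesis using C_iff by blast
    qed
    then have "h \<bullet> emb zeros g = 0" by (rule lines)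
    moreover have "mat_inner (Gs ! i) (zeros ! i) = 0" if "i < length \<omega>s" for i
    proof -
      have "Gs ! i \<in> carrier_mat (dim_row (\<omega>s ! i)) (dim_col (\<omega>s ! i))" using G that by (simp add: space_def)
      from mat_inner_entry_inner[OF this, of "zeros ! i"] show ?thesis
        using that by (auto simp: zeros_def entry_inner_def)
    qed
    ultimately show ?thesis using emb_inner[OF G(1) z] G(2) by simp
  qed
  have "mat_inner (Gs ! j) (Gs ! j) = 0" if j: "j < length \<omega>s" for j
  proof -
    let ?m = "dim_row (\<omega>s ! j)" and ?n = "dim_col (\<omega>s ! j)"
    let ?a = "\<lambda>i k. As ! j $$ (i, k)" and ?g = "\<lambda>i k. Gs ! j $$ (i, k)"
    let ?X = "{x. mat_at j x \<in> X_closed (\<omega>s ! j)}"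
    note A_eq = mat_at_entries[OF spA j] and G_eq = mat_at_entries[OF G(1) j]
    have "rigid ?m ?n ?X"
      unfolding mat_at_def by (rule rigid_Gr2_tilde) (use Gr j nth_mem in blast)
    moreover have in_X: "(\<lambda>i k. Bs ! j $$ (i, k)) \<in> ?X" if "closed_space Bs w" for Bs w
    proof -
      have "Bs[j := mat_at j (\<lambda>i k. Bs ! j $$ (i, k))] ! j \<in> X_closed (\<omega>s ! j)"
        using that j mat_at_entries[OF closed_space_imp_space[OF that] j] by (simp add: closed_space_def)
      then show ?thesis using that j by (simp add: closed_space_def)
    qed
    moreover have h_inc: "h \<bullet> inc j y = entry_inner ?m ?n ?g y" for y
      using emb_update_inner[OF G(1) j, of ?g y] G_eq G(2) by simp
    moreover have p_inc: "p \<bullet> inc j y = entry_inner ?m ?n ?a y" for y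
      using emb_update_inner[OF spA j, of ?a y] A_eq As(2) by simp
    moreover have "normal_to_lines ?m ?n ?X ?a ?g"
      unfolding normal_to_lines_def
    proof (intro allI impI)
      fix V assume V: "\<forall>t. (\<lambda>i k. ?a i k + t * V i k) \<in> ?X"
      have "p + t *\<^sub>R inc j V \<in> C" for t
        using emb_update_add[OF spA j, of ?a t V] A_eq As closed_update[OF As(1), of j] V C_iff by auto
      then have "h \<bullet> inc j V = 0" by (rule lines)
      then show "entry_inner ?m ?n V ?g = 0" using h_inc entry_inner_commute by metis
    qed
    \<comment> \<open>A reflection of factor \<open>j\<close> is extended by the identity on the
      other components; the splitting of component \<open>j\<close> then splits the whole
      point.\<close>
    moreover have "entry_inner ?m ?n ?g k = 0" if K: "reflection_dirs ?m ?n ?X ?a K" and k: "k \<in> K" for K k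
    proof -
      have "h \<bullet> inc j k = 0"
      proof (rule refl[of "inc j ` K"])
        show "p \<bullet> k = 0" if "k \<in> inc j ` K" for k
          using that K p_inc unfolding reflection_dirs_def by auto
        fix c assume "c \<in> C"
        then obtain Bs w where B: "closed_space Bs w" "c = emb Bs w" using C_iff by blast
        note spB = closed_space_imp_space[OF B(1)]
        obtain y z where yz: "(\<lambda>i k. Bs ! j $$ (i, k)) = (\<lambda>i k. y i k + z i k)" "z \<in> K"
          "\<forall>k\<in>K. entry_inner ?m ?n y k = 0" "(\<lambda>i k. y i k - z i k) \<in> ?X"
          using K in_X[OF B(1)] unfolding reflection_dirs_def by blast
        define y' where "y' = emb (Bs[j := mat_at j y]) w"
        have "c = y' + inc j z"
          \<comment> \<open>The scalars 1 and -1, here and below, give the point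
            \<open>y + z\<close> and its mirror image \<open>y - z\<close>.\<close>
          using emb_update_add[OF spB j, of y 1 z] mat_at_entries[OF spB j] yz(1) B(2) by (simp add: y'_def)
        moreover have "y' - inc j z \<in> C"
          using emb_update_add[OF spB j, of y "-1" z] closed_update[OF B(1), of j] yz(4) C_iff by (auto simp: y'_def)
        moreover have "\<forall>k\<in>inc j ` K. y' \<bullet> k = 0"
          using emb_update_inner[OF spB j, of y] yz(3) by (auto simp: y'_def)
        ultimately show "\<exists>y z. c = y + z \<and> z \<in> span (inc j ` K) \<and> (\<forall>k\<in>inc j ` K. y \<bullet> k = 0) \<and> y - z \<in> C"
          using yz(2) span_base by blast
      qed (use k in simp)
      then show ?thesis using h_inc by simp
    qed
    ultimately have zero: "\<forall>i<?m. \<forall>k<?n. ?g i k = 0"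
      using As(1) unfolding rigid_def by blast
    have Gj: "Gs ! j \<in> carrier_mat ?m ?n" using G(1) j by (simp add: space_def)
    show ?thesis using zero by (simp add: mat_inner_entry_inner[OF Gj Gj] entry_inner_def)
  qed
  then have "h \<bullet> h = 0" using emb_inner[OF G(1) G(1)] gg G(2) by simp
  then show ?thesis by simp
qed

end

section \<open>Existence of a decomposition, and minimality\<close>

lemma congruent_to_product_refl:
  fixes \<omega> :: "real mat"
  shows "congruent_to_product \<omega> [\<omega>] 0"
proof -
  define \<Phi> where "\<Phi> x = hd (fst x)" for x :: "real mat list \<times> real Matrix.vec"
  have carrier0: "carrier_vec 0 = {0\<^sub>v 0 :: real Matrix.vec}" by (auto intro!: eq_vecI)
  have X: "product_X_closed [\<omega>] 0 = (\<lambda>A. ([A], 0\<^sub>v 0)) ` X_closed \<omega>"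
    unfolding product_X_closed_def carrier0 by (auto simp: set_Cons_def)
  have "\<Phi> ` product_X_closed [\<omega>] 0 = X_closed \<omega>"
    unfolding X \<Phi>_def by (simp add: image_image)
  then show ?thesis
    unfolding congruent_to_product_def
    by (intro bexI[of _ \<Phi>]) (auto simp: \<Phi>_def product_space_def set_Cons_def scalar_prod_def)
qed

theorem theorem3:
  fixes \<omega> :: "real mat"
  assumes "\<omega> \<in> carrier_mat CARD('m::{finite,linorder}) CARD('n::{finite,linorder})"
    and "partial_permutation \<omega>"
    and "vexillary \<omega>"
    and "(1, 1) \<in> rothe_diagram \<omega>"
  shows "(\<exists>\<omega>s N. (\<forall>\<mu>\<in>set \<omega>s. partial_permutation \<mu> \<and> vexillary \<mu>) \<and>
            congruent_to_product \<omega> \<omega>s N) \<and>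
         (\<forall>\<omega>s N. (\<forall>\<mu>\<in>set \<omega>s. partial_permutation \<mu> \<and> vexillary \<mu>) \<longrightarrow>
            congruent_to_product \<omega> \<omega>s N \<longrightarrow> set \<omega>s \<subseteq> Gr2_tilde \<longrightarrow>
            minimal_submanifold (cart_of_mat ` X_open \<omega> :: (real ^ 'n::_ ^ 'm::_) set))"
proof (intro conjI allI impI)
  show "\<exists>\<omega>s N. (\<forall>\<mu>\<in>set \<omega>s. partial_permutation \<mu> \<and> vexillary \<mu>) \<and> congruent_to_product \<omega> \<omega>s N"
    using assms(2,3) congruent_to_product_refl by (intro exI[of _ "[\<omega>]"] exI[of _ 0]) simp
next
  fix \<omega>s N
  assume cong: "congruent_to_product \<omega> \<omega>s N" and Gr: "set \<omega>s \<subseteq> Gr2_tilde"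
  let ?S = "cart_of_mat ` X_open \<omega> :: (real ^ 'n::_ ^ 'm::_) set"
  obtain \<Phi> where "product_embedding TYPE('m) TYPE('n) \<omega> \<omega>s N \<Phi>"
    using cong assms(1) unfolding congruent_to_product_def product_embedding_def by blast
  then interpret product_embedding \<omega> \<omega>s N \<Phi> "\<lambda>As v. cart_of_mat (\<Phi> (As, v)) :: real ^ 'n::_ ^ 'm::_" .
  obtain \<pi> F U where graph: "graph_submanifold \<pi> F U ?S" and S: "?S = C \<inter> U"
    using X_open_graph_submanifold[OF assms(1,2)] by blast
  interpret graph_submanifold \<pi> F U ?S by (rule graph)
  have "mean_curvature_vector ?S p = 0" if p: "p \<in> ?S" for p
  proof (rule mean_curvature_vector_eq_0[OF p S])
    fix h assume "\<And>v. (\<And>t. p + t *\<^sub>R v \<in> C) \<Longrightarrow> h \<bullet> v = 0"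
      "\<And>K k. (\<And>k. k \<in> K \<Longrightarrow> p \<bullet> k = 0) \<Longrightarrow>
        (\<And>c. c \<in> C \<Longrightarrow> \<exists>y z. c = y + z \<and> z \<in> span K \<and> (\<forall>k\<in>K. y \<bullet> k = 0) \<and> y - z \<in> C) \<Longrightarrow>
        k \<in> K \<Longrightarrow> h \<bullet> k = 0"
    moreover have "p \<in> C" using p S by blast
    ultimately show "h = 0" using normal_vector_eq_0[OF Gr] by blast
  qed
  then show "minimal_submanifold ?S"
    unfolding minimal_submanifold_def using smooth_submanifold_graph by blast
qed

end
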